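(* Let $(M,\omega,J)$ be a Stein manifold of complex dimension $n$ with complex structure $J$ and a symplectic form $\omega$ taming $J$. Let $L_1$ and $L_2$ be smooth Lagrangian submanifolds of $M$ intersecting transversely at a point $p$. Then the union $L_1\cup L_2$ is locally p.s.h. convex near $p$.
   Context: A Stein manifold is a complex manifold admitting a smooth strictly plurisubharmonic (p.s.h.) exhaustion function. The symplectic form $\omega$ tames $J$ if $\omega(v,Jv)>0$ for every nonzero tangent vector $v$. A submanifold $L\subset M$ is Lagrangian if $\omega|_L=0$ and $\dim_{\mathbb{R}}L=n$. Distances on $M$ are those of the Riemannian metric $h(u,v)=\frac12(\omega(u,Jv)+\omega(v,Ju))$, and $\mathbb{B}(p,\varepsilon)$ is the corresponding open ball. For a compact subset $K$ of a complex manifold $U$, its p.s.h. convex hull is $\widehat{K}^{psh}_U=\{q\in U: u(q)\le\sup_K u$ for all continuous p.s.h. functions $u:U\to\mathbb{R}\}$, and $K$ is p.s.h. convex in $U$ if $\widehat{K}^{psh}_U=K$. A closed subset $S$ of a complex manifold $M$ is locally p.s.h. convex near a point $p\in M$ if there exists a Stein neighbourhood $U$ of $p$ such that for every sufficiently small $\varepsilon>0$ the set $S\cap\overline{\mathbb{B}(p,\varepsilon)}$ is p.s.h. convex in $U$. This depends only on $S$ near $p$, so it is applied equally to sets that are closed in a neighbourhood of $p$ (submanifolds being embedded). *)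

theory Defs
  imports "HOL-Analysis.Analysis"
begin

section \<open>Smooth and holomorphic maps between open sets of Euclidean spaces\<close>

primrec Ck_on :: "nat \<Rightarrow> ('a::euclidean_space \<Rightarrow> 'b::real_normed_vector) \<Rightarrow> 'a set \<Rightarrow> bool" where
  "Ck_on 0 f S \<longleftrightarrow> continuous_on S f"
| "Ck_on (Suc k) f S \<longleftrightarrow>
     (\<forall>x\<in>S. f differentiable (at x)) \<and>
     (\<forall>v. Ck_on k (\<lambda>x. frechet_derivative f (at x) v) S)"

text \<open>Only used for open \<open>S\<close>.\<close>

definition smooth_on :: "('a::euclidean_space \<Rightarrow> 'b::real_normed_vector) \<Rightarrow> 'a set \<Rightarrow> bool" where
  "smooth_on f S \<longleftrightarrow> (\<forall>k. Ck_on k f S)"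

definition holo_map_on :: "(complex^'n \<Rightarrow> complex^'n) \<Rightarrow> (complex^'n::finite) set \<Rightarrow> bool" where
  "holo_map_on f S \<longleftrightarrow>
     (\<forall>z\<in>S. \<exists>f'. (f has_derivative f') (at z) \<and> (\<forall>c v. f' (c *s v) = c *s f' v))"


section \<open>Complex manifolds\<close>

text \<open>
  The manifold is the whole type \<open>'m\<close>; its complex structure is given by an atlas of charts with
  values in \<open>complex^'n\<close>, so the complex dimension is \<open>CARD('n)\<close>. A chart is a pair of its
  domain and its coordinate map (whose values outside the domain are irrelevant).
\<close>

type_synonym ('m, 'n) chart = "'m set \<times> ('m \<Rightarrow> complex^'n)"

definition chart_inv :: "('m, 'n::finite) chart \<Rightarrow> complex^'n \<Rightarrow> 'm" where
  "chart_inv \<phi> = inv_into (fst \<phi>) (snd \<phi>)"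

definition complex_atlas ::
    "('m::{t2_space, second_countable_topology}, 'n::finite) chart set \<Rightarrow> bool" where
  "complex_atlas A \<longleftrightarrow>
     (\<Union>\<phi>\<in>A. fst \<phi>) = UNIV \<and>
     (\<forall>\<phi>\<in>A. open (fst \<phi>) \<and> open (snd \<phi> ` fst \<phi>) \<and>
        homeomorphism (fst \<phi>) (snd \<phi> ` fst \<phi>) (snd \<phi>) (chart_inv \<phi>)) \<and>
     (\<forall>\<phi>\<in>A. \<forall>\<psi>\<in>A. holo_map_on (snd \<psi> \<circ> chart_inv \<phi>) (snd \<phi> ` (fst \<phi> \<inter> fst \<psi>)))"

definition smooth_fun_on ::
    "('m::topological_space, 'n::finite) chart set \<Rightarrow> 'm set \<Rightarrow> ('m \<Rightarrow> real) \<Rightarrow> bool" where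
  "smooth_fun_on A U u \<longleftrightarrow> (\<forall>\<phi>\<in>A. smooth_on (u \<circ> chart_inv \<phi>) (snd \<phi> ` (fst \<phi> \<inter> U)))"


section \<open>Plurisubharmonic functions and Stein manifolds\<close>

text \<open>Submean value property on every closed complex disc contained in the open set \<open>V\<close>.\<close>

definition cont_psh :: "(complex^'n::finite) set \<Rightarrow> (complex^'n \<Rightarrow> real) \<Rightarrow> bool" where
  "cont_psh V u \<longleftrightarrow> continuous_on V u \<and>
     (\<forall>z w. (\<forall>\<zeta>. cmod \<zeta> \<le> 1 \<longrightarrow> z + \<zeta> *s w \<in> V) \<longrightarrow>
        u z \<le> (1 / (2 * pi)) * integral {0..2 * pi} (\<lambda>\<theta>. u (z + cis \<theta> *s w)))"

text \<open>
  The Levi form \<open>\<Sum>\<^sub>j\<^sub>k (\<partial>\<^sup>2u / \<partial>z\<^sub>j \<partial>\<bar>z\<^sub>k) w\<^sub>j \<bar>w\<^sub>k\<close>: one quarter of the Laplacian at 0 of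
  \<open>\<zeta> \<mapsto> u (z + \<zeta> w)\<close>.
\<close>

definition levi_form :: "(complex^'n::finite \<Rightarrow> real) \<Rightarrow> complex^'n \<Rightarrow> complex^'n \<Rightarrow> real" where
  "levi_form u z w =
     (frechet_derivative (\<lambda>x. frechet_derivative u (at x) w) (at z) w +
      frechet_derivative (\<lambda>x. frechet_derivative u (at x) (\<i> *s w)) (at z) (\<i> *s w)) / 4"

definition cont_psh_on ::
    "('m::topological_space, 'n::finite) chart set \<Rightarrow> 'm set \<Rightarrow> ('m \<Rightarrow> real) \<Rightarrow> bool" where
  "cont_psh_on A U u \<longleftrightarrow> (\<forall>\<phi>\<in>A. cont_psh (snd \<phi> ` (fst \<phi> \<inter> U)) (u \<circ> chart_inv \<phi>))"

definition smooth_strictly_psh_on ::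
    "('m::topological_space, 'n::finite) chart set \<Rightarrow> 'm set \<Rightarrow> ('m \<Rightarrow> real) \<Rightarrow> bool" where
  "smooth_strictly_psh_on A U u \<longleftrightarrow> smooth_fun_on A U u \<and>
     (\<forall>\<phi>\<in>A. \<forall>z\<in>snd \<phi> ` (fst \<phi> \<inter> U). \<forall>w. w \<noteq> 0 \<longrightarrow> levi_form (u \<circ> chart_inv \<phi>) z w > 0)"

text \<open>An open subset \<open>U\<close>, with the complex structure induced by \<open>A\<close>, is Stein.\<close>

definition stein_on :: "('m::topological_space, 'n::finite) chart set \<Rightarrow> 'm set \<Rightarrow> bool" where
  "stein_on A U \<longleftrightarrow> open U \<and>
     (\<exists>\<rho>. smooth_strictly_psh_on A U \<rho> \<and> (\<forall>c. compact {q \<in> U. \<rho> q \<le> c}))"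

definition psh_hull ::
    "('m::topological_space, 'n::finite) chart set \<Rightarrow> 'm set \<Rightarrow> 'm set \<Rightarrow> 'm set" where
  "psh_hull A U K = {q \<in> U. \<forall>u. cont_psh_on A U u \<longrightarrow> u q \<le> (SUP x\<in>K. u x)}"

definition psh_convex_in ::
    "('m::topological_space, 'n::finite) chart set \<Rightarrow> 'm set \<Rightarrow> 'm set \<Rightarrow> bool" where
  "psh_convex_in A U K \<longleftrightarrow> compact K \<and> K \<subseteq> U \<and> psh_hull A U K = K"


section \<open>Tangent vectors and the complex structure\<close>

text \<open>
  A tangent vector at \<open>p\<close> is the family of its coordinate representations in all charts around
  \<open>p\<close>, extended by 0 to all other charts.
\<close>

type_synonym ('m, 'n) tvec = "('m, 'n) chart \<Rightarrow> complex^'n"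

definition tangent_space ::
    "('m::topological_space, 'n::finite) chart set \<Rightarrow> 'm \<Rightarrow> ('m, 'n) tvec set" where
  "tangent_space A p =
     {v. (\<forall>\<phi>\<in>A. \<forall>\<psi>\<in>A. p \<in> fst \<phi> \<inter> fst \<psi> \<longrightarrow>
            v \<psi> = frechet_derivative (snd \<psi> \<circ> chart_inv \<phi>) (at (snd \<phi> p)) (v \<phi>)) \<and>
         (\<forall>\<phi>. \<not> (\<phi> \<in> A \<and> p \<in> fst \<phi>) \<longrightarrow> v \<phi> = 0)}"

definition tv_zero :: "('m, 'n::finite) tvec" where
  "tv_zero = (\<lambda>\<phi>. 0)"

definition tv_add :: "('m, 'n::finite) tvec \<Rightarrow> ('m, 'n) tvec \<Rightarrow> ('m, 'n) tvec" where
  "tv_add v w = (\<lambda>\<phi>. v \<phi> + w \<phi>)"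

definition tv_scale :: "real \<Rightarrow> ('m, 'n::finite) tvec \<Rightarrow> ('m, 'n) tvec" where
  "tv_scale r v = (\<lambda>\<phi>. r *\<^sub>R v \<phi>)"

definition Jop :: "('m, 'n::finite) tvec \<Rightarrow> ('m, 'n) tvec" where
  "Jop v = (\<lambda>\<phi>. \<i> *s v \<phi>)"

text \<open>The tangent vector at \<open>p\<close> whose representation in the chart \<open>\<phi>\<close> is \<open>a\<close>.\<close>

definition coord_vec ::
    "('m::topological_space, 'n::finite) chart set \<Rightarrow> ('m, 'n) chart \<Rightarrow> 'm \<Rightarrow> complex^'n \<Rightarrow> ('m, 'n) tvec"
  where
  "coord_vec A \<phi> p a = (\<lambda>\<psi>. if \<psi> \<in> A \<and> p \<in> fst \<psi>
     then frechet_derivative (snd \<psi> \<circ> chart_inv \<phi>) (at (snd \<phi> p)) a else 0)"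


section \<open>Symplectic forms\<close>

type_synonym ('m, 'n) two_form = "'m \<Rightarrow> ('m, 'n) tvec \<Rightarrow> ('m, 'n) tvec \<Rightarrow> real"

definition alternating_bilinear_on ::
    "('m, 'n::finite) tvec set \<Rightarrow> (('m, 'n) tvec \<Rightarrow> ('m, 'n) tvec \<Rightarrow> real) \<Rightarrow> bool" where
  "alternating_bilinear_on T b \<longleftrightarrow>
     (\<forall>u\<in>T. \<forall>v\<in>T. \<forall>w\<in>T. b (tv_add u v) w = b u w + b v w) \<and>
     (\<forall>r. \<forall>u\<in>T. \<forall>w\<in>T. b (tv_scale r u) w = r * b u w) \<and>
     (\<forall>u\<in>T. \<forall>v\<in>T. b u v = - b v u)"

definition form_coeff ::
    "('m::topological_space, 'n::finite) chart set \<Rightarrow> ('m, 'n) two_form \<Rightarrow> ('m, 'n) chart \<Rightarrow>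
     complex^'n \<Rightarrow> complex^'n \<Rightarrow> complex^'n \<Rightarrow> real" where
  "form_coeff A \<omega> \<phi> a b = (\<lambda>z. \<omega> (chart_inv \<phi> z)
     (coord_vec A \<phi> (chart_inv \<phi> z) a) (coord_vec A \<phi> (chart_inv \<phi> z) b))"

definition smooth_two_form ::
    "('m::topological_space, 'n::finite) chart set \<Rightarrow> ('m, 'n) two_form \<Rightarrow> bool" where
  "smooth_two_form A \<omega> \<longleftrightarrow>
     (\<forall>p. alternating_bilinear_on (tangent_space A p) (\<omega> p)) \<and>
     (\<forall>\<phi>\<in>A. \<forall>a b. smooth_on (form_coeff A \<omega> \<phi> a b) (snd \<phi> ` fst \<phi>))"

text \<open>\<open>d\<omega> = 0\<close>, evaluated on constant coordinate vector fields (whose Lie brackets vanish).\<close>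

definition closed_two_form ::
    "('m::topological_space, 'n::finite) chart set \<Rightarrow> ('m, 'n) two_form \<Rightarrow> bool" where
  "closed_two_form A \<omega> \<longleftrightarrow>
     (\<forall>\<phi>\<in>A. \<forall>z\<in>snd \<phi> ` fst \<phi>. \<forall>a b c.
        frechet_derivative (form_coeff A \<omega> \<phi> b c) (at z) a +
        frechet_derivative (form_coeff A \<omega> \<phi> c a) (at z) b +
        frechet_derivative (form_coeff A \<omega> \<phi> a b) (at z) c = 0)"

definition symplectic_form ::
    "('m::topological_space, 'n::finite) chart set \<Rightarrow> ('m, 'n) two_form \<Rightarrow> bool" where
  "symplectic_form A \<omega> \<longleftrightarrow> smooth_two_form A \<omega> \<and> closed_two_form A \<omega> \<and>
     (\<forall>p. \<forall>u\<in>tangent_space A p. (\<forall>v\<in>tangent_space A p. \<omega> p u v = 0) \<longrightarrow> u = tv_zero)"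

definition tames_J ::
    "('m::topological_space, 'n::finite) chart set \<Rightarrow> ('m, 'n) two_form \<Rightarrow> bool" where
  "tames_J A \<omega> \<longleftrightarrow> (\<forall>p. \<forall>v\<in>tangent_space A p. v \<noteq> tv_zero \<longrightarrow> \<omega> p v (Jop v) > 0)"


section \<open>Curves, Riemannian distance and balls\<close>

definition smooth_curve_on ::
    "('m::topological_space, 'n::finite) chart set \<Rightarrow> real set \<Rightarrow> (real \<Rightarrow> 'm) \<Rightarrow> bool" where
  "smooth_curve_on A I \<gamma> \<longleftrightarrow> open I \<and> continuous_on I \<gamma> \<and>
     (\<forall>\<phi>\<in>A. smooth_on (snd \<phi> \<circ> \<gamma>) {t \<in> I. \<gamma> t \<in> fst \<phi>})"

definition velocity ::
    "('m::topological_space, 'n::finite) chart set \<Rightarrow> (real \<Rightarrow> 'm) \<Rightarrow> real \<Rightarrow> ('m, 'n) tvec" where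
  "velocity A \<gamma> t = (\<lambda>\<phi>. if \<phi> \<in> A \<and> \<gamma> t \<in> fst \<phi>
     then vector_derivative (snd \<phi> \<circ> \<gamma>) (at t) else 0)"

definition piecewise_smooth_curve ::
    "('m::topological_space, 'n::finite) chart set \<Rightarrow> (real \<Rightarrow> 'm) \<Rightarrow> bool" where
  "piecewise_smooth_curve A \<gamma> \<longleftrightarrow> continuous_on {0..1} \<gamma> \<and>
     (\<exists>(m::nat) t. t 0 = 0 \<and> t m = 1 \<and>
        (\<forall>i<m. t i < t (Suc i) \<and>
           (\<exists>I g. {t i..t (Suc i)} \<subseteq> I \<and> smooth_curve_on A I g \<and>
              (\<forall>s\<in>{t i..t (Suc i)}. \<gamma> s = g s))))"

definition riem_metric ::
    "('m, 'n::finite) two_form \<Rightarrow> 'm \<Rightarrow> ('m, 'n) tvec \<Rightarrow> ('m, 'n) tvec \<Rightarrow> real" where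
  "riem_metric \<omega> p u v = (\<omega> p u (Jop v) + \<omega> p v (Jop u)) / 2"

definition curve_length ::
    "('m::topological_space, 'n::finite) chart set \<Rightarrow> ('m, 'n) two_form \<Rightarrow> (real \<Rightarrow> 'm) \<Rightarrow> real" where
  "curve_length A \<omega> \<gamma> =
     integral {0..1} (\<lambda>t. sqrt (riem_metric \<omega> (\<gamma> t) (velocity A \<gamma> t) (velocity A \<gamma> t)))"

text \<open>Infinite if \<open>p\<close> and \<open>q\<close> lie in different components.\<close>

definition riem_dist ::
    "('m::topological_space, 'n::finite) chart set \<Rightarrow> ('m, 'n) two_form \<Rightarrow> 'm \<Rightarrow> 'm \<Rightarrow> ereal" where
  "riem_dist A \<omega> p q =
     (INF \<gamma>\<in>{\<gamma>. piecewise_smooth_curve A \<gamma> \<and> \<gamma> 0 = p \<and> \<gamma> 1 = q}. ereal (curve_length A \<omega> \<gamma>))"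

definition riem_ball ::
    "('m::topological_space, 'n::finite) chart set \<Rightarrow> ('m, 'n) two_form \<Rightarrow> 'm \<Rightarrow> real \<Rightarrow> 'm set" where
  "riem_ball A \<omega> p \<epsilon> = {q. riem_dist A \<omega> p q < ereal \<epsilon>}"


section \<open>Lagrangian submanifolds\<close>

text \<open>Embedded submanifolds of real dimension \<open>k\<close>, by slice charts: \<open>dim\<close> is the real dimension.\<close>

definition embedded_submanifold ::
    "('m::topological_space, 'n::finite) chart set \<Rightarrow> nat \<Rightarrow> 'm set \<Rightarrow> bool" where
  "embedded_submanifold A k L \<longleftrightarrow>
     (\<forall>q\<in>L. \<exists>\<phi>\<in>A. \<exists>V W F G E.
        q \<in> fst \<phi> \<and> snd \<phi> q \<in> V \<and> V \<subseteq> snd \<phi> ` fst \<phi> \<and> open V \<and> open W \<and>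
        homeomorphism V W F G \<and> smooth_on F V \<and> smooth_on G W \<and>
        subspace (E :: (complex^'n) set) \<and> dim E = k \<and>
        F ` (V \<inter> snd \<phi> ` (fst \<phi> \<inter> L)) = W \<inter> E)"

definition submanifold_tangent_space ::
    "('m::topological_space, 'n::finite) chart set \<Rightarrow> 'm set \<Rightarrow> 'm \<Rightarrow> ('m, 'n) tvec set" where
  "submanifold_tangent_space A L q =
     {velocity A \<gamma> 0 | \<gamma>. \<exists>I. 0 \<in> I \<and> smooth_curve_on A I \<gamma> \<and> \<gamma> ` I \<subseteq> L \<and> \<gamma> 0 = q}"

definition lagrangian_submanifold ::
    "('m::topological_space, 'n::finite) chart set \<Rightarrow> ('m, 'n) two_form \<Rightarrow> 'm set \<Rightarrow> bool" where
  "lagrangian_submanifold A \<omega> L \<longleftrightarrow> embedded_submanifold A CARD('n) L \<and>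
     (\<forall>q\<in>L. \<forall>u\<in>submanifold_tangent_space A L q. \<forall>v\<in>submanifold_tangent_space A L q. \<omega> q u v = 0)"

definition transverse_at ::
    "('m::topological_space, 'n::finite) chart set \<Rightarrow> 'm set \<Rightarrow> 'm set \<Rightarrow> 'm \<Rightarrow> bool" where
  "transverse_at A L1 L2 p \<longleftrightarrow> p \<in> L1 \<and> p \<in> L2 \<and>
     tangent_space A p =
       {tv_add u v | u v. u \<in> submanifold_tangent_space A L1 p \<and> v \<in> submanifold_tangent_space A L2 p}"


section \<open>Local p.s.h. convexity\<close>

definition locally_psh_convex ::
    "('m::topological_space, 'n::finite) chart set \<Rightarrow> ('m, 'n) two_form \<Rightarrow> 'm set \<Rightarrow> 'm \<Rightarrow> bool" where
  "locally_psh_convex A \<omega> S p \<longleftrightarrow>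
     (\<exists>U. p \<in> U \<and> stein_on A U \<and>
        (\<exists>\<epsilon>0>0. \<forall>\<epsilon>. 0 < \<epsilon> \<and> \<epsilon> < \<epsilon>0 \<longrightarrow> psh_convex_in A U (S \<inter> closure (riem_ball A \<omega> p \<epsilon>))))"

end

theory Submission
  imports Defs "HOL-Complex_Analysis.Cauchy_Integral_Formula"
begin

text \<open>
  Let \<open>T1\<close>, \<open>T2\<close> be the tangent spaces at \<open>p\<close> in a chart, \<open>\<Omega>\<close> the symplectic form at \<open>p\<close>, and
  let \<open>\<sigma>\<close> be \<open>1\<close> on \<open>T1\<close> and \<open>-1\<close> on \<open>T2\<close>. Since \<open>T1\<close> and \<open>T2\<close> are Lagrangian, \<open>\<sigma>\<close> is skew for \<open>\<Omega>\<close>, so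
  \<open>h v = \<Omega> (\<sigma> v) (\<i> v)\<close> satisfies \<open>h (\<i> v) = - h v\<close> and is the real part of a holomorphic quadratic
  form \<open>P\<close>; by taming it is positive on \<open>T1\<close> and negative on \<open>T2\<close>. Hence near \<open>p\<close> the form \<open>P\<close> maps \<open>L1\<close>
  and \<open>L2\<close> into opposite sectors of the plane, and the hull of a compact \<open>K\<close> in \<open>L1 \<union> L2\<close> containing \<open>p\<close> is
  controlled as in Kallin's lemma: the functions \<open>- ln \<bar>P - \<i> t\<bar>\<close> show that the hull meets
  \<open>Re P = 0\<close> only at \<open>p\<close>, which decouples the two sides. On each side \<open>L\<close> is totally real, and
  if \<open>g\<close> is a defining map of \<open>L\<close>, the function \<open>\<parallel>g\<parallel>\<^sup>2 - \<kappa> \<parallel>z - q\<parallel>\<^sup>2\<close> is plurisubharmonic and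
  separates \<open>q\<close> from \<open>K\<close>.
\<close>

section \<open>Harmonic minorants and the submean inequality\<close>

lemma holomorphic_mean_value:
  assumes "f holomorphic_on ball c e" and "0 < r" and "r < e"
  shows "((\<lambda>t. f (c + of_real r * cis t)) has_integral (2 * of_real pi * f c)) {0..2*pi}"
proof -
  have "f holomorphic_on cball c r"
    using assms by (auto intro: holomorphic_on_subset)
  then have "((\<lambda>u. f u / (u - c)) has_contour_integral (2 * of_real pi * \<i> * f c)) (circlepath c r)"
    using Cauchy_integral_circlepath_simple[of f c r c] assms(2) by simp
  then have "((\<lambda>t. f (c + r * cis t) / (c + r * cis t - c) * r * \<i> * cis t)
      has_integral (2 * of_real pi * \<i> * f c)) {0..2*pi}"
    unfolding circlepath_def
    by (subst (asm) has_contour_integral_part_circlepath_iff) auto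
  moreover have "(\<lambda>t. f (c + r * cis t) / (c + r * cis t - c) * r * \<i> * cis t)
      = (\<lambda>t. \<i> * f (c + r * cis t))"
    using assms(2) by (auto simp: field_simps)
  ultimately have "((\<lambda>t. \<i> * f (c + r * cis t)) has_integral (\<i> * (2 * of_real pi * f c))) {0..2*pi}"
    by (simp add: mult_ac)
  from has_integral_mult_right[OF this, of "-\<i>"] show ?thesis
    by (simp flip: mult.assoc)
qed

lemma Re_holomorphic_mean_value:
  assumes "f holomorphic_on ball c e" and "0 < r" and "r < e"
  shows "((\<lambda>t. Re (f (c + of_real r * cis t))) has_integral (2 * pi * Re (f c))) {0..2*pi}"
  using has_integral_linear[OF holomorphic_mean_value[OF assms] bounded_linear_Re]
  by (simp add: o_def)

lemma Re_poly_times_cnj_poly_on_unit_circle: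
  "\<exists>s. \<forall>z. cmod z = 1 \<longrightarrow> Re (poly p z * cnj (poly q z)) = Re (poly s z)"
proof (induction p arbitrary: q)
  case 0
  show ?case by (rule exI[of _ 0]) simp
next
  case (pCons a p)
  obtain b q' where q: "q = pCons b q'" by (cases q)
  obtain s' where s': "\<And>z. cmod z = 1 \<Longrightarrow> Re (poly p z * cnj (poly q' z)) = Re (poly s' z)"
    using pCons.IH by blast
  show ?case
  proof (intro exI allI impI)
    fix z assume z: "cmod z = 1"
    have unit: "z * cnj z = 1" using z by (simp add: complex_norm_square[symmetric])
    have "poly (pCons a p) z * cnj (poly q z) =
        cnj b * poly (pCons a p) z + cnj (cnj a * (z * poly q' z))
          + (z * cnj z) * (poly p z * cnj (poly q' z))"
      by (simp add: q algebra_simps)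
    then show "Re (poly (pCons a p) z * cnj (poly q z)) =
        Re (poly (smult (cnj b) (pCons a p) + smult (cnj a) (pCons 0 q') + s') z)"
      unfolding unit using s'[OF z] by (simp add: algebra_simps)
  qed
qed

lemma Re_poly_times_Re_poly_on_unit_circle:
  "\<exists>s. \<forall>z. cmod z = 1 \<longrightarrow> Re (poly p z) * Re (poly q z) = Re (poly s z)"
proof -
  obtain s where s: "\<And>z. cmod z = 1 \<Longrightarrow> Re (poly p z * cnj (poly q z)) = Re (poly s z)"
    using Re_poly_times_cnj_poly_on_unit_circle by blast
  show ?thesis
    by (rule exI[of _ "smult (1/2) (p * q + s)"]) (auto simp flip: s simp: field_simps)
qed

lemma real_polynomial_function_on_unit_circle:
  fixes g :: "complex \<Rightarrow> real"
  assumes "real_polynomial_function g"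
  shows "\<exists>p. \<forall>z. cmod z = 1 \<longrightarrow> g z = Re (poly p z)"
  using assms
proof induction
  case (linear f)
  interpret f: bounded_linear f by (rule linear)
  have "f z = Re (poly [:0, Complex (f 1) (- f \<i>):] z)" for z
  proof -
    have "z = Re z *\<^sub>R 1 + Im z *\<^sub>R \<i>" by (simp add: complex_eq_iff)
    then have "f z = Re z * f 1 + Im z * f \<i>" by (metis f.add f.scaleR real_scaleR_def)
    then show ?thesis by simp
  qed
  then show ?case by blast
next
  case (const c)
  show ?case by (rule exI[of _ "[:of_real c:]"]) simp
next
  case (add f g)
  then obtain p q where "\<And>z. cmod z = 1 \<Longrightarrow> f z = Re (poly p z)" "\<And>z. cmod z = 1 \<Longrightarrow> g z = Re (poly q z)"
    by blast
  then show ?case by (intro exI[of _ "p + q"]) simp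
next
  case (mult f g)
  then obtain p q where "\<And>z. cmod z = 1 \<Longrightarrow> f z = Re (poly p z)" "\<And>z. cmod z = 1 \<Longrightarrow> g z = Re (poly q z)"
    by blast
  then show ?case using Re_poly_times_Re_poly_on_unit_circle[of p q] by simp
qed

lemma approx_on_unit_circle_by_Re_poly:
  assumes "continuous_on (sphere (0::complex) 1) v" and "e > 0"
  obtains p where "\<And>z. cmod z = 1 \<Longrightarrow> \<bar>v z - Re (poly p z)\<bar> < e"
proof -
  obtain g where g: "real_polynomial_function g" "\<And>z. z \<in> sphere 0 1 \<Longrightarrow> \<bar>v z - g z\<bar> < e"
    using Stone_Weierstrass_real_polynomial_function[OF compact_sphere assms] by metis
  obtain p where "\<And>z. cmod z = 1 \<Longrightarrow> g z = Re (poly p z)"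
    using real_polynomial_function_on_unit_circle[OF g(1)] by blast
  with g(2) show thesis by (intro that[of p]) force
qed

definition harmonic_minorant_at :: "(complex \<Rightarrow> real) \<Rightarrow> complex \<Rightarrow> bool" where
  "harmonic_minorant_at v c \<longleftrightarrow>
     (\<exists>f N. open N \<and> c \<in> N \<and> f holomorphic_on N \<and> Re (f c) = v c \<and> (\<forall>z\<in>N. Re (f z) \<le> v z))"

lemma harmonic_minorant_at_diff_Re:
  assumes "harmonic_minorant_at v c" and "g holomorphic_on UNIV"
  shows "harmonic_minorant_at (\<lambda>z. v z - Re (g z)) c"
proof -
  obtain f N where N: "open N" "c \<in> N" and f: "f holomorphic_on N" "Re (f c) = v c" "\<forall>z\<in>N. Re (f z) \<le> v z"
    using assms(1) unfolding harmonic_minorant_at_def by blast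
  have "(\<lambda>z. f z - g z) holomorphic_on N"
    by (intro holomorphic_intros f holomorphic_on_subset[OF assms(2)]) auto
  with N f show ?thesis
    unfolding harmonic_minorant_at_def by (intro exI[of _ "\<lambda>z. f z - g z"] exI[of _ N]) auto
qed

text \<open>
  The perturbation \<open>\<epsilon> \<bar>z\<bar>\<^sup>2\<close> excludes a local maximum at \<open>c\<close>: on a small circle about \<open>c\<close> the real part of
  \<open>f z + 2 \<epsilon> cnj c (z - c)\<close> would stay strictly below its value at the centre.
\<close>

lemma harmonic_minorant_at_no_local_max:
  assumes "harmonic_minorant_at v c" and S: "open S" "c \<in> S" and \<epsilon>: "0 < \<epsilon>"
  shows "\<exists>z\<in>S. v c + \<epsilon> * (cmod c)\<^sup>2 < v z + \<epsilon> * (cmod z)\<^sup>2"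
proof (rule ccontr)
  assume "\<not> ?thesis"
  then have max: "v z + \<epsilon> * (cmod z)\<^sup>2 \<le> v c + \<epsilon> * (cmod c)\<^sup>2" if "z \<in> S" for z
    using that by force
  obtain f N where N: "open N" "c \<in> N" and f: "f holomorphic_on N" "Re (f c) = v c"
      "\<And>z. z \<in> N \<Longrightarrow> Re (f z) \<le> v z"
    using assms(1) unfolding harmonic_minorant_at_def by blast
  obtain e where e: "e > 0" "ball c e \<subseteq> S \<inter> N"
    using open_Int[OF S(1) N(1)] S(2) N(2) by (meson IntI openE)
  define r where "r = e / 2"
  have r: "0 < r" "r < e" using e by (auto simp: r_def)
  define g where "g z = f z + 2 * of_real \<epsilon> * cnj c * (z - c)" for z
  have g: "g holomorphic_on ball c e"
    unfolding g_def by (intro holomorphic_intros holomorphic_on_subset[OF f(1)]) (use e in auto)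
  have "Re (g (c + r * cis t)) \<le> Re (g c) - \<epsilon> * r\<^sup>2" for t
  proof -
    define z where "z = c + r * cis t"
    have radius: "cmod (z - c) = r" using r by (simp add: z_def norm_mult)
    then have "z \<in> ball c e" using r by (simp add: dist_norm norm_minus_commute)
    then have "z \<in> S" "z \<in> N" using e by auto
    have "(cmod z)\<^sup>2 = (cmod c)\<^sup>2 + 2 * Re (cnj c * (z - c)) + r\<^sup>2"
      unfolding radius[symmetric] by (simp add: cmod_power2) (simp add: power2_eq_square algebra_simps)
    then have "\<epsilon> * (cmod z)\<^sup>2 = \<epsilon> * (cmod c)\<^sup>2 + 2 * \<epsilon> * Re (cnj c * (z - c)) + \<epsilon> * r\<^sup>2"
      by (simp only: distrib_left mult.assoc mult.left_commute)
    moreover have "Re (g z) = Re (f z) + 2 * \<epsilon> * Re (cnj c * (z - c))"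
      unfolding g_def by (simp add: algebra_simps)
    moreover have "Re (g c) = v c" by (simp add: g_def f)
    ultimately show ?thesis
      using max[OF \<open>z \<in> S\<close>] f(3)[OF \<open>z \<in> N\<close>] unfolding z_def[symmetric] by linarith
  qed
  then have "2 * pi * Re (g c) \<le> (2 * pi) * (Re (g c) - \<epsilon> * r\<^sup>2)"
    using has_integral_le[OF Re_holomorphic_mean_value[OF g r]
        has_integral_const_real[of "Re (g c) - \<epsilon> * r\<^sup>2" 0 "2*pi"]] by simp
  then show False using \<epsilon> r(1) by (simp add: mult_le_0_iff)
qed

lemma harmonic_minorant_maximum_principle:
  assumes S: "compact S" and v: "continuous_on S v"
    and minorant: "\<And>c. c \<in> interior S \<Longrightarrow> harmonic_minorant_at v c"
    and boundary: "\<And>z. z \<in> frontier S \<Longrightarrow> v z \<le> M" and a: "a \<in> S"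
  shows "v a \<le> M"
proof (rule field_le_epsilon)
  fix e :: real assume e: "e > 0"
  obtain B where B: "B > 0" "\<And>z. z \<in> S \<Longrightarrow> cmod z \<le> B"
    using compact_imp_bounded[OF S] by (metis bounded_pos)
  define \<epsilon> where "\<epsilon> = e / B\<^sup>2"
  have \<epsilon>: "\<epsilon> > 0" using e B(1) by (simp add: \<epsilon>_def)
  define w where "w z = v z + \<epsilon> * (cmod z)\<^sup>2" for z
  have "continuous_on S w" unfolding w_def by (intro continuous_intros v)
  then obtain c where c: "c \<in> S" "\<And>z. z \<in> S \<Longrightarrow> w z \<le> w c"
    using continuous_attains_sup[OF S] a by blast
  have "c \<notin> interior S"
  proof
    assume "c \<in> interior S"
    from harmonic_minorant_at_no_local_max[OF minorant[OF this] open_interior this \<epsilon>]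
    show False using c(2) interior_subset by (fastforce simp: w_def)
  qed
  then have "v c \<le> M"
    using c(1) boundary compact_imp_closed[OF S] by (simp add: frontier_def)
  moreover have "\<epsilon> * (cmod c)\<^sup>2 \<le> e"
    using power_mono[OF B(2)[OF c(1)], of 2] e B(1) by (simp add: \<epsilon>_def field_simps)
  moreover have "v a \<le> w a" using \<epsilon> by (simp add: w_def)
  ultimately show "v a \<le> M + e" using c(2)[OF a] by (simp add: w_def)
qed

lemma harmonic_minorant_submean:
  assumes v: "continuous_on (cball 0 1) v"
    and minorant: "\<And>c. c \<in> ball 0 1 \<Longrightarrow> harmonic_minorant_at v c"
  shows "v 0 \<le> (1 / (2 * pi)) * integral {0..2*pi} (\<lambda>t. v (cis t))"
proof (rule field_le_epsilon)
  fix e :: real assume "e > 0"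
  have "continuous_on (sphere 0 1) v"
    by (rule continuous_on_subset[OF v]) auto
  then obtain p where p: "\<And>z. cmod z = 1 \<Longrightarrow> \<bar>v z - Re (poly p z)\<bar> < e/2"
    using approx_on_unit_circle_by_Re_poly[of v "e/2"] \<open>e > 0\<close> by auto
  have poly_holo: "poly p holomorphic_on S" for S
    by (simp add: holomorphic_on_def field_differentiable_def) (meson DERIV_subset poly_DERIV subset_UNIV)
  have centre: "v 0 - Re (poly p 0) \<le> e/2"
  proof (rule harmonic_minorant_maximum_principle[of "cball 0 1" "\<lambda>z. v z - Re (poly p z)" "e/2" 0])
    show "harmonic_minorant_at (\<lambda>z. v z - Re (poly p z)) c" if "c \<in> interior (cball 0 1)" for c
      using harmonic_minorant_at_diff_Re[OF minorant poly_holo] that by simp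
    show "v z - Re (poly p z) \<le> e/2" if "z \<in> frontier (cball 0 1)" for z
    proof -
      have "cmod z = 1" using that by simp
      from p[OF this] show ?thesis by linarith
    qed
  qed (auto intro!: continuous_intros v)
  have poly_mean: "((\<lambda>t. Re (poly p (cis t))) has_integral (2 * pi * Re (poly p 0))) {0..2*pi}"
    using Re_holomorphic_mean_value[OF poly_holo, of 1 2 0] by simp
  have "continuous_on {0..2*pi} (\<lambda>t. v (cis t))"
    by (rule continuous_on_compose2[OF v]) (auto intro!: continuous_intros)
  then have v_mean: "((\<lambda>t. v (cis t) + e/2) has_integral
      (integral {0..2*pi} (\<lambda>t. v (cis t)) + e/2 * (2*pi))) {0..2*pi}"
    using has_integral_const_real[of "e/2" 0 "2*pi"]
    by (intro has_integral_add integrable_integral integrable_continuous_real) (auto simp: mult_ac)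
  have "Re (poly p (cis t)) \<le> v (cis t) + e/2" for t
    using p[OF norm_cis, of t] by linarith
  then have "2 * pi * Re (poly p 0) \<le> integral {0..2*pi} (\<lambda>t. v (cis t)) + e/2 * (2*pi)"
    by (intro has_integral_le[OF poly_mean v_mean])
  then have "Re (poly p 0) \<le> (1 / (2 * pi)) * integral {0..2*pi} (\<lambda>t. v (cis t)) + e/2"
    by (simp add: field_simps)
  with centre show "v 0 \<le> (1 / (2 * pi)) * integral {0..2*pi} (\<lambda>t. v (cis t)) + e" by linarith
qed

section \<open>Holomorphic and plurisubharmonic functions of several variables\<close>

lemma bounded_bilinear_vector_scalar_mult:
  "bounded_bilinear ((*s) :: complex \<Rightarrow> complex^'n::finite \<Rightarrow> complex^'n)"
  by (rule bilinear_conv_bounded_bilinear[THEN iffD1])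
     (auto simp: bilinear_def vec_eq_iff algebra_simps intro!: linearI)

lemmas bounded_linear_i_scale =
  bounded_bilinear.bounded_linear_right[OF bounded_bilinear_vector_scalar_mult, of \<i>]

lemma scale_Re_Im: "c *s v = Re c *\<^sub>R v + Im c *\<^sub>R (\<i> *s (v::complex^'n::finite))"
  by (auto simp: vec_eq_iff complex_eq_iff)

lemma i_scale_i_scale: "\<i> *s (\<i> *s v) = - (v::complex^'n::finite)"
  by (simp add: vec_eq_iff flip: mult.assoc)

lemma norm_i_scale: "norm (\<i> *s (v::complex^'n::finite)) = norm v"
  by (simp add: norm_vec_def norm_mult)

lemma linear_imp_complex_linear:
  fixes f :: "complex^'n::finite \<Rightarrow> complex"
  assumes "linear f" and "\<And>v. f (\<i> *s v) = \<i> * f v"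
  shows "f (c *s v) = c * f v"
proof -
  have "f (c *s v) = Re c *\<^sub>R f v + Im c *\<^sub>R f (\<i> *s v)"
    by (subst scale_Re_Im) (simp add: linear_add[OF assms(1)] linear_cmul[OF assms(1)])
  then show ?thesis
    by (simp add: assms(2) complex_eq_iff)
qed

definition holo_fun_on :: "(complex^'n::finite \<Rightarrow> complex) \<Rightarrow> (complex^'n) set \<Rightarrow> bool" where
  "holo_fun_on f S \<longleftrightarrow>
     (\<forall>z\<in>S. \<exists>f'. (f has_derivative f') (at z) \<and> (\<forall>c v. f' (c *s v) = c * f' v))"

lemma holo_fun_on_frechet:
  assumes "holo_fun_on f S" and "z \<in> S"
  shows "(f has_derivative frechet_derivative f (at z)) (at z)"
    and "frechet_derivative f (at z) (c *s v) = c * frechet_derivative f (at z) v"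
  using assms unfolding holo_fun_on_def by (metis frechet_derivative_at)+

lemma holo_map_on_frechet:
  assumes "holo_map_on f S" and "z \<in> S"
  shows "(f has_derivative frechet_derivative f (at z)) (at z)"
    and "frechet_derivative f (at z) (c *s v) = c *s frechet_derivative f (at z) v"
  using assms unfolding holo_map_on_def by (metis frechet_derivative_at)+

lemma holo_fun_on_cong:
  assumes "holo_fun_on f S" and "open S" and "\<And>z. z \<in> S \<Longrightarrow> f z = g z"
  shows "holo_fun_on g S"
  unfolding holo_fun_on_def
proof
  fix z assume z: "z \<in> S"
  then obtain f' where f': "(f has_derivative f') (at z)" "\<forall>c v. f' (c *s v) = c * f' v"
    using assms(1) unfolding holo_fun_on_def by meson
  show "\<exists>f'. (g has_derivative f') (at z) \<and> (\<forall>c v. f' (c *s v) = c * f' v)"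
    using has_derivative_transform_within_open[OF f'(1) assms(2) z assms(3)] f'(2) by blast
qed

lemma holo_fun_on_subset: "holo_fun_on f S \<Longrightarrow> T \<subseteq> S \<Longrightarrow> holo_fun_on f T"
  by (auto simp: holo_fun_on_def)

lemma holo_map_on_subset: "holo_map_on f S \<Longrightarrow> T \<subseteq> S \<Longrightarrow> holo_map_on f T"
  by (auto simp: holo_map_on_def)

lemma continuous_on_holo_fun: "holo_fun_on f S \<Longrightarrow> continuous_on S f"
  unfolding holo_fun_on_def
  by (meson continuous_at_imp_continuous_on has_derivative_continuous)

lemma continuous_on_holo_map: "holo_map_on f S \<Longrightarrow> continuous_on S f"
  unfolding holo_map_on_def
  by (meson continuous_at_imp_continuous_on has_derivative_continuous)

lemma holo_fun_on_const: "holo_fun_on (\<lambda>z. c) S"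
  unfolding holo_fun_on_def by (intro ballI exI[of _ "\<lambda>v. 0"]) auto

lemma holo_fun_on_linear:
  assumes "bounded_linear f" and "\<And>c v. f (c *s v) = c * f v"
  shows "holo_fun_on f S"
  unfolding holo_fun_on_def using bounded_linear_imp_has_derivative[OF assms(1)] assms(2) by blast

lemma holo_fun_on_add:
  assumes "holo_fun_on f S" and "holo_fun_on g S"
  shows "holo_fun_on (\<lambda>z. f z + g z) S"
  unfolding holo_fun_on_def
proof
  fix z assume "z \<in> S"
  then obtain f' g' where "(f has_derivative f') (at z)" "\<forall>c v. f' (c *s v) = c * f' v"
      "(g has_derivative g') (at z)" "\<forall>c v. g' (c *s v) = c * g' v"
    using assms unfolding holo_fun_on_def by meson
  then show "\<exists>h'. ((\<lambda>z. f z + g z) has_derivative h') (at z) \<and> (\<forall>c v. h' (c *s v) = c * h' v)"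
    by (intro exI[of _ "\<lambda>v. f' v + g' v"] conjI has_derivative_add) (auto simp: algebra_simps)
qed

lemma holo_fun_on_compose_field:
  assumes f: "holo_fun_on f S" and g: "\<And>z. z \<in> S \<Longrightarrow> g field_differentiable (at (f z))"
  shows "holo_fun_on (\<lambda>z. g (f z)) S"
  unfolding holo_fun_on_def
proof
  fix z assume z: "z \<in> S"
  obtain f' where f': "(f has_derivative f') (at z)" "\<forall>c v. f' (c *s v) = c * f' v"
    using f z unfolding holo_fun_on_def by meson
  obtain d where "(g has_field_derivative d) (at (f z))"
    using g[OF z] unfolding field_differentiable_def by blast
  then have "(g has_derivative (\<lambda>x. d * x)) (at (f z))" by (simp add: has_field_derivative_def)
  from has_derivative_compose[OF f'(1) this]
  show "\<exists>h'. ((\<lambda>z. g (f z)) has_derivative h') (at z) \<and> (\<forall>c v. h' (c *s v) = c * h' v)"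
    using f'(2) by (intro exI[of _ "\<lambda>v. d * f' v"]) auto
qed

lemma holo_fun_on_cmult: "holo_fun_on f S \<Longrightarrow> holo_fun_on (\<lambda>z. c * f z) S"
  by (rule holo_fun_on_compose_field[where g = "\<lambda>w. c * w"]) (auto intro!: derivative_intros)

lemma holo_fun_on_compose_map:
  assumes "holo_fun_on f T" and "holo_map_on g S" and "g ` S \<subseteq> T"
  shows "holo_fun_on (\<lambda>z. f (g z)) S"
  unfolding holo_fun_on_def
proof
  fix z assume z: "z \<in> S"
  obtain g' where g': "(g has_derivative g') (at z)" "\<forall>c v. g' (c *s v) = c *s g' v"
    using assms(2) z unfolding holo_map_on_def by meson
  obtain f' where f': "(f has_derivative f') (at (g z))" "\<forall>c v. f' (c *s v) = c * f' v"
    using assms(1,3) z unfolding holo_fun_on_def by blast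
  from has_derivative_compose[OF g'(1) f'(1)]
  show "\<exists>h'. ((\<lambda>z. f (g z)) has_derivative h') (at z) \<and> (\<forall>c v. h' (c *s v) = c * h' v)"
    using f'(2) g'(2) by (intro exI[of _ "\<lambda>v. f' (g' v)"]) auto
qed

lemma holo_fun_on_translate:
  assumes "holo_fun_on f T" and "\<And>z. z \<in> S \<Longrightarrow> z + a \<in> T"
  shows "holo_fun_on (\<lambda>z. f (z + a)) S"
proof (rule holo_fun_on_compose_map[OF assms(1)])
  show "holo_map_on (\<lambda>z. z + a) S"
    unfolding holo_map_on_def by (intro ballI exI[of _ "\<lambda>v. v"]) (auto intro!: derivative_eq_intros)
qed (use assms(2) in auto)

lemma has_field_derivative_holo_fun_on_line:
  assumes "holo_fun_on f S" and "z + c *s w \<in> S"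
  shows "((\<lambda>\<zeta>. f (z + \<zeta> *s w)) has_field_derivative frechet_derivative f (at (z + c *s w)) w) (at c)"
proof -
  have "((\<lambda>\<zeta>. z + \<zeta> *s w) has_derivative (\<lambda>\<zeta>. \<zeta> *s w)) (at c)"
    using has_derivative_add[OF has_derivative_const bounded_linear_imp_has_derivative[OF
        bounded_bilinear.bounded_linear_left[OF bounded_bilinear_vector_scalar_mult, of w]]] by simp
  from has_derivative_compose[OF this holo_fun_on_frechet(1)[OF assms]]
  show ?thesis
    unfolding has_field_derivative_def
    by (rule has_derivative_eq_rhs) (simp add: fun_eq_iff holo_fun_on_frechet(2)[OF assms])
qed

definition complexify_linear :: "(complex^'n::finite \<Rightarrow> real) \<Rightarrow> complex^'n \<Rightarrow> complex" where
  "complexify_linear l v = Complex (l v) (- l (\<i> *s v))"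

definition complexify_bilinear ::
    "(complex^'n::finite \<Rightarrow> complex^'n \<Rightarrow> real) \<Rightarrow> complex^'n \<Rightarrow> complex^'n \<Rightarrow> complex" where
  "complexify_bilinear B v w =
     Complex (B v w - B (\<i> *s v) (\<i> *s w)) (- (B (\<i> *s v) w + B v (\<i> *s w)))"

lemma Re_complexify_linear [simp]: "Re (complexify_linear l v) = l v"
  by (simp add: complexify_linear_def)

lemma Re_complexify_bilinear [simp]:
  "Re (complexify_bilinear B v w) = B v w - B (\<i> *s v) (\<i> *s w)"
  by (simp add: complexify_bilinear_def)

lemma bounded_bilinear_uminus:
  assumes "bounded_bilinear B"
  shows "bounded_bilinear (\<lambda>v w. - B v w)"
proof -
  interpret B: bounded_bilinear B by fact
  have "(\<lambda>v w. - B v w) = (\<lambda>v. B (- v))" by (simp add: fun_eq_iff B.minus_left)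
  then show ?thesis using B.comp1[OF bounded_linear_minus[OF bounded_linear_ident]] by simp
qed

lemma complexify_bilinear_uminus: "complexify_bilinear (\<lambda>v w. - B v w) v w = - complexify_bilinear B v w"
  by (simp add: complexify_bilinear_def complex_eq_iff)

lemma holo_fun_on_complexify_linear:
  fixes l :: "complex^'n::finite \<Rightarrow> real"
  assumes "bounded_linear l"
  shows "holo_fun_on (complexify_linear l) S"
proof -
  interpret l: bounded_linear l by fact
  interpret J: bounded_linear "\<lambda>v::complex^'n. \<i> *s v" by (rule bounded_linear_i_scale)
  have linear: "linear (complexify_linear l)"
    by (rule linearI) (simp_all add: complexify_linear_def complex_eq_iff l.add l.scaleR J.add J.scaleR)
  show ?thesis
  proof (rule holo_fun_on_linear)
    show "complexify_linear l (c *s v) = c * complexify_linear l v" for c v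
      by (rule linear_imp_complex_linear[OF linear])
         (simp add: complexify_linear_def complex_eq_iff i_scale_i_scale l.neg del: vector_smult_assoc)
  qed (use linear in \<open>simp add: linear_conv_bounded_linear\<close>)
qed

lemma bounded_bilinear_complexify_bilinear:
  fixes B :: "complex^'n::finite \<Rightarrow> complex^'n \<Rightarrow> real"
  assumes "bounded_bilinear B"
  shows "bounded_bilinear (complexify_bilinear B)"
proof -
  interpret B: bounded_bilinear B by fact
  interpret J: bounded_linear "\<lambda>v::complex^'n. \<i> *s v" by (rule bounded_linear_i_scale)
  show ?thesis
    by (rule bilinear_conv_bounded_bilinear[THEN iffD1])
       (auto simp: bilinear_def complexify_bilinear_def complex_eq_iff J.add J.scaleR
          B.add_left B.add_right B.scaleR_left B.scaleR_right algebra_simps intro!: linearI)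
qed

lemma holo_fun_on_complexify_bilinear:
  fixes B :: "complex^'n::finite \<Rightarrow> complex^'n \<Rightarrow> real"
  assumes B: "bounded_bilinear B"
  shows "holo_fun_on (\<lambda>v. complexify_bilinear B v v) S"
  unfolding holo_fun_on_def
proof
  fix z :: "complex^'n"
  let ?C = "complexify_bilinear B"
  interpret B: bounded_bilinear B by fact
  interpret C: bounded_bilinear ?C by (rule bounded_bilinear_complexify_bilinear[OF B])
  have i_left: "?C (\<i> *s v) w = \<i> * ?C v w" and i_right: "?C v (\<i> *s w) = \<i> * ?C v w" for v w
    by (simp_all add: complexify_bilinear_def complex_eq_iff i_scale_i_scale B.minus_left B.minus_right
        del: vector_smult_assoc)
  have "?C (c *s v) w = c * ?C v w" for c v w
    by (rule linear_imp_complex_linear[OF bounded_linear.linear[OF C.bounded_linear_left] i_left])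
  moreover have "?C v (c *s w) = c * ?C v w" for c v w
    by (rule linear_imp_complex_linear[OF bounded_linear.linear[OF C.bounded_linear_right] i_right])
  ultimately have "\<forall>c v. ?C z (c *s v) + ?C (c *s v) z = c * (?C z v + ?C v z)"
    by (simp add: distrib_left)
  with C.FDERIV[OF has_derivative_ident has_derivative_ident, of z UNIV]
  show "\<exists>f'. ((\<lambda>v. ?C v v) has_derivative f') (at z) \<and> (\<forall>c v. f' (c *s v) = c * f' v)"
    by blast
qed

definition pluriharmonic_minorant_at :: "(complex^'n::finite \<Rightarrow> real) \<Rightarrow> complex^'n \<Rightarrow> bool" where
  "pluriharmonic_minorant_at u z \<longleftrightarrow>
     (\<exists>F N. open N \<and> z \<in> N \<and> holo_fun_on F N \<and> Re (F z) = u z \<and> (\<forall>y\<in>N. Re (F y) \<le> u y))"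

lemma pluriharmonic_minorant_at_mono:
  assumes "pluriharmonic_minorant_at u z" and "open N" "z \<in> N" "\<And>y. y \<in> N \<Longrightarrow> u y \<le> v y" and "u z = v z"
  shows "pluriharmonic_minorant_at v z"
proof -
  obtain F N' where "open N'" "z \<in> N'" "holo_fun_on F N'" "Re (F z) = u z" "\<forall>y\<in>N'. Re (F y) \<le> u y"
    using assms(1) unfolding pluriharmonic_minorant_at_def by blast
  then show ?thesis
    using assms(2-5) unfolding pluriharmonic_minorant_at_def
    by (intro exI[of _ F] exI[of _ "N \<inter> N'"]) (auto intro: order_trans elim: holo_fun_on_subset)
qed

lemma pluriharmonic_minorant_at_add:
  assumes "pluriharmonic_minorant_at u z" and "pluriharmonic_minorant_at v z"
  shows "pluriharmonic_minorant_at (\<lambda>y. u y + v y) z"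
proof -
  obtain F N G N' where "open N" "z \<in> N" "holo_fun_on F N" "Re (F z) = u z" "\<forall>y\<in>N. Re (F y) \<le> u y"
     "open N'" "z \<in> N'" "holo_fun_on G N'" "Re (G z) = v z" "\<forall>y\<in>N'. Re (G y) \<le> v y"
    using assms unfolding pluriharmonic_minorant_at_def by blast
  then show ?thesis
    unfolding pluriharmonic_minorant_at_def
    by (intro exI[of _ "\<lambda>y. F y + G y"] exI[of _ "N \<inter> N'"])
       (auto intro!: add_mono holo_fun_on_add elim: holo_fun_on_subset)
qed

lemma pluriharmonic_minorant_at_cmult:
  assumes "pluriharmonic_minorant_at u z" and "0 \<le> c"
  shows "pluriharmonic_minorant_at (\<lambda>y. c * u y) z"
proof -
  obtain F N where "open N" "z \<in> N" "holo_fun_on F N" "Re (F z) = u z" "\<forall>y\<in>N. Re (F y) \<le> u y"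
    using assms unfolding pluriharmonic_minorant_at_def by blast
  then show ?thesis
    using assms(2) unfolding pluriharmonic_minorant_at_def
    by (intro exI[of _ "\<lambda>y. of_real c * F y"] exI[of _ N]) (auto intro!: mult_left_mono holo_fun_on_cmult)
qed

lemma pluriharmonic_minorant_at_compose_holo_map:
  assumes u: "pluriharmonic_minorant_at u (g z)" and g: "holo_map_on g S" "open S" "z \<in> S"
  shows "pluriharmonic_minorant_at (\<lambda>y. u (g y)) z"
proof -
  obtain F N where F: "open N" "g z \<in> N" "holo_fun_on F N" "Re (F (g z)) = u (g z)" "\<forall>y\<in>N. Re (F y) \<le> u y"
    using u unfolding pluriharmonic_minorant_at_def by blast
  let ?N = "S \<inter> g -` N"
  have "open ?N"
    by (rule continuous_open_preimage[OF continuous_on_holo_map[OF g(1)] g(2) F(1)])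
  moreover have "holo_fun_on (\<lambda>y. F (g y)) ?N"
    by (rule holo_fun_on_compose_map[OF F(3) holo_map_on_subset[OF g(1)]]) auto
  ultimately show ?thesis
    using F g(3) unfolding pluriharmonic_minorant_at_def
    by (intro exI[of _ "\<lambda>y. F (g y)"] exI[of _ ?N]) auto
qed

lemma harmonic_minorant_at_line:
  assumes "pluriharmonic_minorant_at u (z + c *s w)"
  shows "harmonic_minorant_at (\<lambda>\<zeta>. u (z + \<zeta> *s w)) c"
proof -
  obtain F N where F: "open N" "z + c *s w \<in> N" "holo_fun_on F N" "Re (F (z + c *s w)) = u (z + c *s w)"
      "\<forall>y\<in>N. Re (F y) \<le> u y"
    using assms unfolding pluriharmonic_minorant_at_def by blast
  let ?D = "(\<lambda>\<zeta>. z + \<zeta> *s w) -` N"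
  have "continuous_on UNIV (\<lambda>\<zeta>. z + \<zeta> *s w)"
    by (intro continuous_intros bounded_bilinear.continuous_on[OF bounded_bilinear_vector_scalar_mult])
  then have "open ?D" by (rule open_vimage[OF F(1)])
  moreover have "(\<lambda>\<zeta>. F (z + \<zeta> *s w)) holomorphic_on ?D"
    by (rule holomorphic_onI, rule field_differentiable_at_within)
       (auto simp: field_differentiable_def intro: has_field_derivative_holo_fun_on_line[OF F(3)])
  ultimately show ?thesis
    using F unfolding harmonic_minorant_at_def
    by (intro exI[of _ "\<lambda>\<zeta>. F (z + \<zeta> *s w)"] exI[of _ ?D]) auto
qed

text \<open>
  Stronger than plurisubharmonicity, but local, stable under maxima and holomorphic pull-back, and
  free of integrals.
\<close>

definition strong_psh :: "(complex^'n::finite) set \<Rightarrow> (complex^'n \<Rightarrow> real) \<Rightarrow> bool" where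
  "strong_psh S u \<longleftrightarrow> continuous_on S u \<and> (\<forall>z\<in>S. pluriharmonic_minorant_at u z)"

lemma strong_psh_continuous: "strong_psh S u \<Longrightarrow> continuous_on S u"
  by (simp add: strong_psh_def)

lemma strong_psh_subset: "strong_psh S u \<Longrightarrow> T \<subseteq> S \<Longrightarrow> strong_psh T u"
  unfolding strong_psh_def by (meson continuous_on_subset subsetD)

lemma strong_psh_const: "strong_psh S (\<lambda>z. c)"
  unfolding strong_psh_def pluriharmonic_minorant_at_def
  by (auto intro!: exI[of _ "\<lambda>z. of_real c"] exI[of _ UNIV] holo_fun_on_const)

lemma strong_psh_add: "strong_psh S u \<Longrightarrow> strong_psh S v \<Longrightarrow> strong_psh S (\<lambda>z. u z + v z)"
  unfolding strong_psh_def by (auto intro: continuous_intros pluriharmonic_minorant_at_add)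

lemma strong_psh_cmult: "strong_psh S u \<Longrightarrow> 0 \<le> c \<Longrightarrow> strong_psh S (\<lambda>z. c * u z)"
  unfolding strong_psh_def by (auto intro: continuous_intros pluriharmonic_minorant_at_cmult)

lemma strong_psh_max:
  assumes "strong_psh S u" and "strong_psh S v"
  shows "strong_psh S (\<lambda>z. max (u z) (v z))"
  unfolding strong_psh_def
proof (intro conjI ballI)
  show "continuous_on S (\<lambda>z. max (u z) (v z))"
    using assms by (auto intro: continuous_on_max strong_psh_continuous)
  fix z assume "z \<in> S"
  then obtain w where w: "pluriharmonic_minorant_at w z" "w z = max (u z) (v z)" "\<And>y. w y \<le> max (u y) (v y)"
    using assms unfolding strong_psh_def by (cases "v z \<le> u z") (auto simp: max_def intro: that)
  show "pluriharmonic_minorant_at (\<lambda>z. max (u z) (v z)) z"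
    by (rule pluriharmonic_minorant_at_mono[OF w(1) open_UNIV UNIV_I w(3,2)])
qed

lemma strong_psh_local:
  assumes "\<And>z. z \<in> S \<Longrightarrow> \<exists>N w. open N \<and> z \<in> N \<and> strong_psh N w \<and> (\<forall>y\<in>N. u y = w y)"
  shows "strong_psh S u"
proof -
  have "isCont u z \<and> pluriharmonic_minorant_at u z" if z: "z \<in> S" for z
  proof
    obtain N w where N: "open N" "z \<in> N" and w: "strong_psh N w" "\<forall>y\<in>N. u y = w y"
      using assms[OF z] by blast
    then have "continuous_on N u" by (metis continuous_on_eq strong_psh_continuous)
    then show "isCont u z" using N by (simp add: continuous_on_eq_continuous_at)
    show "pluriharmonic_minorant_at u z"
      by (rule pluriharmonic_minorant_at_mono[of w z N]) (use w N in \<open>auto simp: strong_psh_def\<close>)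
  qed
  then show ?thesis by (simp add: strong_psh_def continuous_at_imp_continuous_on)
qed

lemma strong_psh_cong:
  assumes "open S" and "\<And>z. z \<in> S \<Longrightarrow> u z = v z" and "strong_psh S u"
  shows "strong_psh S v"
proof (rule strong_psh_local)
  show "\<exists>N w. open N \<and> z \<in> N \<and> strong_psh N w \<and> (\<forall>y\<in>N. v y = w y)" if "z \<in> S" for z
    using assms that by (intro exI[of _ S] exI[of _ u]) auto
qed

lemma strong_psh_compose_holo_map:
  assumes "strong_psh T u" and "holo_map_on g S" "g ` S \<subseteq> T" "open S"
  shows "strong_psh S (\<lambda>z. u (g z))"
  using assms unfolding strong_psh_def
  by (auto intro: continuous_on_compose2 continuous_on_holo_map pluriharmonic_minorant_at_compose_holo_map)

lemma strong_psh_glue: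
  assumes B: "open B" and v: "strong_psh B v" and N: "open N" and u: "strong_psh N u"
    and V: "open V" "V \<inter> B \<subseteq> N"
    and frontier: "\<And>y. y \<in> frontier V \<inter> B \<Longrightarrow> y \<in> N \<and> u y < v y"
  shows "strong_psh B (\<lambda>z. if z \<in> V then max (u z) (v z) else v z)"
proof (rule strong_psh_local)
  let ?w = "\<lambda>z. if z \<in> V then max (u z) (v z) else v z"
  fix z assume z: "z \<in> B"
  consider (inside) "z \<in> V" | (outside) "z \<notin> closure V" | (boundary) "z \<in> frontier V"
    using V(1) by (auto simp: frontier_def interior_open)
  then show "\<exists>N w. open N \<and> z \<in> N \<and> strong_psh N w \<and> (\<forall>y\<in>N. ?w y = w y)"
  proof cases
    case inside
    have "strong_psh (V \<inter> B) (\<lambda>z. max (u z) (v z))"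
      using V(2) by (intro strong_psh_max strong_psh_subset[OF u] strong_psh_subset[OF v]) auto
    then show ?thesis
      using inside z V(1) B by (intro exI[of _ "V \<inter> B"] exI[of _ "\<lambda>z. max (u z) (v z)"]) auto
  next
    case outside
    have "open (B - closure V)" using B by (simp add: open_Diff)
    moreover have "y \<notin> V" if "y \<in> B - closure V" for y using that closure_subset by blast
    ultimately show ?thesis
      using outside z strong_psh_subset[OF v, of "B - closure V"]
      by (intro exI[of _ "B - closure V"] exI[of _ v]) auto
  next
    case boundary
    let ?M = "(N \<inter> B) \<inter> (\<lambda>y. v y - u y) -` {0<..}"
    have "continuous_on (N \<inter> B) (\<lambda>y. v y - u y)"
      using u v by (auto intro!: continuous_intros elim: continuous_on_subset dest!: strong_psh_continuous)
    then have "open ?M" using N B by (intro continuous_open_preimage) auto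
    then show ?thesis
      using boundary z frontier[of z] strong_psh_subset[OF v, of ?M] by (intro exI[of _ ?M] exI[of _ v]) auto
  qed
qed

lemma strong_psh_imp_cont_psh:
  fixes u :: "complex^'n::finite \<Rightarrow> real"
  assumes u: "strong_psh V u"
  shows "cont_psh V u"
  unfolding cont_psh_def
proof (intro conjI allI impI)
  show u_cont: "continuous_on V u" by (rule strong_psh_continuous[OF u])
  fix z w :: "complex^'n" assume disc: "\<forall>\<zeta>. cmod \<zeta> \<le> 1 \<longrightarrow> z + \<zeta> *s w \<in> V"
  have "continuous_on (cball 0 1) (\<lambda>\<zeta>. z + \<zeta> *s w)"
    by (intro continuous_intros bounded_bilinear.continuous_on[OF bounded_bilinear_vector_scalar_mult])
  then have "continuous_on (cball 0 1) (\<lambda>\<zeta>. u (z + \<zeta> *s w))"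
    by (rule continuous_on_compose2[OF u_cont]) (use disc in auto)
  moreover have "harmonic_minorant_at (\<lambda>\<zeta>. u (z + \<zeta> *s w)) c" if "c \<in> ball 0 1" for c
    using u disc that by (intro harmonic_minorant_at_line) (simp add: strong_psh_def)
  ultimately show "u z \<le> 1 / (2 * pi) * integral {0..2 * pi} (\<lambda>\<theta>. u (z + cis \<theta> *s w))"
    using harmonic_minorant_submean[of "\<lambda>\<zeta>. u (z + \<zeta> *s w)"] by simp
qed

lemma strong_psh_minus_ln_cmod:
  assumes P: "holo_fun_on P S" and S: "open S" and P_avoids: "\<And>z. z \<in> S \<Longrightarrow> P z \<noteq> a"
  shows "strong_psh S (\<lambda>z. - ln (cmod (P z - a)))"
  unfolding strong_psh_def
proof (intro conjI ballI)
  have P_cont: "continuous_on S P" by (rule continuous_on_holo_fun[OF P])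
  show "continuous_on S (\<lambda>z. - ln (cmod (P z - a)))"
    using P_avoids by (intro continuous_intros P_cont) auto
  fix z assume z: "z \<in> S"
  define Q where "Q y = (P y - a) / (P z - a)" for y
  define N where "N = S \<inter> Q -` {w. 0 < Re w}"
  have "continuous_on S Q"
    unfolding Q_def using P_avoids[OF z] by (intro continuous_intros P_cont) auto
  then have "open N"
    unfolding N_def by (rule continuous_open_preimage[OF _ S]) (rule open_halfspace_Re_gt)
  moreover have "z \<in> N" using z P_avoids[OF z] by (simp add: N_def Q_def)
  moreover have "holo_fun_on (\<lambda>y. of_real (- ln (cmod (P z - a))) + - 1 * Ln (Q y)) N"
  proof -
    have "holo_fun_on Q N"
      unfolding Q_def
      by (rule holo_fun_on_compose_field[where g = "\<lambda>w. (w - a) / (P z - a)", OF holo_fun_on_subset[OF P]])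
         (use P_avoids[OF z] in \<open>auto simp: N_def intro!: derivative_intros\<close>)
    then have "holo_fun_on (\<lambda>y. Ln (Q y)) N"
      by (rule holo_fun_on_compose_field)
         (force intro!: field_differentiable_at_Ln simp: N_def complex_nonpos_Reals_iff)
    then show ?thesis by (intro holo_fun_on_add holo_fun_on_const holo_fun_on_cmult)
  qed
  moreover have "Re (of_real (- ln (cmod (P z - a))) + - 1 * Ln (Q y)) = - ln (cmod (P y - a))"
    if "y \<in> N" for y
  proof -
    have "Q y \<noteq> 0" "P y \<noteq> a" using that P_avoids by (auto simp: N_def)
    then show ?thesis using P_avoids[OF z] by (simp add: Q_def norm_divide ln_div)
  qed
  ultimately show "pluriharmonic_minorant_at (\<lambda>z. - ln (cmod (P z - a))) z"
    unfolding pluriharmonic_minorant_at_def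
    by (intro exI[of _ "\<lambda>y. of_real (- ln (cmod (P z - a))) + - 1 * Ln (Q y)"] exI[of _ N]) auto
qed

section \<open>Smoothness calculus\<close>

lemma Ck_on_SucD:
  assumes "Ck_on (Suc k) f S"
  shows "\<And>x. x \<in> S \<Longrightarrow> (f has_derivative frechet_derivative f (at x)) (at x)"
    and "\<And>v. Ck_on k (\<lambda>x. frechet_derivative f (at x) v) S"
  using assms by (auto simp: frechet_derivative_works)

lemma Ck_on_cong:
  assumes "open S" "\<And>x. x \<in> S \<Longrightarrow> f x = g x" "Ck_on k f S"
  shows "Ck_on k g S"
  using assms(2,3)
proof (induction k arbitrary: f g)
  case 0
  then show ?case using continuous_on_eq by fastforce
next
  case (Suc k)
  have g: "(g has_derivative frechet_derivative f (at x)) (at x)" if "x \<in> S" for x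
    by (rule has_derivative_transform_within_open[OF Ck_on_SucD(1)[OF Suc.prems(2) that] assms(1) that])
       (use Suc.prems(1) in auto)
  then have "frechet_derivative f (at x) = frechet_derivative g (at x)" if "x \<in> S" for x
    using that frechet_derivative_at by blast
  then have "Ck_on k (\<lambda>x. frechet_derivative g (at x) v) S" for v
    using Suc.IH[OF _ Ck_on_SucD(2)[OF Suc.prems(2)]] by auto
  then show ?case using g by (auto simp: differentiable_def)
qed

lemma Ck_on_SucI:
  assumes "open S" "\<And>x. x \<in> S \<Longrightarrow> (f has_derivative D x) (at x)" "\<And>v. Ck_on k (\<lambda>x. D x v) S"
  shows "Ck_on (Suc k) f S"
proof -
  have "D x = frechet_derivative f (at x)" if "x \<in> S" for x
    using assms(2)[OF that] frechet_derivative_at by blast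
  then have "Ck_on k (\<lambda>x. frechet_derivative f (at x) v) S" for v
    using Ck_on_cong[OF assms(1) _ assms(3)[of v]] by simp
  then show ?thesis using assms(2) by (auto simp: differentiable_def)
qed

lemma Ck_on_Suc_imp: "Ck_on (Suc k) f S \<Longrightarrow> Ck_on k f S"
proof (induction k arbitrary: f)
  case 0
  then show ?case
    by (auto intro!: continuous_at_imp_continuous_on differentiable_imp_continuous_within)
next
  case (Suc k)
  then have "Ck_on k (\<lambda>x. frechet_derivative f (at x) v) S" for v
    by (metis Ck_on.simps(2))
  then show ?case using Suc.prems by simp
qed

lemma Ck_on_le: "Ck_on k f S \<Longrightarrow> j \<le> k \<Longrightarrow> Ck_on j f S"
proof (induction k arbitrary: j)
  case (Suc k)
  then show ?case using Ck_on_Suc_imp[OF Suc.prems(1)] by (cases "j = Suc k") auto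
qed simp

lemma Ck_on_subset: "Ck_on k f S \<Longrightarrow> T \<subseteq> S \<Longrightarrow> Ck_on k f T"
  by (induction k arbitrary: f) (auto elim: continuous_on_subset)

lemma Ck_on_const: "Ck_on k (\<lambda>x. c) S"
  by (induction k arbitrary: c) auto

lemma Ck_on_linear:
  assumes "bounded_linear L" "open S"
  shows "Ck_on k L S"
proof (cases k)
  case 0
  then show ?thesis using assms by (simp add: linear_continuous_on)
next
  case (Suc j)
  then show ?thesis
    using Ck_on_SucI[OF assms(2) bounded_linear_imp_has_derivative[OF assms(1)] Ck_on_const] by simp
qed

lemma Ck_on_linear_compose:
  assumes "bounded_linear L" "open S" "Ck_on k f S"
  shows "Ck_on k (\<lambda>x. L (f x)) S"
  using assms(3)
proof (induction k arbitrary: f)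
  case 0
  then show ?case using continuous_on_compose2[OF linear_continuous_on[OF assms(1), of UNIV]] by auto
next
  case (Suc k)
  show ?case
  proof (rule Ck_on_SucI[OF assms(2)])
    show "((\<lambda>x. L (f x)) has_derivative (\<lambda>v. L (frechet_derivative f (at x) v))) (at x)" if "x \<in> S" for x
      by (rule bounded_linear.has_derivative[OF assms(1) Ck_on_SucD(1)[OF Suc.prems that]])
    show "Ck_on k (\<lambda>x. L (frechet_derivative f (at x) v)) S" for v
      by (rule Suc.IH[OF Ck_on_SucD(2)[OF Suc.prems]])
  qed
qed

lemma Ck_on_add:
  assumes "open S" "Ck_on k f S" "Ck_on k g S"
  shows "Ck_on k (\<lambda>x. f x + g x) S"
  using assms(2,3)
proof (induction k arbitrary: f g)
  case 0
  then show ?case by (auto intro: continuous_intros)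
next
  case (Suc k)
  show ?case
    by (rule Ck_on_SucI[OF assms(1)
        has_derivative_add[OF Ck_on_SucD(1)[OF Suc.prems(1)] Ck_on_SucD(1)[OF Suc.prems(2)]]
         Suc.IH[OF Ck_on_SucD(2)[OF Suc.prems(1)] Ck_on_SucD(2)[OF Suc.prems(2)]]])
qed

lemma Ck_on_sum:
  assumes "open S" "\<And>i. i \<in> I \<Longrightarrow> Ck_on k (f i) S"
  shows "Ck_on k (\<lambda>x. \<Sum>i\<in>I. f i x) S"
  using assms(2)
  by (induction I rule: infinite_finite_induct) (auto intro: Ck_on_const Ck_on_add[OF assms(1)])

lemma Ck_on_bilinear:
  assumes "bounded_bilinear B" "open S" "Ck_on k f S" "Ck_on k g S"
  shows "Ck_on k (\<lambda>x. B (f x) (g x)) S"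
  using assms(3,4)
proof (induction k arbitrary: f g)
  case 0
  then show ?case using bounded_bilinear.continuous_on[OF assms(1)] by auto
next
  case (Suc k)
  show ?case
  proof (rule Ck_on_SucI[OF assms(2)])
    show "((\<lambda>x. B (f x) (g x)) has_derivative
        (\<lambda>v. B (f x) (frechet_derivative g (at x) v) + B (frechet_derivative f (at x) v) (g x))) (at x)"
      if "x \<in> S" for x
      by (rule bounded_bilinear.FDERIV[OF assms(1) Ck_on_SucD(1)[OF Suc.prems(1) that]
          Ck_on_SucD(1)[OF Suc.prems(2) that]])
    show "Ck_on k (\<lambda>x. B (f x) (frechet_derivative g (at x) v) +
        B (frechet_derivative f (at x) v) (g x)) S" for v
      by (intro Ck_on_add[OF assms(2)] Suc.IH Ck_on_SucD(2)[OF Suc.prems(1)] Ck_on_SucD(2)[OF Suc.prems(2)]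
          Ck_on_Suc_imp[OF Suc.prems(1)] Ck_on_Suc_imp[OF Suc.prems(2)])
  qed
qed

lemma linear_sum_Basis:
  fixes L :: "'a::euclidean_space \<Rightarrow> 'b::real_vector"
  assumes "linear L"
  shows "L v = (\<Sum>b\<in>Basis. (v \<bullet> b) *\<^sub>R L b)"
proof -
  have "L v = L (\<Sum>b\<in>Basis. (v \<bullet> b) *\<^sub>R b)" by (simp add: euclidean_representation)
  also have "\<dots> = (\<Sum>b\<in>Basis. (v \<bullet> b) *\<^sub>R L b)"
    by (simp add: linear_sum[OF assms] linear_cmul[OF assms])
  finally show ?thesis .
qed

lemma Ck_on_compose:
  fixes f :: "'a::euclidean_space \<Rightarrow> 'b::euclidean_space" and g :: "'b \<Rightarrow> 'c::real_normed_vector"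
  assumes "open S" "open T" "f ` S \<subseteq> T" "Ck_on k f S" "Ck_on k g T"
  shows "Ck_on k (\<lambda>x. g (f x)) S"
  using assms(4,5)
proof (induction k arbitrary: g)
  case 0
  then show ?case using assms(3) by (auto intro: continuous_on_compose2)
next
  case (Suc k)
  let ?f' = "\<lambda>x. frechet_derivative f (at x)" and ?g' = "\<lambda>y. frechet_derivative g (at y)"
  show ?case
  proof (rule Ck_on_SucI[OF assms(1)])
    show "((\<lambda>x. g (f x)) has_derivative (\<lambda>v. ?g' (f x) (?f' x v))) (at x)" if "x \<in> S" for x
      by (rule has_derivative_compose[OF Ck_on_SucD(1)[OF Suc.prems(1) that]
          Ck_on_SucD(1)[OF Suc.prems(2)]])
         (use assms(3) that in auto)
    fix v
    have "Ck_on k (\<lambda>x. \<Sum>b\<in>Basis. (?f' x v \<bullet> b) *\<^sub>R ?g' (f x) b) S"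
      by (intro Ck_on_sum[OF assms(1)] Ck_on_bilinear[OF bounded_bilinear_scaleR assms(1)]
            Ck_on_linear_compose[OF bounded_linear_inner_left assms(1)] Suc.IH
            Ck_on_SucD(2)[OF Suc.prems(1)] Ck_on_SucD(2)[OF Suc.prems(2)] Ck_on_Suc_imp[OF Suc.prems(1)])
    moreover have "(\<Sum>b\<in>Basis. (?f' x v \<bullet> b) *\<^sub>R ?g' (f x) b) = ?g' (f x) (?f' x v)" if "x \<in> S" for x
      by (rule linear_sum_Basis[symmetric], rule has_derivative_linear, rule Ck_on_SucD(1)[OF Suc.prems(2)])
         (use assms(3) that in auto)
    ultimately show "Ck_on k (\<lambda>x. ?g' (f x) (?f' x v)) S"
      using Ck_on_cong[OF assms(1)] by (metis (no_types, lifting))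
  qed
qed

lemma Ck_on_inverse:
  fixes f :: "'a::euclidean_space \<Rightarrow> real"
  assumes "open S" "\<And>x. x \<in> S \<Longrightarrow> f x \<noteq> 0" "Ck_on k f S"
  shows "Ck_on k (\<lambda>x. 1 / f x) S"
  using assms(3)
proof (induction k)
  case 0
  then show ?case using assms(2) by (auto intro!: continuous_intros)
next
  case (Suc k)
  let ?f' = "\<lambda>x. frechet_derivative f (at x)"
  show ?case
  proof (rule Ck_on_SucI[OF assms(1)])
    show "((\<lambda>x. 1 / f x) has_derivative (\<lambda>v. - (?f' x v * ((1 / f x) * (1 / f x))))) (at x)"
      if "x \<in> S" for x
      using has_derivative_divide'[OF has_derivative_const Ck_on_SucD(1)[OF Suc.prems that], of 1]
        assms(2)[OF that]
      by (simp add: divide_inverse algebra_simps)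
    show "Ck_on k (\<lambda>x. - (?f' x v * ((1 / f x) * (1 / f x)))) S" for v
      by (intro Ck_on_linear_compose[OF bounded_linear_minus[OF bounded_linear_ident] assms(1)]
          Ck_on_bilinear[OF bounded_bilinear_mult assms(1)]
          Ck_on_SucD(2)[OF Suc.prems] Suc.IH Ck_on_Suc_imp[OF Suc.prems])
  qed
qed

lemma Ck_on_1_vector_derivative:
  assumes "Ck_on (Suc 0) f S"
  shows "t \<in> S \<Longrightarrow> (f has_vector_derivative vector_derivative f (at t)) (at t)"
    and "continuous_on S (\<lambda>t. vector_derivative f (at t))"
proof -
  have f: "(f has_vector_derivative frechet_derivative f (at t) 1) (at t)" if "t \<in> S" for t
  proof -
    note D = Ck_on_SucD(1)[OF assms that]
    have "frechet_derivative f (at t) r = r *\<^sub>R frechet_derivative f (at t) 1" for r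
      using linear_cmul[OF has_derivative_linear[OF D], of r 1] by simp
    then show ?thesis unfolding has_vector_derivative_def by (metis (no_types, lifting) D ext)
  qed
  show "t \<in> S \<Longrightarrow> (f has_vector_derivative vector_derivative f (at t)) (at t)"
    using f vector_derivative_at by metis
  have "continuous_on S (\<lambda>t. frechet_derivative f (at t) 1)" using assms by simp
  then show "continuous_on S (\<lambda>t. vector_derivative f (at t))"
    by (rule continuous_on_eq) (simp add: vector_derivative_at[OF f])
qed

lemma bounded_linear_axis: "bounded_linear (axis j :: complex \<Rightarrow> complex^'n::finite)"
proof -
  have "linear (axis j :: complex \<Rightarrow> complex^'n)"
    by (rule linearI) (auto simp: vec_eq_iff axis_def)
  then show ?thesis by (simp add: linear_conv_bounded_linear)
qed

lemma sum_axis: "(\<Sum>j\<in>UNIV. axis j (g j :: complex)) = (\<chi> j. g j)"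
  by (simp add: vec_eq_iff axis_def if_distrib cong: if_cong)

section \<open>Smoothness of holomorphic maps\<close>

lemma Cauchy_derivative_circle:
  assumes g: "g holomorphic_on cball c s" and s: "0 < s"
  shows "((\<lambda>t. g (c + of_real s * cis t) * cis (- t))
      has_integral (2 * of_real pi * of_real s * deriv g c)) {0..2*pi}"
proof -
  have "((\<lambda>u. g u / (u - c) ^ Suc 1)
      has_contour_integral (2 * pi * \<i> / fact 1 * (deriv ^^ 1) g c)) (circlepath c s)"
    by (rule Cauchy_has_contour_integral_higher_derivative_circlepath)
       (use g s in \<open>auto intro: holomorphic_on_imp_continuous_on holomorphic_on_subset\<close>)
  then have "((\<lambda>t. g (c + s * cis t) / (s * cis t)\<^sup>2 * s * \<i> * cis t)
      has_integral (2 * pi * \<i> * deriv g c)) {0..2*pi}"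
    unfolding circlepath_def
    by (subst (asm) has_contour_integral_part_circlepath_iff) (auto simp: power2_eq_square)
  from has_integral_mult_right[OF this, of "- \<i> * s"]
  have "((\<lambda>t. - \<i> * s * (g (c + s * cis t) / (s * cis t)\<^sup>2 * s * \<i> * cis t))
      has_integral (- \<i> * s * (2 * pi * \<i> * deriv g c))) {0..2*pi}" .
  moreover have "- \<i> * s * (2 * pi * \<i> * deriv g c) = 2 * of_real pi * of_real s * deriv g c"
    by (simp add: complex_eq_iff)
  moreover have "- \<i> * s * (g (c + s * cis t) / (s * cis t)\<^sup>2 * s * \<i> * cis t) =
      g (c + s * cis t) * cis (- t)" for t
  proof -
    have "cis (- t) = 1 / cis t" by (simp add: cis_mult field_simps)
    then show ?thesis using s by (simp add: power2_eq_square mult.left_commute[of \<i>])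
  qed
  ultimately show ?thesis by (simp only:)
qed

lemma holo_derivative_eq_integral:
  assumes f: "holo_fun_on f S" and s: "0 < s" and disc: "\<And>\<zeta>. cmod \<zeta> \<le> s \<Longrightarrow> x + \<zeta> *s v \<in> S"
  shows "frechet_derivative f (at x) v =
    1 / (2 * of_real pi * of_real s) *
      integral {0..2*pi} (\<lambda>t. f (x + (of_real s * cis t) *s v) * cis (- t))"
proof -
  let ?g = "\<lambda>\<zeta>. f (x + \<zeta> *s v)"
  have g: "(?g has_field_derivative frechet_derivative f (at (x + \<zeta> *s v)) v) (at \<zeta>)" if "cmod \<zeta> \<le> s" for \<zeta>
    by (rule has_field_derivative_holo_fun_on_line[OF f disc[OF that]])
  have "?g holomorphic_on cball 0 s"
    by (rule holomorphic_onI, rule field_differentiable_at_within)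
       (auto simp: field_differentiable_def intro: g)
  from Cauchy_derivative_circle[OF this s]
  have "((\<lambda>t. f (x + (of_real s * cis t) *s v) * cis (- t)) has_integral
      (2 * of_real pi * of_real s * deriv ?g 0)) {0..2*pi}" by simp
  moreover have "deriv ?g 0 = frechet_derivative f (at x) v"
    using DERIV_imp_deriv[OF g[of 0]] s by simp
  ultimately show ?thesis using s by (simp add: integral_unique)
qed

lemma uniform_disc_in_open:
  fixes v :: "complex^'n::finite"
  assumes S: "open S" and x0: "x0 \<in> S"
  obtains e s where "e > 0" "s > 0"
    "\<And>x \<zeta>. x \<in> ball x0 e \<Longrightarrow> cmod \<zeta> \<le> s \<Longrightarrow> x + \<zeta> *s v \<in> S"
proof -
  let ?h = "\<lambda>(x, \<zeta>). x + \<zeta> *s v"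
  have "open (?h -` S)"
    unfolding case_prod_beta
    by (rule open_vimage[OF S])
       (intro continuous_intros bounded_bilinear.continuous_on[OF bounded_bilinear_vector_scalar_mult])
  moreover have "(x0, 0) \<in> ?h -` S" using x0 by simp
  ultimately obtain N D where N: "open N" "x0 \<in> N" and D: "open D" "0 \<in> D" and sub: "N \<times> D \<subseteq> ?h -` S"
    by (rule open_prod_elim) auto
  obtain e where e: "e > 0" "ball x0 e \<subseteq> N" using N by (rule openE)
  obtain s where s: "s > 0" "cball 0 s \<subseteq> D" using D open_contains_cball by blast
  show thesis
  proof (rule that[OF e(1) s(1)])
    fix x \<zeta> assume "x \<in> ball x0 e" "cmod \<zeta> \<le> s"
    then have "(x, \<zeta>) \<in> N \<times> D" using e s by auto
    from subsetD[OF sub this] show "x + \<zeta> *s v \<in> S" by simp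
  qed
qed

lemma continuous_on_circle_kernel:
  fixes v :: "complex^'n::finite" and h :: "complex^'n \<Rightarrow> complex"
  assumes h: "continuous_on S h" and "\<And>x t. x \<in> U \<Longrightarrow> x + (of_real s * cis t) *s v \<in> S"
  shows "continuous_on (U \<times> T) (\<lambda>(x, t). h (x + (of_real s * cis t) *s v) * cis (- t))"
  unfolding case_prod_beta
  by (intro continuous_intros continuous_on_compose2[OF h]
      bounded_bilinear.continuous_on[OF bounded_bilinear_vector_scalar_mult])
     (use assms(2) in auto)

lemma continuous_on_holo_derivative:
  fixes f :: "complex^'n::finite \<Rightarrow> complex"
  assumes f: "holo_fun_on f S" and S: "open S"
  shows "continuous_on S (\<lambda>x. frechet_derivative f (at x) v)"
proof (rule continuous_at_imp_continuous_on, rule ballI)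
  fix x0 assume "x0 \<in> S"
  from uniform_disc_in_open[OF S this, of v] obtain e s where e: "e > 0" and s: "s > 0"
    and disc: "\<And>x \<zeta>. x \<in> ball x0 e \<Longrightarrow> cmod \<zeta> \<le> s \<Longrightarrow> x + \<zeta> *s v \<in> S" by blast
  have "continuous_on (ball x0 e \<times> cbox 0 (2*pi)) (\<lambda>(x, t). f (x + (of_real s * cis t) *s v) * cis (- t))"
    by (rule continuous_on_circle_kernel[OF continuous_on_holo_fun[OF f] disc])
       (use s in \<open>auto simp: norm_mult\<close>)
  then have "continuous_on (ball x0 e) (\<lambda>x. 1 / (2 * of_real pi * of_real s) *
      integral {0..2*pi} (\<lambda>t. f (x + (of_real s * cis t) *s v) * cis (- t)))"
    unfolding cbox_interval[symmetric]
    by (intro continuous_on_mult continuous_on_const integral_continuous_on_param)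
  then have "continuous_on (ball x0 e) (\<lambda>x. frechet_derivative f (at x) v)"
    by (rule continuous_on_eq) (simp only: holo_derivative_eq_integral[OF f s disc])
  then show "isCont (\<lambda>x. frechet_derivative f (at x) v) x0"
    using e by (simp add: continuous_on_eq_continuous_at)
qed

lemma has_derivative_integral:
  fixes g :: "'a::euclidean_space \<Rightarrow> real \<Rightarrow> 'b::banach"
  assumes U: "open U" "x0 \<in> U"
    and g': "\<And>x t. x \<in> U \<Longrightarrow> t \<in> {a..b} \<Longrightarrow> ((\<lambda>x. g x t) has_derivative g' x t) (at x)"
    and g_cont: "\<And>x. x \<in> U \<Longrightarrow> continuous_on {a..b} (g x)"
    and g'_cont: "\<And>w. continuous_on (U \<times> {a..b}) (\<lambda>(x, t). g' x t w)"
  shows "((\<lambda>x. integral {a..b} (g x)) has_derivative (\<lambda>w. integral {a..b} (\<lambda>t. g' x0 t w))) (at x0)"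
proof -
  obtain e where e: "e > 0" "ball x0 e \<subseteq> U" using openE[OF U] by blast
  then have x0: "x0 \<in> ball x0 e" by simp
  define D where "D x t = Blinfun (g' x t)" for x t
  have D: "blinfun_apply (D x t) = g' x t" if "x \<in> ball x0 e" "t \<in> {a..b}" for x t
    unfolding D_def
    by (rule bounded_linear_Blinfun_apply, rule has_derivative_bounded_linear, rule g') (use that e in auto)
  have D_cont: "continuous_on (ball x0 e \<times> {a..b}) (\<lambda>(x, t). D x t)"
  proof (rule continuous_on_blinfun_componentwise)
    fix w :: 'a assume "w \<in> Basis"
    have "continuous_on (ball x0 e \<times> {a..b}) (\<lambda>(x, t). g' x t w)"
      by (rule continuous_on_subset[OF g'_cont]) (use e in auto)
    then show "continuous_on (ball x0 e \<times> {a..b}) (\<lambda>p. blinfun_apply (case p of (x, t) \<Rightarrow> D x t) w)"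
      by (rule continuous_on_eq) (auto simp: D)
  qed
  have "((\<lambda>x. integral (cbox a b) (g x)) has_derivative integral (cbox a b) (D x0))
      (at x0 within ball x0 e)"
  proof (rule leibniz_rule[OF _ _ D_cont[folded cbox_interval] x0 convex_ball])
    show "((\<lambda>x. g x t) has_derivative blinfun_apply (D x t)) (at x within ball x0 e)"
      if x: "x \<in> ball x0 e" and t: "t \<in> cbox a b" for x t
    proof -
      have "x \<in> U" using x e by blast
      then show ?thesis using t D[OF x] g' by (simp add: has_derivative_at_withinI)
    qed
    show "g x integrable_on cbox a b" if "x \<in> ball x0 e" for x
      using subsetD[OF e(2) that] g_cont by (auto intro: integrable_continuous_real)
  qed
  then have derivative: "((\<lambda>x. integral {a..b} (g x)) has_derivative integral {a..b} (D x0)) (at x0)"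
    by (simp add: at_within_open[OF x0 open_ball])
  have apply_integral: "blinfun_apply (integral {a..b} (D x0)) w = integral {a..b} (\<lambda>t. g' x0 t w)" for w
  proof -
    have "continuous_on {a..b} (\<lambda>t. case (x0, t) of (x, t) \<Rightarrow> D x t)"
      by (rule continuous_on_compose2[OF D_cont]) (use x0 in \<open>auto intro!: continuous_intros\<close>)
    then have "D x0 integrable_on {a..b}" by (simp add: integrable_continuous_real)
    then have "blinfun_apply (integral {a..b} (D x0)) w = integral {a..b} (\<lambda>t. blinfun_apply (D x0 t) w)"
      by (rule blinfun_apply_integral)
    also have "\<dots> = integral {a..b} (\<lambda>t. g' x0 t w)"
      by (rule integral_cong) (simp add: D[OF x0])
    finally show ?thesis .
  qed
  show ?thesis by (rule has_derivative_eq_rhs[OF derivative]) (simp add: fun_eq_iff apply_integral)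
qed

lemma holo_fun_on_integral:
  fixes g :: "complex^'n::finite \<Rightarrow> real \<Rightarrow> complex"
  assumes U: "open U" and g: "\<And>t. t \<in> {a..b} \<Longrightarrow> holo_fun_on (\<lambda>x. g x t) U"
    and g_cont: "\<And>x. x \<in> U \<Longrightarrow> continuous_on {a..b} (g x)"
    and derivative_cont:
      "\<And>w. continuous_on (U \<times> {a..b}) (\<lambda>(x, t). frechet_derivative (\<lambda>x. g x t) (at x) w)"
  shows "holo_fun_on (\<lambda>x. integral {a..b} (g x)) U"
  unfolding holo_fun_on_def
proof
  fix z assume z: "z \<in> U"
  let ?D = "\<lambda>w. integral {a..b} (\<lambda>t. frechet_derivative (\<lambda>x. g x t) (at z) w)"
  have "((\<lambda>x. integral {a..b} (g x)) has_derivative ?D) (at z)"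
    by (rule has_derivative_integral[OF U z holo_fun_on_frechet(1)[OF g] g_cont derivative_cont])
  moreover have "?D (c *s w) = c * ?D w" for c w
    unfolding integral_mult_right[symmetric]
    by (rule integral_cong, rule holo_fun_on_frechet(2)[OF g z])
  ultimately show "\<exists>f'. ((\<lambda>x. integral {a..b} (g x)) has_derivative f') (at z)
      \<and> (\<forall>c w. f' (c *s w) = c * f' w)"
    by blast
qed

lemma holo_fun_on_derivative:
  fixes f :: "complex^'n::finite \<Rightarrow> complex"
  assumes f: "holo_fun_on f S" and S: "open S"
  shows "holo_fun_on (\<lambda>x. frechet_derivative f (at x) v) S"
proof -
  have "\<exists>e>0. holo_fun_on (\<lambda>x. frechet_derivative f (at x) v) (ball x0 e)" if x0: "x0 \<in> S" for x0
  proof -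
    obtain e s where e: "e > 0" and s: "s > 0"
      and disc: "\<And>x \<zeta>. x \<in> ball x0 e \<Longrightarrow> cmod \<zeta> \<le> s \<Longrightarrow> x + \<zeta> *s v \<in> S"
      using uniform_disc_in_open[OF S x0, of v] by blast
    have circle: "x + (of_real s * cis t) *s v \<in> S" if "x \<in> ball x0 e" for x t
      by (rule disc[OF that]) (use s in \<open>simp add: norm_mult\<close>)
    let ?g = "\<lambda>x t. f (x + (of_real s * cis t) *s v) * cis (- t)"
    have g_derivative: "frechet_derivative (\<lambda>x. ?g x t) (at x) w =
        frechet_derivative f (at (x + (of_real s * cis t) *s v)) w * cis (- t)" if "x \<in> ball x0 e" for x t w
    proof -
      have "((\<lambda>x. x + (of_real s * cis t) *s v) has_derivative (\<lambda>w. w)) (at x)"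
        by (auto intro!: derivative_eq_intros)
      from has_derivative_mult_left[OF
          has_derivative_compose[OF this holo_fun_on_frechet(1)[OF f circle[OF that]]]]
      show ?thesis by (metis frechet_derivative_at)
    qed
    have "holo_fun_on (\<lambda>x. integral {0..2*pi} (?g x)) (ball x0 e)"
    proof (rule holo_fun_on_integral[OF open_ball])
      show "holo_fun_on (\<lambda>x. ?g x t) (ball x0 e)" for t
        using holo_fun_on_cmult[OF holo_fun_on_translate[OF f circle], of "ball x0 e" "cis (- t)"]
        by (simp add: mult.commute)
      show "continuous_on {0..2*pi} (?g x)" if "x \<in> ball x0 e" for x
        by (intro continuous_intros continuous_on_compose2[OF continuous_on_holo_fun[OF f]]
            bounded_bilinear.continuous_on[OF bounded_bilinear_vector_scalar_mult])
           (use circle[OF that] in auto)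
      show "continuous_on (ball x0 e \<times> {0..2*pi}) (\<lambda>(x, t). frechet_derivative (\<lambda>x. ?g x t) (at x) w)" for w
        by (rule continuous_on_eq[OF continuous_on_circle_kernel[OF
            continuous_on_holo_derivative[OF f S] circle]])
           (auto simp: g_derivative)
    qed
    then have "holo_fun_on (\<lambda>x. 1 / (2 * of_real pi * of_real s) * integral {0..2*pi} (?g x)) (ball x0 e)"
      by (rule holo_fun_on_cmult)
    then have "holo_fun_on (\<lambda>x. frechet_derivative f (at x) v) (ball x0 e)"
      by (rule holo_fun_on_cong[OF _ open_ball]) (simp only: holo_derivative_eq_integral[OF f s disc])
    then show ?thesis using e by blast
  qed
  then show ?thesis unfolding holo_fun_on_def by (metis centre_in_ball)
qed

lemma holo_map_on_components: "holo_map_on f S \<longleftrightarrow> (\<forall>j. holo_fun_on (\<lambda>x. f x $ j) S)"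
proof
  assume f: "holo_map_on f S"
  show "\<forall>j. holo_fun_on (\<lambda>x. f x $ j) S"
    unfolding holo_fun_on_def
  proof (intro allI ballI)
    fix j z assume "z \<in> S"
    then obtain f' where "(f has_derivative f') (at z)" "\<forall>c v. f' (c *s v) = c *s f' v"
      using f unfolding holo_map_on_def by meson
    then show "\<exists>f'. ((\<lambda>x. f x $ j) has_derivative f') (at z) \<and> (\<forall>c v. f' (c *s v) = c * f' v)"
      using bounded_linear.has_derivative[OF bounded_linear_vec_nth]
      by (intro exI[of _ "\<lambda>v. f' v $ j"]) auto
  qed
next
  assume f: "\<forall>j. holo_fun_on (\<lambda>x. f x $ j) S"
  show "holo_map_on f S"
    unfolding holo_map_on_def
  proof
    fix z assume "z \<in> S"
    then have "\<forall>j. \<exists>f'. ((\<lambda>x. f x $ j) has_derivative f') (at z) \<and> (\<forall>c v. f' (c *s v) = c * f' v)"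
      using f unfolding holo_fun_on_def by blast
    then obtain f' where f': "\<And>j. ((\<lambda>x. f x $ j) has_derivative f' j) (at z)"
        "\<And>j c v. f' j (c *s v) = c * f' j v" by metis
    have "((\<lambda>x. \<Sum>j\<in>UNIV. axis j (f x $ j)) has_derivative (\<lambda>v. \<Sum>j\<in>UNIV. axis j (f' j v))) (at z)"
      by (intro has_derivative_sum bounded_linear.has_derivative[OF bounded_linear_axis] f')
    then have "(f has_derivative (\<lambda>v. \<chi> j. f' j v)) (at z)" by (simp add: sum_axis)
    then show "\<exists>f'. (f has_derivative f') (at z) \<and> (\<forall>c v. f' (c *s v) = c *s f' v)"
      by (intro exI[of _ "\<lambda>v. \<chi> j. f' j v"]) (auto simp: vec_eq_iff f')
  qed
qed

lemma Ck_on_holo_fun: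
  assumes "holo_fun_on f S" "open S"
  shows "Ck_on k f S"
  using assms(1)
proof (induction k arbitrary: f)
  case 0
  then show ?case by (simp add: continuous_on_holo_fun)
next
  case (Suc k)
  show ?case
    by (rule Ck_on_SucI[OF assms(2) holo_fun_on_frechet(1)[OF Suc.prems]
          Suc.IH[OF holo_fun_on_derivative[OF Suc.prems assms(2)]]])
qed

lemma Ck_on_holo_map:
  assumes "holo_map_on f S" "open S"
  shows "Ck_on k f S"
proof -
  have "Ck_on k (\<lambda>x. \<Sum>j\<in>UNIV. axis j (f x $ j)) S"
    using assms by (intro Ck_on_sum Ck_on_linear_compose[OF bounded_linear_axis] Ck_on_holo_fun)
      (auto simp: holo_map_on_components)
  then show ?thesis by (simp add: sum_axis)
qed

lemma holo_map_on_derivative: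
  assumes f: "holo_map_on f S" and S: "open S"
  shows "holo_map_on (\<lambda>x. frechet_derivative f (at x) v) S"
  unfolding holo_map_on_components
proof
  fix j
  have "((\<lambda>x. f x $ j) has_derivative (\<lambda>v. frechet_derivative f (at x) v $ j)) (at x)" if "x \<in> S" for x
    by (rule bounded_linear.has_derivative[OF bounded_linear_vec_nth holo_map_on_frechet(1)[OF f that]])
  then have component: "frechet_derivative (\<lambda>x. f x $ j) (at x) v = frechet_derivative f (at x) v $ j"
    if "x \<in> S" for x
    using frechet_derivative_at that by (metis (no_types, lifting))
  have "holo_fun_on (\<lambda>x. f x $ j) S" using f by (simp add: holo_map_on_components)
  then show "holo_fun_on (\<lambda>x. frechet_derivative f (at x) v $ j) S"
    by (rule holo_fun_on_cong[OF holo_fun_on_derivative[OF _ S] S component])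
qed

section \<open>Second derivatives and the Levi form\<close>

definition second_derivative ::
    "('a::euclidean_space \<Rightarrow> 'b::real_normed_vector) \<Rightarrow> 'a \<Rightarrow> 'a \<Rightarrow> 'a \<Rightarrow> 'b" where
  "second_derivative f x v w = frechet_derivative (\<lambda>y. frechet_derivative f (at y) v) (at x) w"

lemma levi_form_eq_second_derivative:
  "levi_form u z w = (second_derivative u z w w + second_derivative u z (\<i> *s w) (\<i> *s w)) / 4"
  by (simp add: levi_form_def second_derivative_def)

lemma Ck_on_2D:
  assumes "Ck_on 2 f S"
  shows "x \<in> S \<Longrightarrow> (f has_derivative frechet_derivative f (at x)) (at x)"
    and "x \<in> S \<Longrightarrow> ((\<lambda>y. frechet_derivative f (at y) v) has_derivative second_derivative f x v) (at x)"
    and "continuous_on S (\<lambda>x. second_derivative f x v w)"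
proof -
  have f: "Ck_on (Suc (Suc 0)) f S" using assms by (simp add: numeral_2_eq_2)
  show "x \<in> S \<Longrightarrow> (f has_derivative frechet_derivative f (at x)) (at x)"
    by (rule Ck_on_SucD(1)[OF f])
  show "x \<in> S \<Longrightarrow> ((\<lambda>y. frechet_derivative f (at y) v) has_derivative second_derivative f x v) (at x)"
    using Ck_on_SucD(1)[OF Ck_on_SucD(2)[OF f]] by (simp add: second_derivative_def[abs_def])
  show "continuous_on S (\<lambda>x. second_derivative f x v w)"
    using Ck_on_SucD(2)[OF Ck_on_SucD(2)[OF f]] by (simp add: second_derivative_def)
qed

lemma second_derivative_eqI:
  assumes "open S" and "x \<in> S" and "\<And>y. y \<in> S \<Longrightarrow> (f has_derivative D y) (at y)"
    and "((\<lambda>y. D y v) has_derivative D') (at x)"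
  shows "second_derivative f x v w = D' w"
proof -
  have "((\<lambda>y. frechet_derivative f (at y) v) has_derivative D') (at x)"
    using assms(4) assms(1,2)
    by (rule has_derivative_transform_within_open) (simp add: frechet_derivative_at[OF assms(3), symmetric])
  then show ?thesis
    unfolding second_derivative_def by (metis frechet_derivative_at)
qed

lemma bounded_bilinear_second_derivative:
  fixes f :: "'a::euclidean_space \<Rightarrow> 'b::real_normed_vector"
  assumes S: "open S" and f: "Ck_on 2 f S" and x: "x \<in> S"
  shows "bounded_bilinear (second_derivative f x)"
proof -
  note D = Ck_on_2D[OF f]
  have "linear (\<lambda>v. second_derivative f x v w)" for w
  proof (rule linearI)
    fix v v' and r :: real
    have "((\<lambda>y. frechet_derivative f (at y) (v + v')) has_derivative
        (\<lambda>w. second_derivative f x v w + second_derivative f x v' w)) (at x)"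
      by (rule has_derivative_transform_within_open[OF has_derivative_add[OF D(2)[OF x] D(2)[OF x]] S x])
         (simp add: linear_add[OF has_derivative_linear[OF D(1)]])
    from second_derivative_eqI[OF S x D(1) this]
    show "second_derivative f x (v + v') w = second_derivative f x v w + second_derivative f x v' w" .
    have "((\<lambda>y. frechet_derivative f (at y) (r *\<^sub>R v)) has_derivative
        (\<lambda>w. r *\<^sub>R second_derivative f x v w)) (at x)"
      by (rule has_derivative_transform_within_open[OF has_derivative_scaleR_right[OF D(2)[OF x]] S x])
         (simp add: linear_cmul[OF has_derivative_linear[OF D(1)]])
    from second_derivative_eqI[OF S x D(1) this]
    show "second_derivative f x (r *\<^sub>R v) w = r *\<^sub>R second_derivative f x v w" .
  qed
  moreover have "linear (second_derivative f x v)" for v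
    using has_derivative_linear[OF D(2)[OF x]] .
  ultimately show ?thesis
    by (intro bilinear_conv_bounded_bilinear[THEN iffD1]) (simp add: bilinear_def)
qed

lemma second_derivative_add_scaleR:
  assumes S: "open S" "x \<in> S" and f: "Ck_on 2 f S" and g: "Ck_on 2 g S"
  shows "second_derivative (\<lambda>x. f x + c *\<^sub>R g x) x v w = second_derivative f x v w +
      c *\<^sub>R second_derivative g x v w"
  by (rule second_derivative_eqI[OF S
      has_derivative_add[OF Ck_on_2D(1)[OF f] has_derivative_scaleR_right[OF Ck_on_2D(1)[OF g]]]
      has_derivative_add[OF Ck_on_2D(2)[OF f S(2)] has_derivative_scaleR_right[OF Ck_on_2D(2)[OF g S(2)]]]])

lemma has_derivative_linear_family:
  fixes F :: "'a::real_normed_vector \<Rightarrow> 'b::euclidean_space \<Rightarrow> 'c::real_normed_vector"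
  assumes S: "open S" "x \<in> S" and linear: "\<And>y. y \<in> S \<Longrightarrow> linear (F y)"
    and F': "\<And>b. ((\<lambda>y. F y b) has_derivative F' b) (at x)" and g: "(g has_derivative g') (at x)"
  shows "((\<lambda>y. F y (g y)) has_derivative (\<lambda>w. F' (g x) w + F x (g' w))) (at x)"
proof -
  have "((\<lambda>y. \<Sum>b\<in>Basis. (g x \<bullet> b) *\<^sub>R F y b) has_derivative (\<lambda>w. \<Sum>b\<in>Basis. (g x \<bullet> b) *\<^sub>R F' b w)) (at x)"
    by (intro has_derivative_sum has_derivative_scaleR_right F')
  then have "((\<lambda>y. F y (g x)) has_derivative (\<lambda>w. \<Sum>b\<in>Basis. (g x \<bullet> b) *\<^sub>R F' b w)) (at x)"
    by (rule has_derivative_transform_within_open[OF _ S]) (rule linear_sum_Basis[OF linear, symmetric])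
  from has_derivative_unique[OF this F']
  have F'_sum: "(\<Sum>b\<in>Basis. (g x \<bullet> b) *\<^sub>R F' b w) = F' (g x) w" for w by metis
  have "((\<lambda>y. \<Sum>b\<in>Basis. (g y \<bullet> b) *\<^sub>R F y b) has_derivative
      (\<lambda>w. \<Sum>b\<in>Basis. (g x \<bullet> b) *\<^sub>R F' b w + (g' w \<bullet> b) *\<^sub>R F x b)) (at x)"
    by (intro has_derivative_sum has_derivative_scaleR
        bounded_linear.has_derivative[OF bounded_linear_inner_left] F' g)
  then have "((\<lambda>y. F y (g y)) has_derivative
      (\<lambda>w. \<Sum>b\<in>Basis. (g x \<bullet> b) *\<^sub>R F' b w + (g' w \<bullet> b) *\<^sub>R F x b)) (at x)"
    by (rule has_derivative_transform_within_open[OF _ S]) (rule linear_sum_Basis[OF linear, symmetric])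
  then show ?thesis
    by (simp add: sum.distrib F'_sum linear_sum_Basis[OF linear[OF S(2)], of "g' _", symmetric])
qed

lemma second_derivative_compose:
  fixes f :: "'a::euclidean_space \<Rightarrow> 'b::euclidean_space" and g :: "'b \<Rightarrow> 'c::real_normed_vector"
  assumes S: "open S" "x \<in> S" and f: "Ck_on 2 f S" "f ` S \<subseteq> T" and g: "Ck_on 2 g T"
  shows "second_derivative (\<lambda>x. g (f x)) x v w =
    second_derivative g (f x) (frechet_derivative f (at x) v) (frechet_derivative f (at x) w) +
    frechet_derivative g (at (f x)) (second_derivative f x v w)"
proof (rule second_derivative_eqI[OF S])
  have fT: "f y \<in> T" if "y \<in> S" for y using that f(2) by blast
  show "((\<lambda>x. g (f x)) has_derivative
      (\<lambda>v. frechet_derivative g (at (f y)) (frechet_derivative f (at y) v))) (at y)" if "y \<in> S" for y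
    by (rule has_derivative_compose[OF Ck_on_2D(1)[OF f(1) that] Ck_on_2D(1)[OF g fT[OF that]]])
  show "((\<lambda>y. frechet_derivative g (at (f y)) (frechet_derivative f (at y) v)) has_derivative
      (\<lambda>w. second_derivative g (f x) (frechet_derivative f (at x) v) (frechet_derivative f (at x) w) +
        frechet_derivative g (at (f x)) (second_derivative f x v w))) (at x)"
  proof (rule has_derivative_linear_family[OF S])
    show "linear (frechet_derivative g (at (f y)))" if "y \<in> S" for y
      by (rule has_derivative_linear[OF Ck_on_2D(1)[OF g fT[OF that]]])
    show "((\<lambda>y. frechet_derivative g (at (f y)) b) has_derivative
        (\<lambda>w. second_derivative g (f x) b (frechet_derivative f (at x) w))) (at x)" for b
      by (rule has_derivative_compose[OF Ck_on_2D(1)[OF f(1) S(2)] Ck_on_2D(2)[OF g fT[OF S(2)]]])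
  qed (rule Ck_on_2D(2)[OF f(1) S(2)])
qed

lemma second_derivative_norm_sq_compose:
  fixes G :: "'a::euclidean_space \<Rightarrow> 'b::euclidean_space"
  assumes S: "open S" "x \<in> S" and G: "Ck_on 2 G S"
  shows "second_derivative (\<lambda>x. (norm (G x))\<^sup>2) x v w =
    2 * (frechet_derivative G (at x) v \<bullet> frechet_derivative G (at x) w)
      + 2 * (G x \<bullet> second_derivative G x v w)"
proof (rule second_derivative_eqI[OF S])
  note D = Ck_on_2D[OF G]
  show "((\<lambda>x. (norm (G x))\<^sup>2) has_derivative (\<lambda>v. 2 * (G y \<bullet> frechet_derivative G (at y) v))) (at y)"
    if "y \<in> S" for y
    unfolding power2_norm_eq_inner by (auto intro!: derivative_eq_intros D(1)[OF that] simp: inner_commute)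
  show "((\<lambda>y. 2 * (G y \<bullet> frechet_derivative G (at y) v)) has_derivative (\<lambda>w.
      2 * (frechet_derivative G (at x) v \<bullet> frechet_derivative G (at x) w)
        + 2 * (G x \<bullet> second_derivative G x v w))) (at x)"
    by (auto intro!: derivative_eq_intros D(1)[OF S(2)] D(2)[OF S(2)] simp: inner_commute algebra_simps)
qed

lemma Ck_on_norm_sq_compose:
  fixes G :: "'a::euclidean_space \<Rightarrow> 'b::euclidean_space"
  assumes "open S" and "Ck_on k G S"
  shows "Ck_on k (\<lambda>x. (norm (G x))\<^sup>2) S"
  unfolding power2_norm_eq_inner by (rule Ck_on_bilinear[OF bounded_bilinear_inner assms(1,2,2)])

lemma Ck_on_diff_const:
  assumes "open S"
  shows "Ck_on k (\<lambda>x. x - a) S"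
  using Ck_on_add[OF assms Ck_on_linear[OF bounded_linear_ident assms] Ck_on_const[of k "- a"]] by simp

lemma frechet_derivative_diff_const: "frechet_derivative (\<lambda>x. x - a) (at x) = (\<lambda>v. v)"
  by (rule frechet_derivative_at[symmetric]) (auto intro!: derivative_eq_intros)

lemma second_derivative_diff_const: "second_derivative (\<lambda>x. x - a) x v w = 0"
  by (simp add: second_derivative_def frechet_derivative_diff_const)

lemma second_derivative_norm_sq: "second_derivative (\<lambda>x. (norm (x - a))\<^sup>2) x v w = 2 * (v \<bullet> w)"
  using second_derivative_norm_sq_compose[OF open_UNIV UNIV_I Ck_on_diff_const[OF open_UNIV]]
  by (simp add: frechet_derivative_diff_const second_derivative_diff_const)

lemma levi_form_norm_sq: "levi_form (\<lambda>z. (norm (z - a))\<^sup>2) z w = (norm w)\<^sup>2"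
  by (simp add: levi_form_eq_second_derivative second_derivative_norm_sq
      norm_i_scale flip: power2_norm_eq_inner)

lemma levi_form_compose_holo_map:
  fixes \<tau> :: "complex^'n::finite \<Rightarrow> complex^'n"
  assumes S: "open S" "z \<in> S" and \<tau>: "holo_map_on \<tau> S" "\<tau> ` S \<subseteq> T" and u: "Ck_on 2 u T"
  shows "levi_form (\<lambda>z. u (\<tau> z)) z w = levi_form u (\<tau> z) (frechet_derivative \<tau> (at z) w)"
proof -
  let ?D = "\<lambda>z. frechet_derivative \<tau> (at z)"
  have \<tau>2: "Ck_on 2 \<tau> S" by (rule Ck_on_holo_map[OF \<tau>(1) S(1)])
  have D_i: "?D y (\<i> *s w) = \<i> *s ?D y w" if "y \<in> S" for y w
    by (rule holo_map_on_frechet(2)[OF \<tau>(1) that])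
  have "((\<lambda>y. ?D y (\<i> *s w)) has_derivative (\<lambda>v. \<i> *s second_derivative \<tau> z w v)) (at z)"
    using bounded_linear.has_derivative[OF bounded_linear_i_scale Ck_on_2D(2)[OF \<tau>2 S(2)]] S
    by (rule has_derivative_transform_within_open) (simp add: D_i)
  from second_derivative_eqI[OF S Ck_on_2D(1)[OF \<tau>2] this]
  have "second_derivative \<tau> z (\<i> *s w) v = \<i> *s second_derivative \<tau> z w v" for v .
  moreover have "second_derivative \<tau> z w (\<i> *s w) = \<i> *s second_derivative \<tau> z w w"
    unfolding second_derivative_def
    by (rule holo_map_on_frechet(2)[OF holo_map_on_derivative[OF \<tau>(1) S(1)] S(2)])
  ultimately have "second_derivative \<tau> z (\<i> *s w) (\<i> *s w) = - second_derivative \<tau> z w w"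
    by (simp add: i_scale_i_scale del: vector_smult_assoc)
  moreover have "linear (frechet_derivative u (at (\<tau> z)))"
    using \<tau>(2) S(2) by (intro has_derivative_linear[OF Ck_on_2D(1)[OF u]]) auto
  ultimately show ?thesis
    unfolding levi_form_eq_second_derivative second_derivative_compose[OF S \<tau>2 \<tau>(2) u] D_i[OF S(2)]
    by (simp add: linear_neg)
qed

section \<open>Functions with positive Levi form\<close>

lemma continuous_on_bilinear_family:
  fixes B :: "'t::topological_space \<Rightarrow> 'a::euclidean_space \<Rightarrow> 'b::euclidean_space \<Rightarrow> 'c::real_normed_vector"
  assumes bilinear: "\<And>t. t \<in> S \<Longrightarrow> bounded_bilinear (B t)"
    and coefficients: "\<And>a b. continuous_on S (\<lambda>t. B t a b)"
    and v: "continuous_on S v" and w: "continuous_on S w"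
  shows "continuous_on S (\<lambda>t. B t (v t) (w t))"
proof -
  have "continuous_on S (\<lambda>t. \<Sum>a\<in>Basis. (v t \<bullet> a) *\<^sub>R (\<Sum>b\<in>Basis. (w t \<bullet> b) *\<^sub>R B t a b))"
    by (intro continuous_intros coefficients v w)
  then show ?thesis
  proof (rule continuous_on_eq)
    fix t assume "t \<in> S"
    then interpret B: bounded_bilinear "B t" by (rule bilinear)
    have "B t (v t) (w t) = (\<Sum>a\<in>Basis. (v t \<bullet> a) *\<^sub>R B t a (w t))"
      by (rule linear_sum_Basis[OF bounded_linear.linear[OF B.bounded_linear_left]])
    then show "(\<Sum>a\<in>Basis. (v t \<bullet> a) *\<^sub>R (\<Sum>b\<in>Basis. (w t \<bullet> b) *\<^sub>R B t a b)) = B t (v t) (w t)"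
      using linear_sum_Basis[OF bounded_linear.linear[OF B.bounded_linear_right], of _ "w t"] by simp
  qed
qed

lemma continuous_on_second_derivative:
  assumes S: "open S" and f: "Ck_on 2 f S" and x: "continuous_on T x" "x ` T \<subseteq> S"
    and v: "continuous_on T v" and w: "continuous_on T w"
  shows "continuous_on T (\<lambda>t. second_derivative f (x t) (v t) (w t))"
proof (rule continuous_on_bilinear_family[OF _ _ v w])
  show "bounded_bilinear (second_derivative f (x t))" if "t \<in> T" for t
    using that x(2) by (intro bounded_bilinear_second_derivative[OF S f]) auto
  show "continuous_on T (\<lambda>t. second_derivative f (x t) a b)" for a b
    by (rule continuous_on_compose2[OF Ck_on_2D(3)[OF f] x])
qed

lemma pos_quadratic_family_lower_bound:
  fixes q :: "'a::metric_space \<Rightarrow> 'b::euclidean_space \<Rightarrow> real"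
  assumes S: "open S" "a \<in> S" and cont: "continuous_on (S \<times> sphere 0 1) (\<lambda>(x, v). q x v)"
    and homogeneous: "\<And>x r v. x \<in> S \<Longrightarrow> q x (r *\<^sub>R v) = r\<^sup>2 * q x v"
    and pos: "\<And>v. v \<noteq> 0 \<Longrightarrow> 0 < q a v"
  obtains m r where "0 < m" "0 < r" "cball a r \<subseteq> S" "\<And>x v. x \<in> cball a r \<Longrightarrow> m * (norm v)\<^sup>2 \<le> q x v"
proof -
  have "continuous_on (sphere 0 1) (q a)"
    using continuous_on_compose2[OF cont
        continuous_on_Pair[OF continuous_on_const continuous_on_id]] S(2) by auto
  moreover have "sphere (0::'b) 1 \<noteq> {}" by simp
  ultimately obtain v0 where v0: "v0 \<in> sphere 0 1" "\<And>v. v \<in> sphere 0 1 \<Longrightarrow> q a v0 \<le> q a v"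
    using continuous_attains_inf[OF compact_sphere] by blast
  define m where "m = q a v0 / 2"
  have "v0 \<noteq> 0" using v0(1) by auto
  then have m: "0 < m" using pos by (simp add: m_def)
  obtain X where X: "a \<in> X" "open X"
    "\<forall>x\<in>X \<inter> S. \<forall>v\<in>sphere 0 1. dist (case (x, v) of (x, v) \<Rightarrow> q x v) (case (a, v) of (x, v) \<Rightarrow> q x v) \<le> m"
    by (rule continuous_on_prod_compactE[OF cont compact_sphere S(2) m])
  have "open (X \<inter> S)" "a \<in> X \<inter> S" using X S by auto
  then obtain r where r: "0 < r" "cball a r \<subseteq> X \<inter> S"
    using open_contains_cball by blast
  show thesis
  proof (rule that[OF m r(1)])
    fix x v assume "x \<in> cball a r"
    then have x: "x \<in> X" "x \<in> S" using r(2) by auto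
    show "m * (norm v)\<^sup>2 \<le> q x v"
    proof (cases "v = 0")
      case True
      then show ?thesis using homogeneous[of x 0 v] x(2) by simp
    next
      case False
      then have "sgn v \<in> sphere 0 1" by (simp add: norm_sgn)
      then have "\<bar>q x (sgn v) - q a (sgn v)\<bar> \<le> m" "2 * m \<le> q a (sgn v)"
        using X(3) x v0(2) by (auto simp: m_def dist_real_def)
      then have "m \<le> q x (sgn v)" by linarith
      moreover have "q x v = (norm v)\<^sup>2 * q x (sgn v)"
        using homogeneous[of x "norm v" "sgn v"] x(2) False by (simp add: sgn_div_norm)
      ultimately show ?thesis by (simp add: mult.commute mult_right_mono)
    qed
  qed (use r in auto)
qed

lemma levi_form_lower_bound:
  assumes S: "open S" "a \<in> S" and u: "Ck_on 2 u S" and pos: "\<And>w. w \<noteq> 0 \<Longrightarrow> 0 < levi_form u a w"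
  obtains m r where "0 < m" "0 < r" "cball a r \<subseteq> S" "\<And>x w. x \<in> cball a r \<Longrightarrow> m * (norm w)\<^sup>2 \<le> levi_form u x w"
proof (rule pos_quadratic_family_lower_bound[OF S, of "levi_form u"])
  interpret J: bounded_linear "\<lambda>v::complex^'a. \<i> *s v" by (rule bounded_linear_i_scale)
  have bilinear: "bounded_bilinear (second_derivative u x)" if "x \<in> S" for x
    by (rule bounded_bilinear_second_derivative[OF S(1) u that])
  show "levi_form u x (r *\<^sub>R w) = r\<^sup>2 * levi_form u x w" if "x \<in> S" for x r w
    using bounded_bilinear.scaleR_left[OF bilinear[OF that]]
      bounded_bilinear.scaleR_right[OF bilinear[OF that]]
    by (simp add: levi_form_eq_second_derivative J.scaleR power2_eq_square algebra_simps)
  show "continuous_on (S \<times> sphere 0 1) (\<lambda>(x, w). levi_form u x w)"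
    unfolding levi_form_eq_second_derivative case_prod_beta
    by (intro continuous_intros continuous_on_second_derivative[OF S(1) u] J.continuous_on) auto
qed (use pos that in auto)

lemma second_order_mean_value:
  fixes u :: "'a::euclidean_space \<Rightarrow> real"
  assumes u: "Ck_on 2 u S" and segment: "\<And>t. t \<in> {0..1} \<Longrightarrow> x + t *\<^sub>R v \<in> S"
  obtains t where "t \<in> {0<..<1}"
    "u (x + v) = u x + frechet_derivative u (at x) v + second_derivative u (x + t *\<^sub>R v) v v / 2"
proof -
  let ?D = "\<lambda>x. frechet_derivative u (at x) v"
  define diff where "diff m t = (if m = 0 then u (x + t *\<^sub>R v) else if m = Suc 0 then ?D (x + t *\<^sub>R v)
      else second_derivative u (x + t *\<^sub>R v) v v)" for m :: nat and t
  have line: "((\<lambda>t. f (x + t *\<^sub>R v)) has_real_derivative f' v) (at t)"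
    if "(f has_derivative f') (at (x + t *\<^sub>R v))" for f f' and t :: real
  proof -
    have "((\<lambda>t. x + t *\<^sub>R v) has_derivative (\<lambda>h. h *\<^sub>R v)) (at t)" by (auto intro!: derivative_eq_intros)
    from has_derivative_compose[OF this that] show ?thesis
      unfolding has_field_derivative_def
      by (rule has_derivative_eq_rhs)
         (simp add: fun_eq_iff linear_cmul[OF has_derivative_linear[OF that]] mult.commute)
  qed
  have "\<forall>m t. m < 2 \<and> 0 \<le> t \<and> t \<le> 1 \<longrightarrow> (diff m has_real_derivative diff (Suc m) t) (at t)"
    using line[OF Ck_on_2D(1)[OF u segment]] line[OF Ck_on_2D(2)[OF u segment]]
    by (auto simp: diff_def[abs_def] less_2_cases_iff)
  from Taylor_up[OF _ refl this, of 0] obtain t where "0 < t" "t < 1"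
    "diff 0 1 = (\<Sum>m<2. diff m 0 / fact m * (1 - 0) ^ m) + diff 2 t / fact 2 * (1 - 0)\<^sup>2" by auto
  then show thesis
    by (intro that[of t]) (auto simp: diff_def numeral_2_eq_2)
qed

text \<open>
  The Hessian \<open>B\<close> of \<open>u\<close> satisfies \<open>B v v = (B v v - B (\<i> v) (\<i> v)) / 2 + 2 levi_form u z v\<close>: the first
  summand is pluriharmonic, so positivity of the Levi form makes the holomorphic part of the
  second-order Taylor polynomial a minorant.
\<close>

lemma second_derivative_ge_holomorphic_part:
  fixes u :: "complex^'n::finite \<Rightarrow> real"
  assumes S: "open S" "z \<in> S" and u: "Ck_on 2 u S" and pos: "\<And>w. w \<noteq> 0 \<Longrightarrow> 0 < levi_form u z w"
  obtains r where "0 < r" "cball z r \<subseteq> S"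
    "\<And>x v. x \<in> cball z r \<Longrightarrow> Re (complexify_bilinear (second_derivative u z) v v) / 2
        \<le> second_derivative u x v v"
proof -
  let ?B = "second_derivative u" and ?C = "complexify_bilinear (second_derivative u z)"
  have B: "bounded_bilinear (?B x)" if "x \<in> S" for x
    by (rule bounded_bilinear_second_derivative[OF S(1) u that])
  interpret C: bounded_bilinear ?C by (rule bounded_bilinear_complexify_bilinear[OF B[OF S(2)]])
  obtain m r where mr: "0 < m" "0 < r" "cball z r \<subseteq> S"
    "\<And>x v. x \<in> cball z r \<Longrightarrow> m * (norm v)\<^sup>2 \<le> ?B x v v - Re (?C v v) / 2"
  proof (rule pos_quadratic_family_lower_bound[OF S, of "\<lambda>x v. ?B x v v - Re (?C v v) / 2"])
    show "?B x (r *\<^sub>R v) (r *\<^sub>R v) - Re (?C (r *\<^sub>R v) (r *\<^sub>R v)) / 2 = r\<^sup>2 * (?B x v v - Re (?C v v) / 2)"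
      if "x \<in> S" for x r v
      unfolding C.scaleR_left C.scaleR_right bounded_bilinear.scaleR_left[OF B[OF that]]
        bounded_bilinear.scaleR_right[OF B[OF that]]
      by (simp add: power2_eq_square algebra_simps del: Re_complexify_bilinear)
    show "continuous_on (S \<times> sphere 0 1) (\<lambda>(x, v). ?B x v v - Re (?C v v) / 2)"
      unfolding case_prod_beta
      by (intro continuous_intros continuous_on_second_derivative[OF S(1) u]
          bounded_linear.continuous_on[OF bounded_linear_Re] C.continuous_on) auto
    show "0 < ?B z v v - Re (?C v v) / 2" if "v \<noteq> 0" for v
      using pos[OF that] by (simp add: levi_form_eq_second_derivative field_simps)
  qed (use that in blast)
  show thesis
  proof (rule that[OF mr(2,3)])
    fix x v :: "complex^'n" assume "x \<in> cball z r"
    moreover have "0 \<le> m * (norm v)\<^sup>2" using mr(1) by simp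
    ultimately show "Re (?C v v) / 2 \<le> ?B x v v" using mr(4)[of x v] by linarith
  qed
qed

lemma pluriharmonic_minorant_at_levi_form_pos:
  assumes S: "open S" "z \<in> S" and u: "Ck_on 2 u S" and pos: "\<And>w. w \<noteq> 0 \<Longrightarrow> 0 < levi_form u z w"
  shows "pluriharmonic_minorant_at u z"
proof -
  let ?C = "complexify_bilinear (second_derivative u z)" and ?D = "frechet_derivative u (at z)"
  have B: "bounded_bilinear (second_derivative u z)"
    by (rule bounded_bilinear_second_derivative[OF S(1) u S(2)])
  obtain r where r: "0 < r" "cball z r \<subseteq> S"
    "\<And>x v. x \<in> cball z r \<Longrightarrow> Re (?C v v) / 2 \<le> second_derivative u x v v"
    using second_derivative_ge_holomorphic_part[OF S u pos] by blast
  define F where "F y = of_real (u z) +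
      (complexify_linear ?D (y + - z) + of_real (1/4) * ?C (y + - z) (y + - z))" for y
  have "holo_fun_on F (ball z r)"
    unfolding F_def
    by (intro holo_fun_on_add holo_fun_on_const holo_fun_on_cmult
        holo_fun_on_translate[OF holo_fun_on_complexify_linear[where S = UNIV]]
        holo_fun_on_translate[OF holo_fun_on_complexify_bilinear[OF B, where S = UNIV]]
        has_derivative_bounded_linear[OF Ck_on_2D(1)[OF u S(2)]] UNIV_I)
  moreover have "Re (F y) \<le> u y" if y: "y \<in> ball z r" for y
  proof -
    define v where "v = y - z"
    have near: "z + t *\<^sub>R v \<in> cball z r" if "t \<in> {0..1}" for t
      using that y mult_mono[of t 1 "norm v" r] by (auto simp: v_def dist_norm norm_minus_commute)
    obtain t where t: "t \<in> {0<..<1}" "u (z + v) = u z + ?D v + second_derivative u (z + t *\<^sub>R v) v v / 2"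
      by (rule second_order_mean_value[OF u]) (use near r(2) in blast)
    have "Re (?C v v) / 2 \<le> second_derivative u (z + t *\<^sub>R v) v v"
      using r(3)[OF near] t(1) by simp
    then show ?thesis using t(2) by (simp add: F_def v_def del: Re_complexify_bilinear)
  qed
  moreover have "Re (F z) = u z"
    by (simp add: F_def bounded_bilinear.zero_left[OF bounded_bilinear_complexify_bilinear[OF B]]
        linear_0[OF has_derivative_linear[OF Ck_on_2D(1)[OF u S(2)]]] del: Re_complexify_bilinear)
  ultimately show ?thesis
    using r(1) unfolding pluriharmonic_minorant_at_def by (intro exI[of _ F] exI[of _ "ball z r"]) auto
qed

lemma strong_psh_levi_form_pos:
  assumes "open S" and "Ck_on 2 u S" and "\<And>z w. z \<in> S \<Longrightarrow> w \<noteq> 0 \<Longrightarrow> 0 < levi_form u z w"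
  shows "strong_psh S u"
  using assms Ck_on_le[of 2 u S 0] pluriharmonic_minorant_at_levi_form_pos[OF assms(1) _ assms(2)]
  by (auto simp: strong_psh_def)

lemma strong_psh_norm_sq: "strong_psh S (\<lambda>z. (norm (z - a))\<^sup>2)"
  by (rule strong_psh_subset[OF strong_psh_levi_form_pos[OF open_UNIV
        Ck_on_norm_sq_compose[OF open_UNIV Ck_on_diff_const[OF open_UNIV]]]])
     (auto simp: levi_form_norm_sq)

definition uniformly_psh :: "real \<Rightarrow> (complex^'n::finite) set \<Rightarrow> (complex^'n \<Rightarrow> real) \<Rightarrow> bool" where
  "uniformly_psh \<kappa> S u \<longleftrightarrow> (\<forall>q. strong_psh S (\<lambda>z. u z - \<kappa> * (norm (z - q))\<^sup>2))"

lemma uniformly_psh_subset: "uniformly_psh \<kappa> S u \<Longrightarrow> T \<subseteq> S \<Longrightarrow> uniformly_psh \<kappa> T u"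
  unfolding uniformly_psh_def using strong_psh_subset by blast

lemma uniformly_psh_continuous:
  assumes "uniformly_psh \<kappa> S u"
  shows "continuous_on S u"
proof -
  have "continuous_on S (\<lambda>z. (u z - \<kappa> * (norm (z - 0))\<^sup>2) + \<kappa> * (norm (z - 0))\<^sup>2)"
    using assms unfolding uniformly_psh_def
    by (intro continuous_on_add strong_psh_continuous continuous_intros) blast
  then show ?thesis by simp
qed

lemma uniformly_psh_levi_form:
  assumes S: "open S" and u: "Ck_on 2 u S"
    and levi: "\<And>z w. z \<in> S \<Longrightarrow> w \<noteq> 0 \<Longrightarrow> \<kappa> * (norm w)\<^sup>2 < levi_form u z w"
  shows "uniformly_psh \<kappa> S u"
  unfolding uniformly_psh_def
proof
  fix q
  have norm_sq: "Ck_on 2 (\<lambda>z. (norm (z - q))\<^sup>2) S"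
    by (rule Ck_on_norm_sq_compose[OF S Ck_on_diff_const[OF S]])
  have "strong_psh S (\<lambda>z. u z + (- \<kappa>) *\<^sub>R (norm (z - q))\<^sup>2)"
  proof (rule strong_psh_levi_form_pos[OF S])
    show "Ck_on 2 (\<lambda>z. u z + (- \<kappa>) *\<^sub>R (norm (z - q))\<^sup>2) S"
      by (intro Ck_on_add[OF S u] Ck_on_linear_compose[OF bounded_linear_scaleR_right S norm_sq])
    show "0 < levi_form (\<lambda>z. u z + (- \<kappa>) *\<^sub>R (norm (z - q))\<^sup>2) z w" if "z \<in> S" "w \<noteq> 0" for z w
    proof -
      have "levi_form (\<lambda>z. u z + (- \<kappa>) *\<^sub>R (norm (z - q))\<^sup>2) z w =
          levi_form u z w - \<kappa> * levi_form (\<lambda>z. (norm (z - q))\<^sup>2) z w"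
        unfolding levi_form_eq_second_derivative second_derivative_add_scaleR[OF S that(1) u norm_sq]
        by (simp add: field_simps)
      then show ?thesis using levi[OF that] by (simp add: levi_form_norm_sq)
    qed
  qed
  then show "strong_psh S (\<lambda>z. u z - \<kappa> * (norm (z - q))\<^sup>2)" by simp
qed

lemma uniformly_psh_near_totally_real_zero:
  fixes G :: "complex^'n::finite \<Rightarrow> 'b::euclidean_space"
  assumes N: "open N" "a \<in> N" and G: "Ck_on 2 G N" "G a = 0"
    and totally_real: "\<And>v. frechet_derivative G (at a) v = 0 \<Longrightarrow>
        frechet_derivative G (at a) (\<i> *s v) = 0 \<Longrightarrow> v = 0"
  obtains r \<kappa> where "0 < r" "0 < \<kappa>" "ball a r \<subseteq> N" "uniformly_psh \<kappa> (ball a r) (\<lambda>z. (norm (G z))\<^sup>2)"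
proof -
  let ?D = "frechet_derivative G (at a)" and ?u = "\<lambda>z. (norm (G z))\<^sup>2"
  have u: "Ck_on 2 ?u N" by (rule Ck_on_norm_sq_compose[OF N(1) G(1)])
  have "0 < levi_form ?u a w" if "w \<noteq> 0" for w
  proof -
    have "levi_form ?u a w = ((norm (?D w))\<^sup>2 + (norm (?D (\<i> *s w)))\<^sup>2) / 2"
      unfolding levi_form_eq_second_derivative second_derivative_norm_sq_compose[OF N G(1)] G(2)
      by (simp add: power2_norm_eq_inner)
    moreover have "?D w \<noteq> 0 \<or> ?D (\<i> *s w) \<noteq> 0" using totally_real that by blast
    ultimately show ?thesis by (smt (verit) divide_pos_pos norm_eq_zero power2_less_0 zero_less_power2)
  qed
  from levi_form_lower_bound[OF N u this] obtain m r where mr: "0 < m" "0 < r" "cball a r \<subseteq> N"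
    "\<And>z w. z \<in> cball a r \<Longrightarrow> m * (norm w)\<^sup>2 \<le> levi_form ?u z w" by blast
  show thesis
  proof (rule that[OF mr(2), of "m / 2"])
    show "ball a r \<subseteq> N" using mr(3) by auto
    show "uniformly_psh (m / 2) (ball a r) ?u"
    proof (rule uniformly_psh_levi_form[OF open_ball Ck_on_subset[OF u \<open>ball a r \<subseteq> N\<close>]])
      fix z w :: "complex^'n" assume "z \<in> ball a r" "w \<noteq> 0"
      then have "m * (norm w)\<^sup>2 \<le> levi_form ?u z w" "0 < m * (norm w)\<^sup>2" using mr(1,4) by auto
      then show "m / 2 * (norm w)\<^sup>2 < levi_form ?u z w" by simp
    qed
  qed (use mr in simp)
qed

section \<open>Hulls\<close>

definition hull_in :: "(complex^'n::finite) set \<Rightarrow> (complex^'n) set \<Rightarrow> (complex^'n) set" where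
  "hull_in B K = {q \<in> B. \<forall>u. strong_psh B u \<longrightarrow> (\<exists>x\<in>K. u q \<le> u x)}"

text \<open>Wherever \<open>f = 0\<close> on the domain below, \<open>v < s\<close>, so that the two branches agree near such points.\<close>

lemma strong_psh_extend_by_const:
  assumes B: "open B" and v: "strong_psh B v" and f: "continuous_on B f"
  shows "open {z \<in> B. f z \<noteq> (0::real) \<or> v z < s}"
    and "strong_psh {z \<in> B. f z \<noteq> 0 \<or> v z < s} (\<lambda>z. if 0 < f z then max (v z) s else s)"
proof -
  let ?D = "{z \<in> B. f z \<noteq> 0 \<or> v z < s}"
  define V V' where "V = B \<inter> f -` {0<..}" and "V' = B \<inter> f -` {..<0}"
  have open_V: "open V" and open_V': "open V'"
    unfolding V_def V'_def by (rule continuous_open_preimage[OF f B]; simp)+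
  have "?D = V \<union> V' \<union> (B \<inter> v -` {..<s})" by (auto simp: V_def V'_def)
  then show open_D: "open ?D"
    using open_V open_V' continuous_open_preimage[OF strong_psh_continuous[OF v] B] by auto
  have "strong_psh ?D (\<lambda>z. if z \<in> V then max (v z) s else s)"
  proof (rule strong_psh_glue[OF open_D strong_psh_const B v open_V])
    show "V \<inter> ?D \<subseteq> B" by (auto simp: V_def)
    fix y assume y: "y \<in> frontier V \<inter> ?D"
    have "V \<inter> V' = {}" by (auto simp: V_def V'_def)
    then have "closure V \<inter> V' = {}" using open_V' by (metis inf_commute open_Int_closure_eq_empty)
    then have "y \<notin> V" "y \<notin> V'" using y open_V by (auto simp: frontier_def interior_open)
    then show "y \<in> B \<and> v y < s" using y by (auto simp: V_def V'_def)
  qed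
  then show "strong_psh ?D (\<lambda>z. if 0 < f z then max (v z) s else s)"
    by (rule strong_psh_cong[OF open_D, rotated]) (auto simp: V_def)
qed

lemma compact_pos_lower_bound:
  fixes f :: "'a::topological_space \<Rightarrow> real"
  assumes "compact C" and "continuous_on C f" and "\<And>y. y \<in> C \<Longrightarrow> 0 < f y"
  obtains \<eta> where "0 < \<eta>" "\<And>y. y \<in> C \<Longrightarrow> \<eta> \<le> f y"
proof (cases "C = {}")
  case True
  then show thesis using that[of 1] by simp
next
  case False
  then obtain y where "y \<in> C" "\<And>x. x \<in> C \<Longrightarrow> f y \<le> f x"
    using continuous_attains_inf[OF assms(1) _ assms(2)] by blast
  then show thesis using that[of "f y"] assms(3) by blast
qed

lemma compact_dominating_multiple:
  fixes f g :: "'a::topological_space \<Rightarrow> real"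
  assumes C: "compact C" and f: "continuous_on C f" and g: "continuous_on C g" "\<And>y. y \<in> C \<Longrightarrow> 0 < g y"
  obtains M where "0 \<le> M" "\<And>y. y \<in> C \<Longrightarrow> f y < M * g y"
proof -
  have "bounded ((\<lambda>y. f y / g y) ` C)"
    by (intro compact_imp_bounded compact_continuous_image C continuous_intros f g) (use g(2) in force)
  then obtain b where b: "0 < b" "\<And>y. y \<in> C \<Longrightarrow> \<bar>f y / g y\<bar> \<le> b"
    by (auto simp: bounded_pos)
  show thesis
  proof (rule that[of "b + 1"])
    fix y assume y: "y \<in> C"
    have "f y / g y < b + 1" using b(2)[OF y] by linarith
    then show "f y < (b + 1) * g y" using g(2)[OF y] by (simp add: pos_divide_less_eq)
  qed (use b in simp)
qed

lemma compact_ray_endpoint: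
  fixes w :: "'a::euclidean_space"
  assumes Y: "compact Y" and w: "w \<in> Y" "w \<noteq> 0"
  obtains s where "1 \<le> s" "s *\<^sub>R w \<in> Y" "\<And>s'. s < s' \<Longrightarrow> s' *\<^sub>R w \<notin> Y"
proof -
  let ?S = "(\<lambda>s. s *\<^sub>R w) -` Y \<inter> {1..}"
  obtain b where b: "\<And>y. y \<in> Y \<Longrightarrow> norm y \<le> b"
    using compact_imp_bounded[OF Y] by (auto simp: bounded_iff)
  have "closed ?S"
    by (intro closed_vimage_Int compact_imp_closed[OF Y] continuous_intros closed_atLeast)
  moreover have "?S \<subseteq> cball 0 (b / norm w)"
  proof
    fix s assume "s \<in> ?S"
    then have "\<bar>s\<bar> * norm w \<le> b" using b[of "s *\<^sub>R w"] by simp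
    then show "s \<in> cball 0 (b / norm w)" using w(2) by (simp add: pos_le_divide_eq)
  qed
  ultimately have "compact ?S" using compact_Int_closed[OF compact_cball] by (metis inf.absorb2)
  moreover have "1 \<in> ?S" using w(1) by simp
  ultimately obtain s where "s \<in> ?S" "\<And>s'. s' \<in> ?S \<Longrightarrow> s' \<le> s"
    using compact_attains_sup[of ?S] by blast
  then show thesis by (intro that[of s]) force+
qed

locale compact_hull =
  fixes B K :: "(complex^'n::finite) set"
  assumes open_B: "open B" and compact_K: "compact K" and K_nonempty: "K \<noteq> {}" and K_subset: "K \<subseteq> B"
    and compact_hull_in: "compact (hull_in B K)"
begin

lemma hull_superset: "K \<subseteq> hull_in B K"
  using K_subset by (auto simp: hull_in_def)

lemma hull_subset: "hull_in B K \<subseteq> B"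
  by (auto simp: hull_in_def)

lemma separating_function:
  assumes y: "y \<in> B" "y \<notin> hull_in B K"
  obtains v where "strong_psh B v" "\<And>x. x \<in> K \<Longrightarrow> v x \<le> 0" "0 < v y"
proof -
  obtain u where u: "strong_psh B u" "\<And>x. x \<in> K \<Longrightarrow> u x < u y"
    using y unfolding hull_in_def by force
  obtain m where m: "m \<in> K" "\<And>x. x \<in> K \<Longrightarrow> u x \<le> u m"
    using continuous_attains_sup[OF compact_K K_nonempty
        continuous_on_subset[OF strong_psh_continuous[OF u(1)] K_subset]] by blast
  show thesis
    by (rule that[OF strong_psh_add[OF u(1) strong_psh_const[of _ "- u m"]]]) (use u m in auto)
qed

lemma separating_function_compact:
  assumes C: "compact C" "C \<subseteq> B" "C \<inter> hull_in B K = {}"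
  obtains \<phi> where "strong_psh B \<phi>" "\<And>x. x \<in> K \<Longrightarrow> \<phi> x = 0" "\<And>z. 0 \<le> \<phi> z" "\<And>y. y \<in> C \<Longrightarrow> 0 < \<phi> y"
proof -
  define V where "V = {v. strong_psh B v \<and> (\<forall>x\<in>K. v x \<le> 0)}"
  have positive_open: "open (B \<inter> v -` {0<..})" if "v \<in> V" for v
    by (rule continuous_open_preimage) (use that open_B strong_psh_continuous in \<open>auto simp: V_def\<close>)
  have cover: "C \<subseteq> (\<Union>v\<in>V. B \<inter> v -` {0<..})"
  proof
    fix y assume "y \<in> C"
    then have "y \<in> B" "y \<notin> hull_in B K" using C by auto
    then obtain v where "strong_psh B v" "\<And>x. x \<in> K \<Longrightarrow> v x \<le> 0" "0 < v y"
      using separating_function by blast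
    then show "y \<in> (\<Union>v\<in>V. B \<inter> v -` {0<..})" using \<open>y \<in> B\<close> by (auto simp: V_def)
  qed
  obtain F where F: "F \<subseteq> V" "finite F" "C \<subseteq> (\<Union>v\<in>F. B \<inter> v -` {0<..})"
    using compactE_image[OF C(1) positive_open cover] by blast
  have "\<exists>\<phi>. strong_psh B \<phi> \<and> (\<forall>x\<in>K. \<phi> x = 0) \<and> (\<forall>z. 0 \<le> \<phi> z) \<and> (\<forall>v\<in>F. \<forall>z. v z \<le> \<phi> z)"
    using F(2,1)
  proof (induction F rule: finite_induct)
    case empty
    show ?case by (rule exI[of _ "\<lambda>z. 0"]) (auto intro: strong_psh_const)
  next
    case (insert v F)
    then obtain \<phi> where \<phi>: "strong_psh B \<phi>" "\<forall>x\<in>K. \<phi> x = 0" "\<forall>z. 0 \<le> \<phi> z" "\<forall>v\<in>F. \<forall>z. v z \<le> \<phi> z" by blast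
    have "strong_psh B (\<lambda>z. max (\<phi> z) (v z))"
      using insert.prems \<phi>(1) by (auto intro: strong_psh_max simp: V_def)
    moreover have "\<forall>x\<in>K. max (\<phi> x) (v x) = 0" using insert.prems \<phi>(2) by (auto simp: V_def)
    ultimately show ?case
      using \<phi>(3,4) by (intro exI[of _ "\<lambda>z. max (\<phi> z) (v z)"]) (auto simp: le_max_iff_disj)
  qed
  then obtain \<phi> where \<phi>: "strong_psh B \<phi>" "\<forall>x\<in>K. \<phi> x = 0" "\<forall>z. 0 \<le> \<phi> z" "\<forall>v\<in>F. \<forall>z. v z \<le> \<phi> z" by blast
  show thesis
  proof (rule that[OF \<phi>(1)])
    fix y assume "y \<in> C"
    then obtain v where "v \<in> F" "0 < v y" using F(3) by auto
    then show "0 < \<phi> y" using \<phi>(4) less_le_trans by blast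
  qed (use \<phi> in auto)
qed

text \<open>
  Only the values near the hull matter: a function near the hull can be glued to a multiple of a
  function on \<open>B\<close> that vanishes on \<open>K\<close> and is large away from the hull.
\<close>

lemma hull_maximum_principle:
  assumes N: "open N" "hull_in B K \<subseteq> N" "N \<subseteq> B" and u: "strong_psh N u" and q: "q \<in> hull_in B K"
  shows "\<exists>x\<in>K. u q \<le> u x"
proof -
  have u_cont: "continuous_on N u" by (rule strong_psh_continuous[OF u])
  have K_N: "K \<subseteq> N" using hull_superset N(2) by blast
  obtain m where m: "m \<in> K" "\<And>x. x \<in> K \<Longrightarrow> u x \<le> u m"
    using continuous_attains_sup[OF compact_K K_nonempty continuous_on_subset[OF u_cont K_N]] by blast
  obtain V W where V: "hull_in B K \<subseteq> V" "openin (top_of_set N) V" and W: "V \<subseteq> W" "W \<subseteq> N" "compact W"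
    using open_imp_locally_compact[OF N(1)] N(1,2) compact_hull_in
    unfolding locally_compact_compact_subopen by (meson order_refl)
  have "open V" using V(2) N(1) by (simp add: openin_open_eq)
  have closure_V: "closure V \<subseteq> W" using W by (intro closure_minimal compact_imp_closed)
  have frontier_V: "frontier V \<subseteq> N" "frontier V \<inter> hull_in B K = {}"
    using closure_V W(2) V(1) \<open>open V\<close> by (auto simp: frontier_def interior_open)
  have compact_frontier: "compact (frontier V)"
    using closure_V W(3) compact_closure bounded_subset compact_imp_bounded
    by (metis compact_frontier_bounded bounded_subset closure_subset order_trans)
  obtain \<phi> where \<phi>: "strong_psh B \<phi>" "\<And>x. x \<in> K \<Longrightarrow> \<phi> x = 0" "\<And>z. 0 \<le> \<phi> z" "\<And>y. y \<in> frontier V \<Longrightarrow> 0 < \<phi> y"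
    using separating_function_compact[OF compact_frontier _ frontier_V(2)] frontier_V(1) N(3) by blast
  obtain M where M: "0 \<le> M" "\<And>y. y \<in> frontier V \<Longrightarrow> u y + - u m < M * \<phi> y"
  proof (rule compact_dominating_multiple[OF compact_frontier])
    show "continuous_on (frontier V) (\<lambda>y. u y + - u m)"
      by (intro continuous_intros continuous_on_subset[OF u_cont frontier_V(1)])
    show "0 < \<phi> y" if "y \<in> frontier V" for y by (rule \<phi>(4)[OF that])
    show "continuous_on (frontier V) \<phi>"
      using frontier_V(1) N(3) by (intro continuous_on_subset[OF strong_psh_continuous[OF \<phi>(1)]]) blast
  qed (rule that)
  let ?w = "\<lambda>z. if z \<in> V then max (u z + - u m) (M * \<phi> z) else M * \<phi> z"
  have "strong_psh B ?w"
  proof (rule strong_psh_glue[OF open_B strong_psh_cmult[OF \<phi>(1) M(1)] N(1)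
      strong_psh_add[OF u strong_psh_const]])
    show "V \<inter> B \<subseteq> N" using W by blast
    show "y \<in> N \<and> u y + - u m < M * \<phi> y" if "y \<in> frontier V \<inter> B" for y
      using that frontier_V(1) M(2) by blast
  qed (rule \<open>open V\<close>)
  then obtain x where x: "x \<in> K" "?w q \<le> ?w x"
    using q unfolding hull_in_def by blast
  have "q \<in> V" "x \<in> V" using q x(1) V(1) hull_superset by auto
  then have "u q \<le> u m" using x(2) m(2)[OF x(1)] \<phi>(2)[OF x(1)] by (auto simp: max_def split: if_splits)
  then show ?thesis using m(1) by blast
qed

lemma hull_log_dist_image:
  assumes P: "holo_fun_on P B" and w: "w \<notin> P ` hull_in B K" and q: "q \<in> hull_in B K" and M: "0 \<le> M"
  shows "\<exists>x\<in>K. M * (norm (q - a))\<^sup>2 - ln (cmod (P q - w)) \<le> M * (norm (x - a))\<^sup>2 - ln (cmod (P x - w))"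
proof -
  let ?N = "B \<inter> P -` (- {w})"
  have N: "open ?N"
    by (rule continuous_open_preimage[OF continuous_on_holo_fun[OF P] open_B]) auto
  have "strong_psh ?N (\<lambda>z. M * (norm (z - a))\<^sup>2 + - ln (cmod (P z - w)))"
    by (intro strong_psh_add strong_psh_cmult strong_psh_norm_sq strong_psh_minus_ln_cmod
        holo_fun_on_subset[OF P] N M) auto
  from hull_maximum_principle[OF N _ _ this q] show ?thesis
    using w hull_subset by auto
qed

lemma hull_dist_image:
  assumes P: "holo_fun_on P B" and w: "w \<notin> P ` hull_in B K" and q: "q \<in> hull_in B K"
  shows "\<exists>x\<in>K. cmod (P x - w) \<le> cmod (P q - w)"
proof -
  obtain x where x: "x \<in> K" "ln (cmod (P x - w)) \<le> ln (cmod (P q - w))"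
    using hull_log_dist_image[OF P w q, of 0] by auto
  moreover have "P x \<noteq> w" "P q \<noteq> w" using w q x(1) hull_superset by auto
  ultimately show ?thesis by auto
qed

lemma hull_positive_side:
  assumes P: "holo_fun_on P B"
    and axis: "\<And>x. x \<in> hull_in B K \<Longrightarrow> Re (P x) = 0 \<Longrightarrow> x \<in> K"
    and \<kappa>: "0 < \<kappa>" and \<rho>: "uniformly_psh \<kappa> B \<rho>" "\<And>z. 0 \<le> \<rho> z"
    and \<rho>_K: "\<And>x. x \<in> K \<Longrightarrow> 0 \<le> Re (P x) \<Longrightarrow> \<rho> x = 0"
    and q: "q \<in> hull_in B K" "0 < Re (P q)"
  shows "q \<in> K"
proof (rule ccontr)
  assume "q \<notin> K"
  define v where "v z = \<rho> z - \<kappa> * (norm (z - q))\<^sup>2" for z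
  have v: "strong_psh B v" using \<rho>(1) unfolding uniformly_psh_def v_def by blast
  obtain \<eta> where \<eta>: "0 < \<eta>" "\<And>x. x \<in> K \<Longrightarrow> \<eta> \<le> \<kappa> * (norm (x - q))\<^sup>2"
  proof (rule compact_pos_lower_bound[OF compact_K])
    show "continuous_on K (\<lambda>x. \<kappa> * (norm (x - q))\<^sup>2)" by (intro continuous_intros)
    show "0 < \<kappa> * (norm (x - q))\<^sup>2" if "x \<in> K" for x
      using \<kappa> \<open>q \<notin> K\<close> that by (cases "x = q") auto
  qed (rule that)
  define s where "s = - \<eta> / 2"
  have s: "s < 0" using \<eta>(1) by (simp add: s_def)
  have v_K: "v x < s" if "x \<in> K" "0 \<le> Re (P x)" for x
    using \<rho>_K[OF that] \<eta>(2)[OF that(1)] \<eta>(1) by (simp add: v_def s_def)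
  have Re_P: "continuous_on B (\<lambda>z. Re (P z))"
    by (intro continuous_intros continuous_on_holo_fun[OF P])
  let ?D = "{z \<in> B. Re (P z) \<noteq> 0 \<or> v z < s}" and ?u = "\<lambda>z. if 0 < Re (P z) then max (v z) s else s"
  have "hull_in B K \<subseteq> ?D"
    using axis v_K hull_subset by force
  then obtain x where x: "x \<in> K" "?u q \<le> ?u x"
    using hull_maximum_principle[OF strong_psh_extend_by_const(1)[OF open_B v Re_P] _ _
        strong_psh_extend_by_const(2)[OF open_B v Re_P] q(1)] by blast
  have "?u x = s" using v_K[OF x(1)] by auto
  moreover have "0 \<le> ?u q" using q(2) \<rho>(2)[of q] by (simp add: v_def)
  ultimately show False using x(2) s by linarith
qed

end

lemma compact_hull_in_ball:
  fixes K :: "(complex^'n::finite) set"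
  assumes K: "compact K" "K \<noteq> {}" "K \<subseteq> ball a R"
  shows "compact (hull_in (ball a R) K)"
proof -
  have "continuous_on K (\<lambda>x. norm (x - a))" by (intro continuous_intros)
  then obtain m where m: "m \<in> K" "\<And>x. x \<in> K \<Longrightarrow> norm (x - a) \<le> norm (m - a)"
    using continuous_attains_sup[OF K(1,2)] by blast
  define \<delta> where "\<delta> = norm (m - a)"
  have "\<delta> < R" using m(1) K(3) by (auto simp: \<delta>_def dist_norm norm_minus_commute)
  have bounded_hull: "hull_in (ball a R) K \<subseteq> cball a \<delta>"
  proof
    fix q assume "q \<in> hull_in (ball a R) K"
    then obtain x where "x \<in> K" "(norm (q - a))\<^sup>2 \<le> (norm (x - a))\<^sup>2"
      using strong_psh_norm_sq[of "ball a R" a] unfolding hull_in_def by blast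
    then show "q \<in> cball a \<delta>" using m(2)[of x] by (simp add: \<delta>_def dist_norm norm_minus_commute)
  qed
  have "closed (hull_in (ball a R) K)"
  proof (subst closed_sequential_limits, intro allI impI)
    fix f q assume f: "(\<forall>n. f n \<in> hull_in (ball a R) K) \<and> f \<longlonglongrightarrow> q"
    then have "q \<in> cball a \<delta>"
      using closed_sequentially[OF closed_cball, of f a \<delta> q] bounded_hull by blast
    then have q: "q \<in> ball a R" using \<open>\<delta> < R\<close> by simp
    show "q \<in> hull_in (ball a R) K" unfolding hull_in_def
    proof (intro CollectI conjI q allI impI)
      fix u assume u: "strong_psh (ball a R) u"
      obtain k where k: "k \<in> K" "\<And>x. x \<in> K \<Longrightarrow> u x \<le> u k"
        using continuous_attains_sup[OF K(1,2)
            continuous_on_subset[OF strong_psh_continuous[OF u] K(3)]] by blast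
      have "isCont u q" using strong_psh_continuous[OF u] q by (simp add: continuous_on_eq_continuous_at)
      then have "(\<lambda>n. u (f n)) \<longlonglongrightarrow> u q" using f isCont_tendsto_compose by blast
      moreover have "u (f n) \<le> u k" for n
        using f u k(2) unfolding hull_in_def by (blast intro: order_trans)
      ultimately have "u q \<le> u k" by (intro LIMSEQ_le_const2) auto
      then show "\<exists>x\<in>K. u q \<le> u x" using k(1) by blast
    qed
  qed
  then show ?thesis using bounded_hull compact_cball by (metis closed_Int_compact inf.absorb1)
qed

section \<open>Kallin's lemma for opposite sectors\<close>

lemma sector_distance:
  assumes c: "0 < c" "c \<le> 1" and w: "c * cmod w \<le> \<bar>Re w\<bar>" and b: "Re b = 0"
  shows "c / 2 * cmod b \<le> cmod (w - b)"
proof (cases "cmod b / 2 \<le> cmod w")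
  case True
  then have "c / 2 * cmod b \<le> c * cmod w" using c(1) by (simp add: field_simps)
  also have "\<dots> \<le> \<bar>Re (w - b)\<bar>" using w b by simp
  also have "\<dots> \<le> cmod (w - b)" by (rule abs_Re_le_cmod)
  finally show ?thesis .
next
  case False
  then have "cmod b / 2 \<le> cmod (w - b)"
    using norm_triangle_ineq2[of b w] by (simp add: norm_minus_commute)
  moreover have "c / 2 * cmod b \<le> cmod b / 2" using c by (simp add: mult_left_le_one_le)
  ultimately show ?thesis by linarith
qed

locale sector_hull = compact_hull B K for B K :: "(complex^'n::finite) set" +
  fixes P :: "complex^'n \<Rightarrow> complex" and c :: real
  assumes holo_P: "holo_fun_on P B" and c_pos: "0 < c" and c_le_1: "c \<le> 1"
    and sector_K: "\<And>x. x \<in> K \<Longrightarrow> c * cmod (P x) \<le> \<bar>Re (P x)\<bar>"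
begin

text \<open>
  The point of \<open>P ` hull_in B K\<close> farthest out on a ray of the imaginary axis is closer to the points
  of the ray just beyond it than the two sectors are.
\<close>

lemma hull_avoids_imaginary_axis:
  assumes q: "q \<in> hull_in B K" "Re (P q) = 0"
  shows "P q = 0"
proof (rule ccontr)
  assume "P q \<noteq> 0"
  have "compact (P ` hull_in B K)"
    by (intro compact_continuous_image compact_hull_in
        continuous_on_subset[OF continuous_on_holo_fun[OF holo_P] hull_subset])
  then obtain s where s: "1 \<le> s" "s *\<^sub>R P q \<in> P ` hull_in B K" "\<And>s'. s < s' \<Longrightarrow> s' *\<^sub>R P q \<notin> P ` hull_in B K"
    using compact_ray_endpoint[of "P ` hull_in B K" "P q"] q(1) \<open>P q \<noteq> 0\<close> by blast
  obtain q0 where q0: "q0 \<in> hull_in B K" "P q0 = s *\<^sub>R P q" using s(2) by auto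
  define b where "b = (s * (1 + c/4)) *\<^sub>R P q"
  have "s < s * (1 + c/4)" using s(1) c_pos by (simp add: distrib_left)
  then have "b \<notin> P ` hull_in B K" unfolding b_def by (rule s(3))
  from hull_dist_image[OF holo_P this q0(1)]
  obtain x where x: "x \<in> K" "cmod (P x - b) \<le> cmod (P q0 - b)" by blast
  have "P q0 - b = - (s * (c/4)) *\<^sub>R P q"
    unfolding q0(2) b_def by (simp add: algebra_simps)
  then have "cmod (P q0 - b) = s * (c/4) * cmod (P q)"
    using s(1) c_pos by simp
  also have "\<dots> < c / 2 * cmod b"
    using s(1) c_pos \<open>P q \<noteq> 0\<close> by (simp add: b_def field_simps add_pos_pos)
  also have "\<dots> \<le> cmod (P x - b)"
    by (rule sector_distance[OF c_pos c_le_1 sector_K[OF x(1)]]) (use q(2) in \<open>simp add: b_def\<close>)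
  finally show False using x(2) by simp
qed

lemma hull_log_dist_imaginary_point:
  assumes q: "q \<in> hull_in B K" "P q = 0" and t: "0 < t" and M: "0 \<le> M"
  obtains x where "x \<in> K"
    "M * (norm (q - a))\<^sup>2 - ln t \<le> M * (norm (x - a))\<^sup>2 - ln (cmod (P x - Complex 0 t))"
    "ln t - ln (2/c) \<le> ln (cmod (P x - Complex 0 t))"
proof -
  have cmod_t: "cmod (Complex 0 t) = t" using t by (simp add: cmod_def)
  have "Complex 0 t \<notin> P ` hull_in B K"
    using hull_avoids_imaginary_axis t by (force simp: complex_eq_iff)
  from hull_log_dist_image[OF holo_P this q(1) M, of a] obtain x where x: "x \<in> K"
      "M * (norm (q - a))\<^sup>2 - ln t \<le> M * (norm (x - a))\<^sup>2 - ln (cmod (P x - Complex 0 t))"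
    using cmod_t q(2) by auto
  have "c / 2 * t \<le> cmod (P x - Complex 0 t)"
    using sector_distance[OF c_pos c_le_1 sector_K[OF x(1)], of "Complex 0 t"] cmod_t by simp
  then have "ln (c / 2 * t) \<le> ln (cmod (P x - Complex 0 t))" using c_pos t by (intro ln_mono) auto
  moreover have "ln (c / 2 * t) = ln t - ln (2/c)" using c_pos t by (simp add: ln_mult ln_div)
  ultimately show thesis using that[OF x] by simp
qed

text \<open>
  If \<open>q \<noteq> a\<close>, the weight \<open>M\<close> is chosen so large that \<open>M \<bar>q - a\<bar>\<^sup>2\<close> outweighs the loss \<open>ln (2/c)\<close> of the
  sector estimate, and then \<open>t\<close> so small that only points of \<open>K\<close> close to \<open>a\<close> could compete.
\<close>

lemma hull_zero_fibre:
  assumes K_zero: "\<And>x. x \<in> K \<Longrightarrow> P x = 0 \<Longrightarrow> x = a" and q: "q \<in> hull_in B K" "P q = 0"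
  shows "q = a"
proof (rule ccontr)
  assume "q \<noteq> a"
  define \<Lambda> where "\<Lambda> = ln (2/c)"
  define M where "M = 2 * (\<Lambda> + 1) / (norm (q - a))\<^sup>2"
  have \<Lambda>: "0 \<le> \<Lambda>" using c_pos c_le_1 by (simp add: \<Lambda>_def)
  have M: "0 < M" "M * (norm (q - a))\<^sup>2 = 2 * (\<Lambda> + 1)" using \<Lambda> \<open>q \<noteq> a\<close> by (auto simp: M_def)
  let ?far = "K \<inter> {x. 1 \<le> M * (norm (x - a))\<^sup>2}"
  have far: "compact ?far"
    by (intro compact_Int_closed compact_K closed_Collect_le continuous_intros)
  have P_cont: "continuous_on ?far (\<lambda>x. cmod (P x))"
    using K_subset by (intro continuous_on_norm
        continuous_on_subset[OF continuous_on_holo_fun[OF holo_P]]) auto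
  have "0 < cmod (P x)" if "x \<in> ?far" for x
    using that K_zero[of x] by auto
  from compact_pos_lower_bound[OF far P_cont this] obtain \<eta> where
    \<eta>: "0 < \<eta>" "\<And>x. x \<in> ?far \<Longrightarrow> \<eta> \<le> cmod (P x)" by blast
  have "continuous_on K (\<lambda>x. M * (norm (x - a))\<^sup>2)" by (intro continuous_intros)
  from compact_dominating_multiple[OF compact_K this continuous_on_const[of _ 1]]
  obtain b where b: "0 \<le> b" "\<And>x. x \<in> K \<Longrightarrow> M * (norm (x - a))\<^sup>2 < b" by auto
  define t where "t = \<eta> / 2 * exp (- b)"
  have t: "0 < t" "t \<le> \<eta> / 2" using \<eta>(1) b(1) by (auto simp: t_def)
  have ln_t: "ln t = ln (\<eta> / 2) - b" unfolding t_def using \<eta>(1) by (subst ln_mult_pos) auto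
  obtain x where x: "x \<in> K" "2 * (\<Lambda> + 1) - ln t \<le> M * (norm (x - a))\<^sup>2 - ln (cmod (P x - Complex 0 t))"
      "ln t - \<Lambda> \<le> ln (cmod (P x - Complex 0 t))"
    using hull_log_dist_imaginary_point[OF q t(1) less_imp_le[OF M(1)], of a] unfolding M(2) \<Lambda>_def by blast
  show False
  proof (cases "x \<in> ?far")
    case True
    then have "\<eta> / 2 \<le> cmod (P x - Complex 0 t)"
      using \<eta>(2)[OF True] t norm_triangle_ineq2[of "P x" "Complex 0 t"] by (simp add: cmod_def)
    then have "ln (\<eta> / 2) \<le> ln (cmod (P x - Complex 0 t))" using \<eta>(1) by (intro ln_mono) auto
    then show False using x(2) ln_t b(2)[OF x(1)] \<Lambda> by argo
  next
    case False
    then show False using x \<Lambda> by auto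
  qed
qed

end

definition sector :: "real \<Rightarrow> complex set" where
  "sector c = {w. 0 < Re w \<and> c * cmod w \<le> Re w}"

lemma sector_antimono: "c \<le> c' \<Longrightarrow> sector c' \<subseteq> sector c"
  by (auto simp: sector_def intro: order_trans[OF mult_right_mono])

definition sector_barrier ::
    "complex^'n::finite \<Rightarrow> real \<Rightarrow> real \<Rightarrow> (complex^'n \<Rightarrow> complex) \<Rightarrow> (complex^'n \<Rightarrow> real) \<Rightarrow> bool" where
  "sector_barrier a r c P \<rho> \<longleftrightarrow> (\<exists>\<kappa>>0. uniformly_psh \<kappa> (ball a r) \<rho>) \<and> (\<forall>z. 0 \<le> \<rho> z) \<and> \<rho> a = 0 \<and>
     (\<forall>z\<in>ball a r - {a}. \<rho> z = 0 \<longrightarrow> P z \<in> sector c)"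

lemma sector_barrier_mono:
  assumes "sector_barrier a r c P \<rho>" and "r' \<le> r" and "c' \<le> c"
  shows "sector_barrier a r' c' P \<rho>"
  using assms uniformly_psh_subset[OF _ subset_ball[OF assms(2)], of _ a \<rho>] sector_antimono[OF assms(3)]
    subset_ball[OF assms(2), of a]
  unfolding sector_barrier_def by (meson DiffD1 DiffD2 DiffI subsetD)

lemma hull_in_two_sectors:
  assumes K: "compact K" "a \<in> K" "K \<subseteq> ball a r" and P: "holo_fun_on P (ball a r)" "P a = 0"
    and c: "0 < c" "c \<le> 1"
    and \<rho>1: "sector_barrier a r c P \<rho>1" and \<rho>2: "sector_barrier a r c (\<lambda>z. - P z) \<rho>2"
    and cover: "\<And>x. x \<in> K \<Longrightarrow> \<rho>1 x = 0 \<or> \<rho>2 x = 0"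
  shows "hull_in (ball a r) K \<subseteq> K"
proof
  have sectors: "P x \<in> sector c \<and> \<rho>1 x = 0 \<or> - P x \<in> sector c \<and> \<rho>2 x = 0" if "x \<in> K" "x \<noteq> a" for x
    using that cover[OF that(1)] K(3) \<rho>1 \<rho>2 unfolding sector_barrier_def by blast
  have K_zero: "x = a" if "x \<in> K" "P x = 0" for x
    using sectors[OF that(1)] that(2) by (auto simp: sector_def)
  interpret sector_hull "ball a r" K P c
  proof
    show "c * cmod (P x) \<le> \<bar>Re (P x)\<bar>" if "x \<in> K" for x
      using sectors[OF that] P(2) by (cases "x = a") (auto simp: sector_def)
  qed (use K P c compact_hull_in_ball[OF K(1) _ K(3)] in auto)
  have axis: "x = a" if "x \<in> hull_in (ball a r) K" "Re (P x) = 0" for x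
    using hull_zero_fibre[OF K_zero that(1)] hull_avoids_imaginary_axis[OF that] by blast
  fix q assume q: "q \<in> hull_in (ball a r) K"
  consider (right) "0 < Re (P q)" | (left) "Re (P q) < 0" | (apex) "q = a" using axis[OF q] by fastforce
  then show "q \<in> K"
  proof cases
    case right
    obtain \<kappa> where \<kappa>: "0 < \<kappa>" "uniformly_psh \<kappa> (ball a r) \<rho>1" using \<rho>1 unfolding sector_barrier_def by blast
    show ?thesis
    proof (rule hull_positive_side[OF P(1) _ \<kappa> _ _ q right])
      show "\<rho>1 x = 0" if "x \<in> K" "0 \<le> Re (P x)" for x
        using sectors[OF that(1)] that(2) \<rho>1 by (cases "x = a") (auto simp: sector_def sector_barrier_def)
    qed (use axis K(2) \<rho>1 in \<open>auto simp: sector_barrier_def\<close>)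
  next
    case left
    obtain \<kappa> where \<kappa>: "0 < \<kappa>" "uniformly_psh \<kappa> (ball a r) \<rho>2" using \<rho>2 unfolding sector_barrier_def by blast
    show ?thesis
    proof (rule hull_positive_side[of "\<lambda>z. - 1 * P z", OF holo_fun_on_cmult[OF P(1)] _ \<kappa> _ _ q])
      show "\<rho>2 x = 0" if "x \<in> K" "0 \<le> Re (- 1 * P x)" for x
        using sectors[OF that(1)] that(2) \<rho>2 by (cases "x = a") (auto simp: sector_def sector_barrier_def)
    qed (use axis K(2) \<rho>2 left in \<open>auto simp: sector_barrier_def\<close>)
  qed (use K in simp)
qed

section \<open>Coordinates on complex manifolds\<close>

locale complex_manifold =
  fixes A :: "('m::{t2_space, second_countable_topology}, 'n::finite) chart set"
  assumes atlas: "complex_atlas A"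
begin

definition transition :: "('m, 'n) chart \<Rightarrow> ('m, 'n) chart \<Rightarrow> complex^'n \<Rightarrow> complex^'n" where
  "transition \<phi> \<psi> = snd \<psi> \<circ> chart_inv \<phi>"

definition transition_derivative :: "('m, 'n) chart \<Rightarrow> ('m, 'n) chart \<Rightarrow> 'm \<Rightarrow> complex^'n \<Rightarrow> complex^'n" where
  "transition_derivative \<phi> \<psi> p = frechet_derivative (transition \<phi> \<psi>) (at (snd \<phi> p))"

lemma chart_covers: obtains \<phi> where "\<phi> \<in> A" "p \<in> fst \<phi>"
  using atlas unfolding complex_atlas_def by blast

context
  fixes \<phi> assumes \<phi>: "\<phi> \<in> A"
begin

lemma chart_homeo: "homeomorphism (fst \<phi>) (snd \<phi> ` fst \<phi>) (snd \<phi>) (chart_inv \<phi>)"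
  and open_chart_dom: "open (fst \<phi>)" and open_chart_range: "open (snd \<phi> ` fst \<phi>)"
  using atlas \<phi> unfolding complex_atlas_def by auto

lemma chart_inv_chart: "x \<in> fst \<phi> \<Longrightarrow> chart_inv \<phi> (snd \<phi> x) = x"
  using chart_homeo by (simp add: homeomorphism_def)

lemma chart_chart_inv: "z \<in> snd \<phi> ` fst \<phi> \<Longrightarrow> snd \<phi> (chart_inv \<phi> z) = z"
  using chart_homeo by (auto simp: homeomorphism_def)

lemma chart_inv_in: "z \<in> snd \<phi> ` fst \<phi> \<Longrightarrow> chart_inv \<phi> z \<in> fst \<phi>"
  using chart_homeo by (auto simp: homeomorphism_def)

lemma continuous_on_chart: "continuous_on (fst \<phi>) (snd \<phi>)"
  and continuous_on_chart_inv: "continuous_on (snd \<phi> ` fst \<phi>) (chart_inv \<phi>)"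
  using chart_homeo by (auto simp: homeomorphism_def)

lemma chart_image_eq: "snd \<phi> ` (fst \<phi> \<inter> O') = snd \<phi> ` fst \<phi> \<inter> chart_inv \<phi> -` O'"
  using chart_inv_chart by (auto simp: chart_inv_in chart_chart_inv intro!: rev_image_eqI)

lemma open_chart_image: "open O' \<Longrightarrow> open (snd \<phi> ` (fst \<phi> \<inter> O'))"
  unfolding chart_image_eq by (rule continuous_open_preimage[OF continuous_on_chart_inv open_chart_range])

lemma chart_inv_image_eq:
  assumes "Z \<subseteq> snd \<phi> ` fst \<phi>"
  shows "chart_inv \<phi> ` Z = fst \<phi> \<inter> snd \<phi> -` Z"
proof (intro equalityI subsetI)
  fix x assume "x \<in> chart_inv \<phi> ` Z"
  then obtain z where "z \<in> Z" "x = chart_inv \<phi> z" by blast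
  then show "x \<in> fst \<phi> \<inter> snd \<phi> -` Z" using assms chart_inv_in chart_chart_inv by auto
next
  fix x assume "x \<in> fst \<phi> \<inter> snd \<phi> -` Z"
  then show "x \<in> chart_inv \<phi> ` Z" using chart_inv_chart[of x] by (metis IntD1 IntD2 image_eqI vimageD)
qed

lemma open_chart_inv_image:
  assumes "open Z" "Z \<subseteq> snd \<phi> ` fst \<phi>"
  shows "open (chart_inv \<phi> ` Z)"
  unfolding chart_inv_image_eq[OF assms(2)]
  by (rule continuous_open_preimage[OF continuous_on_chart open_chart_dom assms(1)])

lemma compact_chart_inv_image: "compact Z \<Longrightarrow> Z \<subseteq> snd \<phi> ` fst \<phi> \<Longrightarrow> compact (chart_inv \<phi> ` Z)"
  by (intro compact_continuous_image continuous_on_subset[OF continuous_on_chart_inv])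

lemma transition_holo: "\<psi> \<in> A \<Longrightarrow> holo_map_on (transition \<phi> \<psi>) (snd \<phi> ` (fst \<phi> \<inter> fst \<psi>))"
  using atlas \<phi> unfolding complex_atlas_def transition_def by blast

lemma transition_Ck: "\<psi> \<in> A \<Longrightarrow> Ck_on k (transition \<phi> \<psi>) (snd \<phi> ` (fst \<phi> \<inter> fst \<psi>))"
  using Ck_on_holo_map[OF transition_holo open_chart_image] atlas unfolding complex_atlas_def by blast

end

lemma transition_chart: "\<phi> \<in> A \<Longrightarrow> x \<in> fst \<phi> \<Longrightarrow> transition \<phi> \<psi> (snd \<phi> x) = snd \<psi> x"
  by (simp add: transition_def chart_inv_chart)

lemma has_derivative_transition:
  assumes "\<phi> \<in> A" "\<psi> \<in> A" "p \<in> fst \<phi>" "p \<in> fst \<psi>"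
  shows "(transition \<phi> \<psi> has_derivative transition_derivative \<phi> \<psi> p) (at (snd \<phi> p))"
  unfolding transition_derivative_def
  by (rule holo_map_on_frechet(1)[OF transition_holo[OF assms(1,2)]]) (use assms in auto)

lemma transition_derivative_scale:
  assumes "\<phi> \<in> A" "\<psi> \<in> A" "p \<in> fst \<phi>" "p \<in> fst \<psi>"
  shows "transition_derivative \<phi> \<psi> p (c *s v) = c *s transition_derivative \<phi> \<psi> p v"
  unfolding transition_derivative_def
  by (rule holo_map_on_frechet(2)[OF transition_holo[OF assms(1,2)]]) (use assms in auto)

lemma transition_derivative_linear:
  assumes "\<phi> \<in> A" "\<psi> \<in> A" "p \<in> fst \<phi>" "p \<in> fst \<psi>"
  shows "linear (transition_derivative \<phi> \<psi> p)"
  using has_derivative_linear[OF has_derivative_transition[OF assms]] .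

lemma transition_derivative_cocycle:
  assumes "\<phi> \<in> A" "\<psi> \<in> A" "\<xi> \<in> A" "p \<in> fst \<phi>" "p \<in> fst \<psi>" "p \<in> fst \<xi>"
  shows "transition_derivative \<psi> \<xi> p (transition_derivative \<phi> \<psi> p v) = transition_derivative \<phi> \<xi> p v"
proof -
  have "((\<lambda>z. transition \<psi> \<xi> (transition \<phi> \<psi> z)) has_derivative
      (\<lambda>v. transition_derivative \<psi> \<xi> p (transition_derivative \<phi> \<psi> p v))) (at (snd \<phi> p))"
    by (rule has_derivative_compose[OF has_derivative_transition[OF assms(1,2,4,5)]])
       (use has_derivative_transition[OF assms(2,3,5,6)] assms in \<open>simp add: transition_chart\<close>)
  then have "(transition \<phi> \<xi> has_derivative
      (\<lambda>v. transition_derivative \<psi> \<xi> p (transition_derivative \<phi> \<psi> p v))) (at (snd \<phi> p))"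
  proof (rule has_derivative_transform_within_open)
    show "open (snd \<phi> ` (fst \<phi> \<inter> fst \<psi>))" by (intro open_chart_image open_chart_dom assms)
    show "snd \<phi> p \<in> snd \<phi> ` (fst \<phi> \<inter> fst \<psi>)" using assms by auto
    show "transition \<psi> \<xi> (transition \<phi> \<psi> z) = transition \<phi> \<xi> z" if "z \<in> snd \<phi> ` (fst \<phi> \<inter> fst \<psi>)" for z
      using that assms by (auto simp: transition_chart)
  qed
  then have "transition_derivative \<phi> \<xi> p =
      (\<lambda>v. transition_derivative \<psi> \<xi> p (transition_derivative \<phi> \<psi> p v))"
    unfolding transition_derivative_def[of \<phi> \<xi>] using frechet_derivative_at by metis
  then show ?thesis by simp
qed

lemma transition_derivative_same:
  assumes "\<phi> \<in> A" "p \<in> fst \<phi>"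
  shows "transition_derivative \<phi> \<phi> p v = v"
proof -
  have "(transition \<phi> \<phi> has_derivative (\<lambda>v. v)) (at (snd \<phi> p))"
  proof (rule has_derivative_transform_within_open[OF has_derivative_ident open_chart_range[OF assms(1)]])
    show "z = transition \<phi> \<phi> z" if "z \<in> snd \<phi> ` fst \<phi>" for z
      using that assms by (auto simp: transition_chart)
  qed (use assms in auto)
  then have "transition_derivative \<phi> \<phi> p = (\<lambda>v. v)"
    unfolding transition_derivative_def using frechet_derivative_at by metis
  then show ?thesis by simp
qed

lemma transition_derivative_eq_0_iff:
  assumes "\<phi> \<in> A" "\<psi> \<in> A" "p \<in> fst \<phi>" "p \<in> fst \<psi>"
  shows "transition_derivative \<phi> \<psi> p v = 0 \<longleftrightarrow> v = 0"
  using transition_derivative_cocycle[OF assms(1,2,1,3,4,3), of v] transition_derivative_same[OF assms(1,3)]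
    linear_0[OF transition_derivative_linear[OF assms]]
    linear_0[OF transition_derivative_linear[OF assms(2,1,4,3)]] by metis

lemma coord_vec_eq:
  "coord_vec A \<phi> p a = (\<lambda>\<psi>. if \<psi> \<in> A \<and> p \<in> fst \<psi> then transition_derivative \<phi> \<psi> p a else 0)"
  by (auto simp: fun_eq_iff coord_vec_def transition_derivative_def transition_def)

lemma coord_vec_self: "\<phi> \<in> A \<Longrightarrow> p \<in> fst \<phi> \<Longrightarrow> coord_vec A \<phi> p a \<phi> = a"
  by (simp add: coord_vec_eq transition_derivative_same)

lemma coord_vec_tangent:
  assumes "\<phi> \<in> A" "p \<in> fst \<phi>"
  shows "coord_vec A \<phi> p a \<in> tangent_space A p"
  unfolding tangent_space_def coord_vec_eq
  using assms transition_derivative_cocycle[OF assms(1) _ _ assms(2)]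
  by (auto simp flip: transition_def transition_derivative_def)

lemma coord_vec_change:
  assumes "\<phi> \<in> A" "p \<in> fst \<phi>" "\<psi> \<in> A" "p \<in> fst \<psi>"
  shows "coord_vec A \<psi> p (transition_derivative \<phi> \<psi> p a) = coord_vec A \<phi> p a"
  unfolding coord_vec_eq using assms transition_derivative_cocycle[OF assms(1,3) _ assms(2,4)] by auto

lemma coord_vec_add:
  assumes "\<phi> \<in> A" "p \<in> fst \<phi>"
  shows "coord_vec A \<phi> p (a + b) = tv_add (coord_vec A \<phi> p a) (coord_vec A \<phi> p b)"
  unfolding coord_vec_eq tv_add_def
  using linear_add[OF transition_derivative_linear[OF assms(1) _ assms(2)]] by auto

lemma coord_vec_scaleR:
  assumes "\<phi> \<in> A" "p \<in> fst \<phi>"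
  shows "coord_vec A \<phi> p (r *\<^sub>R a) = tv_scale r (coord_vec A \<phi> p a)"
  unfolding coord_vec_eq tv_scale_def
  using linear_cmul[OF transition_derivative_linear[OF assms(1) _ assms(2)]] by auto

lemma coord_vec_J:
  assumes "\<phi> \<in> A" "p \<in> fst \<phi>"
  shows "coord_vec A \<phi> p (\<i> *s a) = Jop (coord_vec A \<phi> p a)"
  unfolding coord_vec_eq Jop_def using transition_derivative_scale[OF assms(1) _ assms(2)] by auto

lemma coord_vec_eq_zero_iff:
  assumes "\<phi> \<in> A" "p \<in> fst \<phi>"
  shows "coord_vec A \<phi> p a = tv_zero \<longleftrightarrow> a = 0"
proof
  assume "coord_vec A \<phi> p a = tv_zero"
  then show "a = 0" using coord_vec_self[OF assms, of a] by (simp add: tv_zero_def)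
next
  assume "a = 0"
  then show "coord_vec A \<phi> p a = tv_zero"
    unfolding coord_vec_eq tv_zero_def
    using linear_0[OF transition_derivative_linear[OF assms(1) _ assms(2)]] by auto
qed

lemma velocity_eq_coord_vec:
  assumes \<phi>: "\<phi> \<in> A" "\<gamma> t \<in> fst \<phi>" and I: "open I" "t \<in> I" "continuous_on I \<gamma>"
    and d: "((snd \<phi> \<circ> \<gamma>) has_vector_derivative w) (at t)"
  shows "velocity A \<gamma> t = coord_vec A \<phi> (\<gamma> t) w"
proof
  fix \<psi>
  show "velocity A \<gamma> t \<psi> = coord_vec A \<phi> (\<gamma> t) w \<psi>"
  proof (cases "\<psi> \<in> A \<and> \<gamma> t \<in> fst \<psi>")
    case True
    then have \<psi>: "\<psi> \<in> A" "\<gamma> t \<in> fst \<psi>" by auto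
    let ?I = "I \<inter> \<gamma> -` (fst \<phi>)"
    have open_I: "open ?I" by (rule continuous_open_preimage[OF I(3,1) open_chart_dom[OF \<phi>(1)]])
    have "((\<lambda>s. transition \<phi> \<psi> ((snd \<phi> \<circ> \<gamma>) s)) has_derivative
        (\<lambda>r. transition_derivative \<phi> \<psi> (\<gamma> t) (r *\<^sub>R w))) (at t)"
      by (rule has_derivative_compose[OF d[unfolded has_vector_derivative_def]])
         (use has_derivative_transition[OF \<phi>(1) \<psi>(1) \<phi>(2) \<psi>(2)] in simp)
    then have "((\<lambda>s. transition \<phi> \<psi> ((snd \<phi> \<circ> \<gamma>) s))
        has_vector_derivative transition_derivative \<phi> \<psi> (\<gamma> t) w) (at t)"
      unfolding has_vector_derivative_def
      using linear_cmul[OF transition_derivative_linear[OF \<phi>(1) \<psi>(1) \<phi>(2) \<psi>(2)]] by simp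
    then have "((snd \<psi> \<circ> \<gamma>) has_vector_derivative transition_derivative \<phi> \<psi> (\<gamma> t) w) (at t)"
      by (rule has_vector_derivative_transform_within_open[OF _ open_I])
         (use I \<phi> in \<open>auto simp: transition_chart\<close>)
    then show ?thesis using \<psi> by (simp add: velocity_def coord_vec_eq vector_derivative_at)
  next
    case False
    then show ?thesis by (auto simp: velocity_def coord_vec_eq)
  qed
qed

lemma smooth_curve_on_chart:
  assumes "smooth_curve_on A I \<gamma>" and "\<phi> \<in> A"
  shows "open {t \<in> I. \<gamma> t \<in> fst \<phi>}" and "Ck_on k (snd \<phi> \<circ> \<gamma>) {t \<in> I. \<gamma> t \<in> fst \<phi>}"
proof -
  have "{t \<in> I. \<gamma> t \<in> fst \<phi>} = I \<inter> \<gamma> -` fst \<phi>" by auto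
  then show "open {t \<in> I. \<gamma> t \<in> fst \<phi>}"
    using assms(1) continuous_open_preimage[OF _ _ open_chart_dom[OF assms(2)]]
    unfolding smooth_curve_on_def by metis
  show "Ck_on k (snd \<phi> \<circ> \<gamma>) {t \<in> I. \<gamma> t \<in> fst \<phi>}"
    using assms unfolding smooth_curve_on_def smooth_on_def by blast
qed

lemma smooth_curve_velocity:
  assumes \<gamma>: "smooth_curve_on A I \<gamma>" and t: "t \<in> I" and \<phi>: "\<phi> \<in> A" "\<gamma> t \<in> fst \<phi>"
  shows "((snd \<phi> \<circ> \<gamma>) has_vector_derivative vector_derivative (snd \<phi> \<circ> \<gamma>) (at t)) (at t)"
    and "velocity A \<gamma> t = coord_vec A \<phi> (\<gamma> t) (vector_derivative (snd \<phi> \<circ> \<gamma>) (at t))"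
proof -
  show has_velocity: "((snd \<phi> \<circ> \<gamma>) has_vector_derivative vector_derivative (snd \<phi> \<circ> \<gamma>) (at t)) (at t)"
    by (rule Ck_on_1_vector_derivative(1)[OF smooth_curve_on_chart(2)[OF \<gamma> \<phi>(1)]]) (use t \<phi> in simp)
  show "velocity A \<gamma> t = coord_vec A \<phi> (\<gamma> t) (vector_derivative (snd \<phi> \<circ> \<gamma>) (at t))"
    using velocity_eq_coord_vec[OF \<phi> _ t _ has_velocity] \<gamma> unfolding smooth_curve_on_def by blast
qed

lemma smooth_curve_on_chart_inv:
  assumes \<psi>: "\<psi> \<in> A" and I: "open I" and z: "\<And>k. Ck_on k z I" "z ` I \<subseteq> snd \<psi> ` fst \<psi>"
  shows "smooth_curve_on A I (\<lambda>t. chart_inv \<psi> (z t))"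
  unfolding smooth_curve_on_def smooth_on_def
proof (intro conjI ballI allI I)
  let ?\<gamma> = "\<lambda>t. chart_inv \<psi> (z t)"
  show \<gamma>_cont: "continuous_on I ?\<gamma>"
    using z(1)[of 0] by (intro continuous_on_compose2[OF continuous_on_chart_inv[OF \<psi>] _ z(2)]) simp
  fix \<xi> k assume \<xi>: "\<xi> \<in> A"
  let ?T = "{t \<in> I. ?\<gamma> t \<in> fst \<xi>}"
  have "?T = I \<inter> ?\<gamma> -` fst \<xi>" by auto
  then have "open ?T" using continuous_open_preimage[OF \<gamma>_cont I open_chart_dom[OF \<xi>]] by simp
  then have "Ck_on k (\<lambda>t. transition \<psi> \<xi> (z t)) ?T"
  proof (rule Ck_on_compose[OF _ open_chart_image[OF \<psi> open_chart_dom[OF \<xi>]] _ _ transition_Ck[OF \<psi> \<xi>]])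
    show "Ck_on k z ?T" by (rule Ck_on_subset[OF z(1)]) auto
    show "z ` ?T \<subseteq> snd \<psi> ` (fst \<psi> \<inter> fst \<xi>)"
      unfolding chart_image_eq[OF \<psi>] using z(2) by auto
  qed
  then show "Ck_on k (snd \<xi> \<circ> ?\<gamma>) ?T" by (simp add: transition_def o_def)
qed

definition tangent_coords :: "('m, 'n) chart \<Rightarrow> 'm set \<Rightarrow> 'm \<Rightarrow> (complex^'n) set" where
  "tangent_coords \<phi> L p = (\<lambda>u. u \<phi>) ` submanifold_tangent_space A L p"

lemma submanifold_tangent_spaceE:
  assumes "u \<in> submanifold_tangent_space A L p" and \<phi>: "\<phi> \<in> A" "p \<in> fst \<phi>"
  obtains \<gamma> I where "open I" "0 \<in> I" "continuous_on I \<gamma>" "\<gamma> ` I \<subseteq> L" "\<gamma> 0 = p"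
    "((snd \<phi> \<circ> \<gamma>) has_vector_derivative u \<phi>) (at 0)" "u = coord_vec A \<phi> p (u \<phi>)"
proof -
  obtain \<gamma> I where u: "u = velocity A \<gamma> 0" and I: "0 \<in> I"
    and \<gamma>: "smooth_curve_on A I \<gamma>" "\<gamma> ` I \<subseteq> L" "\<gamma> 0 = p"
    using assms(1) unfolding submanifold_tangent_space_def by blast
  note velocity = smooth_curve_velocity[OF \<gamma>(1) I \<phi>(1), unfolded \<gamma>(3), OF \<phi>(2)]
  have "u \<phi> = vector_derivative (snd \<phi> \<circ> \<gamma>) (at 0)"
    using velocity(2) coord_vec_self[OF \<phi>] by (simp add: u)
  then show thesis
    using that[of I \<gamma>] I \<gamma> velocity by (auto simp: u smooth_curve_on_def)
qed

lemma mem_tangent_coords_iff: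
  assumes \<phi>: "\<phi> \<in> A" "p \<in> fst \<phi>"
  shows "w \<in> tangent_coords \<phi> L p \<longleftrightarrow> coord_vec A \<phi> p w \<in> submanifold_tangent_space A L p"
proof
  assume "w \<in> tangent_coords \<phi> L p"
  then obtain u where u: "u \<in> submanifold_tangent_space A L p" "w = u \<phi>"
    unfolding tangent_coords_def by blast
  show "coord_vec A \<phi> p w \<in> submanifold_tangent_space A L p"
    using submanifold_tangent_spaceE[OF u(1) \<phi>] u by metis
next
  assume "coord_vec A \<phi> p w \<in> submanifold_tangent_space A L p"
  then show "w \<in> tangent_coords \<phi> L p"
    unfolding tangent_coords_def using coord_vec_self[OF \<phi>, of w] by (metis image_eqI)
qed

lemma coord_vec_in_submanifold_tangent_space:
  assumes \<psi>: "\<psi> \<in> A" "p \<in> fst \<psi>" and I: "open I" "0 \<in> I" and z: "\<And>k. Ck_on k z I" "z ` I \<subseteq> snd \<psi> ` fst \<psi>"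
    and L: "\<And>t. t \<in> I \<Longrightarrow> chart_inv \<psi> (z t) \<in> L" and z_0: "z 0 = snd \<psi> p" "(z has_vector_derivative v) (at 0)"
  shows "coord_vec A \<psi> p v \<in> submanifold_tangent_space A L p"
proof -
  let ?\<gamma> = "\<lambda>t. chart_inv \<psi> (z t)"
  have \<gamma>: "smooth_curve_on A I ?\<gamma>" by (rule smooth_curve_on_chart_inv[OF \<psi>(1) I(1) z])
  have \<gamma>_0: "?\<gamma> 0 = p" using z_0(1) chart_inv_chart[OF \<psi>] by simp
  have "((snd \<psi> \<circ> ?\<gamma>) has_vector_derivative v) (at 0)"
    by (rule has_vector_derivative_transform_within_open[OF z_0(2) I])
       (use z(2) chart_chart_inv[OF \<psi>(1)] in auto)
  then have "velocity A ?\<gamma> 0 = coord_vec A \<psi> p v"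
    using velocity_eq_coord_vec[OF \<psi>(1) _ I] \<gamma> \<gamma>_0 \<psi>(2) unfolding smooth_curve_on_def by metis
  moreover have "?\<gamma> ` I \<subseteq> L" using L by blast
  ultimately show ?thesis
    unfolding submanifold_tangent_space_def using \<gamma> \<gamma>_0 I(2)
    by (intro CollectI exI[of _ ?\<gamma>] conjI exI[of _ I]) simp_all
qed

lemma submanifold_tangent_in_kernel:
  assumes \<phi>: "\<phi> \<in> A" "p \<in> fst \<phi>" and N: "open N" "snd \<phi> p \<in> N" "N \<subseteq> snd \<phi> ` fst \<phi>"
    and G: "(G has_derivative G') (at (snd \<phi> p))" and zero: "\<And>z. z \<in> N \<Longrightarrow> chart_inv \<phi> z \<in> L \<Longrightarrow> G z = 0"
    and u: "u \<in> submanifold_tangent_space A L p"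
  shows "G' (u \<phi>) = 0"
proof -
  obtain \<gamma> I where I: "open I" "0 \<in> I" and \<gamma>: "continuous_on I \<gamma>" "\<gamma> ` I \<subseteq> L" "\<gamma> 0 = p"
    and velocity: "((snd \<phi> \<circ> \<gamma>) has_vector_derivative u \<phi>) (at 0)"
    using submanifold_tangent_spaceE[OF u \<phi>] by metis
  define J where "J = I \<inter> \<gamma> -` (chart_inv \<phi> ` N)"
  have J: "open J" "0 \<in> J"
    unfolding J_def chart_inv_image_eq[OF \<phi>(1) N(3)]
    using I \<gamma>(3) \<phi> N(2) continuous_open_preimage[OF \<gamma>(1) I(1) open_chart_inv_image[OF \<phi>(1) N(1,3)]]
    by (auto simp: chart_inv_image_eq[OF \<phi>(1) N(3)])
  have "((\<lambda>t. G ((snd \<phi> \<circ> \<gamma>) t)) has_derivative (\<lambda>r. G' (r *\<^sub>R u \<phi>))) (at 0)"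
    by (rule has_derivative_compose[OF velocity[unfolded has_vector_derivative_def]]) (use G \<gamma>(3) in simp)
  moreover have "G ((snd \<phi> \<circ> \<gamma>) t) = 0" if "t \<in> J" for t
    using that zero[of "snd \<phi> (\<gamma> t)"] \<gamma>(2) chart_inv_chart[OF \<phi>(1)]
    unfolding J_def chart_inv_image_eq[OF \<phi>(1) N(3)] by auto
  ultimately have "((\<lambda>t. 0) has_derivative (\<lambda>r. G' (r *\<^sub>R u \<phi>))) (at (0::real))"
    by (rule has_derivative_transform_within_open[OF _ J])
  from has_derivative_unique[OF this has_derivative_const] have "G' (1 *\<^sub>R u \<phi>) = 0" by metis
  then show ?thesis by simp
qed

end

section \<open>Defining maps of submanifolds\<close>

lemma subspace_kernel_projection:
  fixes E :: "'a::euclidean_space set"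
  assumes "subspace E"
  obtains \<pi> :: "'a \<Rightarrow> 'a" where "bounded_linear \<pi>" "\<And>x. \<pi> x = 0 \<longleftrightarrow> x \<in> E"
proof -
  obtain B where B: "B \<subseteq> E" "pairwise orthogonal B" "\<And>x. x \<in> B \<Longrightarrow> norm x = 1"
      "independent B" "span B = E"
    using orthonormal_basis_subspace[OF assms] by metis
  have finite_B: "finite B" using B(4) by (simp add: independent_imp_finite)
  define \<pi> where "\<pi> x = x - (\<Sum>b\<in>B. (x \<bullet> b) *\<^sub>R b)" for x :: 'a
  have "linear \<pi>" unfolding \<pi>_def
    by (rule linearI) (auto simp: algebra_simps inner_add_left sum.distrib scaleR_sum_right)
  then have "bounded_linear \<pi>" by (simp add: linear_conv_bounded_linear)
  moreover have "\<pi> x = 0 \<longleftrightarrow> x \<in> E" for x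
  proof
    assume "\<pi> x = 0"
    then have "x = (\<Sum>b\<in>B. (x \<bullet> b) *\<^sub>R b)" by (simp add: \<pi>_def)
    then show "x \<in> E" using B(1) assms by (metis (no_types, lifting) subspace_scale subspace_sum subsetD)
  next
    assume "x \<in> E"
    then have "(\<Sum>b\<in>B. (x \<bullet> b) *\<^sub>R b) = x"
      by (intro orthonormal_basis_expand) (use B finite_B in auto)
    then show "\<pi> x = 0" by (simp add: \<pi>_def)
  qed
  ultimately show thesis using that by blast
qed

lemma homeomorphism_image_mem_iff:
  assumes "homeomorphism V W F H" and "S \<subseteq> V" and "F ` S = W \<inter> E" and "x \<in> V"
  shows "x \<in> S \<longleftrightarrow> F x \<in> E"
proof
  assume "x \<in> S"
  then show "F x \<in> E" using assms(3) by blast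
next
  assume "F x \<in> E"
  then have "F x \<in> F ` S" using assms(1,3,4) by (auto simp: homeomorphism_def)
  then obtain y where y: "y \<in> S" "F x = F y" by blast
  have "H (F v) = v" if "v \<in> V" for v using assms(1) that by (simp add: homeomorphism_def)
  then have "x = y" using y assms(2,4) by (metis subsetD)
  then show "x \<in> S" using y(1) by simp
qed

lemma curve_in_straightened_set:
  fixes F :: "'a::euclidean_space \<Rightarrow> 'b::euclidean_space"
  assumes FH: "homeomorphism V W F H" and V: "open V" and W: "open W"
    and F: "\<And>k. Ck_on k F V" and H: "\<And>k. Ck_on k H W"
    and S: "S \<subseteq> V" "F ` S = W \<inter> E" and E: "subspace E"
    and x: "x \<in> S" and v: "frechet_derivative F (at x) v \<in> E"
  obtains I z where "open I" "(0::real) \<in> I" "\<And>k. Ck_on k z I" "z ` I \<subseteq> S" "z 0 = x"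
      "(z has_vector_derivative v) (at 0)"
proof -
  have H_F: "H (F y) = y" if "y \<in> V" for y using FH that by (simp add: homeomorphism_def)
  have x_V: "x \<in> V" using x S by blast
  define e where "e = frechet_derivative F (at x) v"
  define l where "l t = F x + t *\<^sub>R e" for t :: real
  define I where "I = l -` W"
  have F_x: "F x \<in> W" "F x \<in> E" using S(2) x by auto
  have "continuous_on UNIV l" unfolding l_def by (intro continuous_intros)
  then have I: "open I" unfolding I_def by (rule open_vimage[OF W])
  have "0 \<in> I" using F_x by (simp add: I_def l_def)
  have l: "Ck_on k l I" for k
    unfolding l_def
    by (intro Ck_on_add[OF I Ck_on_const] Ck_on_linear[OF bounded_linear_scaleR_left I])
  have z: "Ck_on k (\<lambda>t. H (l t)) I" for k
    by (rule Ck_on_compose[OF I W _ l H]) (auto simp: I_def)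
  have "H (l t) \<in> S" if t: "t \<in> I" for t
  proof -
    have "l t \<in> E" using F_x(2) v E by (simp add: l_def e_def subspace_add subspace_scale)
    then obtain y where "y \<in> S" "l t = F y" using S(2) t by (force simp: I_def)
    then show ?thesis using H_F S(1) by auto
  qed
  moreover have "((\<lambda>t. H (l t)) has_vector_derivative v) (at 0)"
  proof -
    have DF: "(F has_derivative frechet_derivative F (at x)) (at x)" by (rule Ck_on_SucD(1)[OF F x_V])
    have DH: "(H has_derivative frechet_derivative H (at (F x))) (at (F x))"
      by (rule Ck_on_SucD(1)[OF H F_x(1)])
    have "((\<lambda>y. y) has_derivative
        (\<lambda>w. frechet_derivative H (at (F x)) (frechet_derivative F (at x) w))) (at x)"
      by (rule has_derivative_transform_within_open[OF has_derivative_compose[OF DF DH] V x_V H_F])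
    then have inverse: "frechet_derivative H (at (F x)) e = v"
      unfolding e_def using has_derivative_unique[OF has_derivative_ident] by metis
    have l': "(l has_vector_derivative e) (at 0)"
      unfolding l_def by (auto intro!: derivative_eq_intros)
    have "((H \<circ> l) has_vector_derivative frechet_derivative H (at (F x)) e) (at 0)"
      by (rule vector_derivative_diff_chain_within[OF l'])
         (use DH in \<open>simp add: l_def has_derivative_at_withinI\<close>)
    then show ?thesis by (simp add: o_def inverse)
  qed
  ultimately show thesis
    using that[of I "\<lambda>t. H (l t)"] I \<open>0 \<in> I\<close> z H_F[OF x_V] by (auto simp: l_def)
qed

context complex_manifold
begin

lemma submanifold_slice_defining_map:
  assumes L: "embedded_submanifold A k L" "p \<in> L"
  obtains \<psi> V and G :: "complex^'n \<Rightarrow> complex^'n"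
  where "\<psi> \<in> A" "p \<in> fst \<psi>" "open V" "snd \<psi> p \<in> V" "V \<subseteq> snd \<psi> ` fst \<psi>" "\<And>k. Ck_on k G V"
    "\<And>z. z \<in> V \<Longrightarrow> chart_inv \<psi> z \<in> L \<longleftrightarrow> G z = 0"
    "\<And>v. frechet_derivative G (at (snd \<psi> p)) v = 0 \<Longrightarrow> coord_vec A \<psi> p v \<in> submanifold_tangent_space A L p"
proof -
  from bspec[OF L(1)[unfolded embedded_submanifold_def] L(2)]
  obtain \<psi> V W F H E where \<psi>: "\<psi> \<in> A" "p \<in> fst \<psi>"
    and V: "open V" "snd \<psi> p \<in> V" "V \<subseteq> snd \<psi> ` fst \<psi>" and W: "open W" and FH: "homeomorphism V W F H"
    and smooth: "smooth_on F V" "smooth_on H W" and E: "subspace (E :: (complex^'n) set)"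
    and slice: "F ` (V \<inter> snd \<psi> ` (fst \<psi> \<inter> L)) = W \<inter> E"
    by (elim bexE exE conjE) (rule that)
  have F: "Ck_on k F V" and H: "Ck_on k H W" for k using smooth by (auto simp: smooth_on_def)
  obtain \<pi> where \<pi>: "bounded_linear (\<pi> :: complex^'n \<Rightarrow> complex^'n)" "\<And>x. \<pi> x = 0 \<longleftrightarrow> x \<in> E"
    using subspace_kernel_projection[OF E] by blast
  let ?S = "V \<inter> snd \<psi> ` (fst \<psi> \<inter> L)"
  have S_iff: "z \<in> ?S \<longleftrightarrow> chart_inv \<psi> z \<in> L" if "z \<in> V" for z
    using that V(3) by (auto simp: chart_image_eq[OF \<psi>(1)])
  show thesis
  proof (rule that[OF \<psi> V])
    show "Ck_on k (\<lambda>z. \<pi> (F z)) V" for k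
      by (rule Ck_on_linear_compose[OF \<pi>(1) V(1) F])
    show "chart_inv \<psi> z \<in> L \<longleftrightarrow> \<pi> (F z) = 0" if "z \<in> V" for z
      unfolding \<pi>(2) S_iff[OF that, symmetric]
      by (rule homeomorphism_image_mem_iff[OF FH Int_lower1 slice that])
    fix v assume v: "frechet_derivative (\<lambda>z. \<pi> (F z)) (at (snd \<psi> p)) v = 0"
    have "((\<lambda>z. \<pi> (F z)) has_derivative (\<lambda>v. \<pi> (frechet_derivative F (at (snd \<psi> p)) v))) (at (snd \<psi> p))"
      by (rule bounded_linear.has_derivative[OF \<pi>(1) Ck_on_SucD(1)[OF F V(2)]])
    then have in_E: "frechet_derivative F (at (snd \<psi> p)) v \<in> E"
      using v \<pi>(2) frechet_derivative_at by metis
    have base: "snd \<psi> p \<in> ?S" using V(2) \<psi>(2) L(2) by blast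
    obtain I z where I: "open I" "(0::real) \<in> I" and z: "\<And>k. Ck_on k z I" "z ` I \<subseteq> ?S"
        "z 0 = snd \<psi> p" "(z has_vector_derivative v) (at 0)"
      by (rule curve_in_straightened_set[OF FH V(1) W F H Int_lower1 slice E base in_E]) (rule that)
    show "coord_vec A \<psi> p v \<in> submanifold_tangent_space A L p"
      by (rule coord_vec_in_submanifold_tangent_space[OF \<psi> I z(1) _ _ z(3,4)])
         (use z(2) V(3) S_iff in blast)+
  qed
qed

lemma submanifold_defining_map:
  assumes L: "embedded_submanifold A k L" "p \<in> L" and \<phi>: "\<phi> \<in> A" "p \<in> fst \<phi>"
  obtains N and G :: "complex^'n \<Rightarrow> complex^'n"
  where "open N" "snd \<phi> p \<in> N" "N \<subseteq> snd \<phi> ` fst \<phi>" "\<And>k. Ck_on k G N"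
    "\<And>z. z \<in> N \<Longrightarrow> chart_inv \<phi> z \<in> L \<longleftrightarrow> G z = 0"
    "tangent_coords \<phi> L p = {v. frechet_derivative G (at (snd \<phi> p)) v = 0}"
proof -
  obtain \<psi> V and G :: "complex^'n \<Rightarrow> complex^'n" where \<psi>: "\<psi> \<in> A" "p \<in> fst \<psi>"
    and V: "open V" "snd \<psi> p \<in> V" "V \<subseteq> snd \<psi> ` fst \<psi>" and G: "\<And>k. Ck_on k G V"
      "\<And>z. z \<in> V \<Longrightarrow> chart_inv \<psi> z \<in> L \<longleftrightarrow> G z = 0"
    and kernel: "\<And>v. frechet_derivative G (at (snd \<psi> p)) v = 0 \<Longrightarrow>
        coord_vec A \<psi> p v \<in> submanifold_tangent_space A L p"
    using submanifold_slice_defining_map[OF L] by metis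
  let ?\<tau> = "transition \<phi> \<psi>" and ?DG = "frechet_derivative G (at (snd \<psi> p))"
  define N where "N = snd \<phi> ` (fst \<phi> \<inter> chart_inv \<psi> ` V)"
  have V_eq: "chart_inv \<psi> ` V = fst \<psi> \<inter> snd \<psi> -` V" by (rule chart_inv_image_eq[OF \<psi>(1) V(3)])
  have N: "open N" "snd \<phi> p \<in> N" "N \<subseteq> snd \<phi> ` fst \<phi>"
    unfolding N_def using open_chart_image[OF \<phi>(1) open_chart_inv_image[OF \<psi>(1) V(1,3)]] \<phi> \<psi> V(2)
    by (auto simp: V_eq)
  have \<tau>: "?\<tau> z \<in> V" "z \<in> snd \<phi> ` (fst \<phi> \<inter> fst \<psi>)" "chart_inv \<psi> (?\<tau> z) = chart_inv \<phi> z" if "z \<in> N" for z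
    using that \<phi> \<psi> unfolding N_def V_eq by (auto simp: transition_chart chart_inv_chart)
  have \<tau>_smooth: "Ck_on k ?\<tau> N" for k
    by (rule Ck_on_subset[OF transition_Ck[OF \<phi>(1) \<psi>(1)]]) (use \<tau>(2) in blast)
  have smooth: "Ck_on k (\<lambda>z. G (?\<tau> z)) N" for k
    by (rule Ck_on_compose[OF N(1) V(1) _ \<tau>_smooth G(1)]) (use \<tau>(1) in blast)
  have zero_set: "chart_inv \<phi> z \<in> L \<longleftrightarrow> G (?\<tau> z) = 0" if "z \<in> N" for z
    using G(2)[OF \<tau>(1)[OF that]] \<tau>(3)[OF that] by simp
  have "(G has_derivative ?DG) (at (?\<tau> (snd \<phi> p)))"
    using Ck_on_SucD(1)[OF G(1) V(2)] \<phi> by (simp add: transition_chart)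
  from has_derivative_compose[OF has_derivative_transition[OF \<phi>(1) \<psi>(1) \<phi>(2) \<psi>(2)] this]
  have D: "((\<lambda>z. G (?\<tau> z)) has_derivative (\<lambda>w. ?DG (transition_derivative \<phi> \<psi> p w))) (at (snd \<phi> p))" .
  have "tangent_coords \<phi> L p = {v. ?DG (transition_derivative \<phi> \<psi> p v) = 0}"
  proof (intro equalityI subsetI CollectI)
    fix v assume "v \<in> tangent_coords \<phi> L p"
    then show "?DG (transition_derivative \<phi> \<psi> p v) = 0"
      using submanifold_tangent_in_kernel[OF \<phi> N D] zero_set unfolding tangent_coords_def by blast
  next
    fix v assume "v \<in> {v. ?DG (transition_derivative \<phi> \<psi> p v) = 0}"
    then have "coord_vec A \<psi> p (transition_derivative \<phi> \<psi> p v) \<in> submanifold_tangent_space A L p"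
      using kernel by simp
    then show "v \<in> tangent_coords \<phi> L p"
      using coord_vec_change[OF \<phi> \<psi>] mem_tangent_coords_iff[OF \<phi>] by simp
  qed
  then show thesis
    using that[OF N smooth zero_set] by (simp add: frechet_derivative_at[OF D, symmetric])
qed

lemma subspace_tangent_coords:
  assumes "embedded_submanifold A k L" and "p \<in> L" and "\<phi> \<in> A" "p \<in> fst \<phi>"
  shows "subspace (tangent_coords \<phi> L p)"
proof -
  obtain N and G :: "complex^'n \<Rightarrow> complex^'n" where "snd \<phi> p \<in> N" "Ck_on (Suc 0) G N"
    "tangent_coords \<phi> L p = {v. frechet_derivative G (at (snd \<phi> p)) v = 0}"
    using submanifold_defining_map[OF assms] by metis
  then show ?thesis
    using linear_subspace_kernel[OF has_derivative_linear[OF Ck_on_SucD(1)]] by metis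
qed

end

section \<open>Coordinate balls are Stein\<close>

definition ball_exhaustion :: "complex^'n::finite \<Rightarrow> real \<Rightarrow> complex^'n \<Rightarrow> real" where
  "ball_exhaustion a R z = 1 / (R\<^sup>2 - (norm (z - a))\<^sup>2)"

lemma norm_sq_less_in_ball:
  fixes z :: "'a::real_normed_vector"
  assumes "z \<in> ball a R"
  shows "(norm (z - a))\<^sup>2 < R\<^sup>2"
  using assms by (intro power_strict_mono) (auto simp: dist_norm norm_minus_commute)

lemma Ck_on_ball_exhaustion: "Ck_on k (ball_exhaustion a R) (ball a R)"
proof -
  have "Ck_on k (\<lambda>z. R\<^sup>2 + - (norm (z - a))\<^sup>2) (ball a R)"
    by (intro Ck_on_add[OF open_ball] Ck_on_const
        Ck_on_norm_sq_compose[OF open_ball Ck_on_diff_const[OF open_ball]]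
        Ck_on_linear_compose[OF bounded_linear_minus[OF bounded_linear_ident] open_ball])
  then have "Ck_on k (\<lambda>z. 1 / (R\<^sup>2 + - (norm (z - a))\<^sup>2)) (ball a R)"
    by (rule Ck_on_inverse[OF open_ball, rotated]) (use norm_sq_less_in_ball in force)
  then show ?thesis by (simp add: ball_exhaustion_def[abs_def])
qed

lemma second_derivative_ball_exhaustion:
  assumes z: "z \<in> ball a R"
  shows "second_derivative (ball_exhaustion a R) z v w =
    8 * ((z - a) \<bullet> v) * ((z - a) \<bullet> w) * (ball_exhaustion a R z)^3 + 2 * (v \<bullet> w) * (ball_exhaustion a R z)\<^sup>2"
proof (rule second_derivative_eqI[OF open_ball z])
  let ?\<rho> = "ball_exhaustion a R"
  have derivative: "(?\<rho> has_derivative (\<lambda>w. 2 * ((y - a) \<bullet> w) * (?\<rho> y)\<^sup>2)) (at y)" if "y \<in> ball a R" for y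
    using norm_sq_less_in_ball[OF that] unfolding ball_exhaustion_def[abs_def] power2_norm_eq_inner
    by (auto intro!: derivative_eq_intros simp: inner_commute power2_eq_square divide_simps)
  show "(?\<rho> has_derivative (\<lambda>w. 2 * ((y - a) \<bullet> w) * (?\<rho> y)\<^sup>2)) (at y)" if "y \<in> ball a R" for y
    by (rule derivative[OF that])
  show "((\<lambda>y. 2 * ((y - a) \<bullet> v) * (?\<rho> y)\<^sup>2) has_derivative
      (\<lambda>w. 8 * ((z - a) \<bullet> v) * ((z - a) \<bullet> w) * (?\<rho> z)^3 + 2 * (v \<bullet> w) * (?\<rho> z)\<^sup>2)) (at z)"
    by (auto intro!: derivative_eq_intros derivative[OF z]
        simp: inner_commute power2_eq_square power3_eq_cube algebra_simps)
qed

lemma levi_form_ball_exhaustion_pos: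
  assumes "z \<in> ball a R" and "w \<noteq> 0"
  shows "0 < levi_form (ball_exhaustion a R) z w"
proof -
  let ?\<rho> = "ball_exhaustion a R z"
  have \<rho>: "0 < ?\<rho>" using norm_sq_less_in_ball[OF assms(1)] by (simp add: ball_exhaustion_def)
  define s t where "s = (z - a) \<bullet> w" and "t = (z - a) \<bullet> (\<i> *s w)"
  have "levi_form (ball_exhaustion a R) z w = 2 * (s\<^sup>2 + t\<^sup>2) * ?\<rho>^3 + (norm w)\<^sup>2 * ?\<rho>\<^sup>2"
    unfolding levi_form_eq_second_derivative second_derivative_ball_exhaustion[OF assms(1)]
      power2_norm_eq_inner[symmetric] norm_i_scale s_def[symmetric] t_def[symmetric]
    by (simp add: power2_eq_square algebra_simps)
  then show ?thesis using \<rho> assms(2) by (simp add: add_nonneg_pos)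
qed

lemma compact_ball_exhaustion_sublevel: "compact {z \<in> ball a R. ball_exhaustion a R z \<le> c}"
proof -
  have "{z \<in> ball a R. ball_exhaustion a R z \<le> c} = cball a R \<inter> {z. 1 \<le> c * (R\<^sup>2 - (norm (z - a))\<^sup>2)}"
  proof (intro equalityI subsetI)
    fix z assume z: "z \<in> {z \<in> ball a R. ball_exhaustion a R z \<le> c}"
    then show "z \<in> cball a R \<inter> {z. 1 \<le> c * (R\<^sup>2 - (norm (z - a))\<^sup>2)}"
      using norm_sq_less_in_ball[of z a R] by (auto simp: ball_exhaustion_def pos_divide_le_eq)
  next
    fix z assume z: "z \<in> cball a R \<inter> {z. 1 \<le> c * (R\<^sup>2 - (norm (z - a))\<^sup>2)}"
    then have "norm (z - a) \<noteq> R" by auto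
    then have "z \<in> ball a R" using z by (auto simp: dist_norm norm_minus_commute)
    then show "z \<in> {z \<in> ball a R. ball_exhaustion a R z \<le> c}"
      using z norm_sq_less_in_ball[of z a R] by (simp add: ball_exhaustion_def pos_divide_le_eq)
  qed
  moreover have "closed {z. 1 \<le> c * (R\<^sup>2 - (norm (z - a))\<^sup>2)}"
    by (intro closed_Collect_le continuous_intros)
  ultimately show ?thesis by (simp add: compact_Int_closed)
qed

context complex_manifold
begin

context
  fixes \<phi> a R
  assumes \<phi>: "\<phi> \<in> A" and ball: "ball a R \<subseteq> snd \<phi> ` fst \<phi>"
begin

lemma coordinate_ball_eq: "chart_inv \<phi> ` ball a R = fst \<phi> \<inter> snd \<phi> -` ball a R"
  by (rule chart_inv_image_eq[OF \<phi> ball])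

lemma coordinate_ball_in_chart:
  assumes \<psi>: "\<psi> \<in> A"
  shows "open (snd \<psi> ` (fst \<psi> \<inter> chart_inv \<phi> ` ball a R))"
    and "holo_map_on (transition \<psi> \<phi>) (snd \<psi> ` (fst \<psi> \<inter> chart_inv \<phi> ` ball a R))"
    and "transition \<psi> \<phi> ` snd \<psi> ` (fst \<psi> \<inter> chart_inv \<phi> ` ball a R) \<subseteq> ball a R"
proof -
  show "open (snd \<psi> ` (fst \<psi> \<inter> chart_inv \<phi> ` ball a R))"
    by (intro open_chart_image open_chart_inv_image \<phi> \<psi> ball open_ball)
  show "holo_map_on (transition \<psi> \<phi>) (snd \<psi> ` (fst \<psi> \<inter> chart_inv \<phi> ` ball a R))"
    by (rule holo_map_on_subset[OF transition_holo[OF \<psi> \<phi>]]) (auto simp: coordinate_ball_eq)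
  show "transition \<psi> \<phi> ` snd \<psi> ` (fst \<psi> \<inter> chart_inv \<phi> ` ball a R) \<subseteq> ball a R"
    using \<psi> by (auto simp: coordinate_ball_eq transition_chart)
qed

lemma cont_psh_on_coordinate_ball:
  assumes u: "strong_psh (ball a R) u"
  shows "cont_psh_on A (chart_inv \<phi> ` ball a R) (\<lambda>q. u (snd \<phi> q))"
  unfolding cont_psh_on_def
proof
  fix \<psi> assume \<psi>: "\<psi> \<in> A"
  have "(\<lambda>q. u (snd \<phi> q)) \<circ> chart_inv \<psi> = (\<lambda>y. u (transition \<psi> \<phi> y))"
    by (simp add: fun_eq_iff transition_def)
  then show "cont_psh (snd \<psi> ` (fst \<psi> \<inter> chart_inv \<phi> ` ball a R)) ((\<lambda>q. u (snd \<phi> q)) \<circ> chart_inv \<psi>)"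
    using strong_psh_imp_cont_psh[OF
        strong_psh_compose_holo_map[OF u coordinate_ball_in_chart(2,3,1)[OF \<psi>]]] by simp
qed

lemma smooth_strictly_psh_coordinate_ball:
  "smooth_strictly_psh_on A (chart_inv \<phi> ` ball a R) (\<lambda>q. ball_exhaustion a R (snd \<phi> q))"
  unfolding smooth_strictly_psh_on_def smooth_fun_on_def smooth_on_def
proof (intro conjI ballI allI impI)
  fix \<psi> assume \<psi>: "\<psi> \<in> A"
  let ?Y = "snd \<psi> ` (fst \<psi> \<inter> chart_inv \<phi> ` ball a R)"
  note Y = coordinate_ball_in_chart[OF \<psi>]
  have in_chart: "(\<lambda>q. ball_exhaustion a R (snd \<phi> q)) \<circ> chart_inv \<psi> =
      (\<lambda>y. ball_exhaustion a R (transition \<psi> \<phi> y))"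
    by (simp add: fun_eq_iff transition_def)
  show "Ck_on k ((\<lambda>q. ball_exhaustion a R (snd \<phi> q)) \<circ> chart_inv \<psi>) ?Y" for k
    unfolding in_chart
    by (rule Ck_on_compose[OF Y(1) open_ball Y(3) Ck_on_holo_map[OF Y(2,1)] Ck_on_ball_exhaustion])
  fix y w :: "complex^'n" assume y: "y \<in> ?Y" and w: "w \<noteq> 0"
  then obtain q where q: "q \<in> fst \<psi>" "q \<in> fst \<phi>" "y = snd \<psi> q" unfolding coordinate_ball_eq by blast
  have "frechet_derivative (transition \<psi> \<phi>) (at y) w \<noteq> 0"
    using transition_derivative_eq_0_iff[OF \<psi> \<phi> q(1,2)] w q(3) by (simp add: transition_derivative_def)
  then have "0 < levi_form (ball_exhaustion a R) (transition \<psi> \<phi> y)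
      (frechet_derivative (transition \<psi> \<phi>) (at y) w)"
    by (rule levi_form_ball_exhaustion_pos[OF subsetD[OF Y(3) imageI[OF y]]])
  then show "0 < levi_form ((\<lambda>q. ball_exhaustion a R (snd \<phi> q)) \<circ> chart_inv \<psi>) y w"
    unfolding in_chart by (simp only: levi_form_compose_holo_map[OF Y(1) y Y(2,3) Ck_on_ball_exhaustion])
qed

lemma stein_coordinate_ball: "stein_on A (chart_inv \<phi> ` ball a R)"
  unfolding stein_on_def
proof (intro conjI exI[of _ "\<lambda>q. ball_exhaustion a R (snd \<phi> q)"] allI smooth_strictly_psh_coordinate_ball)
  show "open (chart_inv \<phi> ` ball a R)" by (intro open_chart_inv_image \<phi> ball open_ball)
  fix c
  let ?Z = "{z \<in> ball a R. ball_exhaustion a R z \<le> c}"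
  have "{q \<in> chart_inv \<phi> ` ball a R. ball_exhaustion a R (snd \<phi> q) \<le> c} = chart_inv \<phi> ` ?Z"
    using ball by (auto simp: chart_chart_inv[OF \<phi>] subset_eq)
  moreover have "?Z \<subseteq> snd \<phi> ` fst \<phi>" using ball by auto
  ultimately show "compact {q \<in> chart_inv \<phi> ` ball a R. ball_exhaustion a R (snd \<phi> q) \<le> c}"
    using compact_chart_inv_image[OF \<phi> compact_ball_exhaustion_sublevel] by simp
qed

lemma continuous_on_cont_psh_coordinate_ball:
  assumes u: "cont_psh_on A (chart_inv \<phi> ` ball a R) u"
  shows "continuous_on (chart_inv \<phi> ` ball a R) u"
proof -
  let ?U = "chart_inv \<phi> ` ball a R"
  have "continuous_on (snd \<phi> ` (fst \<phi> \<inter> ?U)) (u \<circ> chart_inv \<phi>)"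
    using u \<phi> unfolding cont_psh_on_def cont_psh_def by blast
  moreover have "continuous_on ?U (snd \<phi>)"
    by (rule continuous_on_subset[OF continuous_on_chart[OF \<phi>]]) (auto simp: coordinate_ball_eq)
  ultimately have "continuous_on ?U (\<lambda>q. (u \<circ> chart_inv \<phi>) (snd \<phi> q))"
    by (rule continuous_on_compose2) (auto simp: coordinate_ball_eq)
  then show ?thesis
    by (rule continuous_on_eq) (auto simp: coordinate_ball_eq chart_inv_chart[OF \<phi>])
qed

lemma compact_Int_coordinate_ball:
  assumes S: "closedin (top_of_set (ball a R)) {z \<in> ball a R. chart_inv \<phi> z \<in> S}"
    and E: "compact E" "E \<subseteq> chart_inv \<phi> ` ball a R"
  shows "compact (S \<inter> E)"
proof -
  obtain T where T: "closed T" "{z \<in> ball a R. chart_inv \<phi> z \<in> S} = ball a R \<inter> T"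
    using S by (auto simp: closedin_closed)
  have in_chart: "x \<in> fst \<phi>" "snd \<phi> x \<in> ball a R" if "x \<in> E" for x
    using E(2) that by (auto simp: coordinate_ball_eq)
  have "x \<in> S \<longleftrightarrow> snd \<phi> x \<in> T" if "x \<in> E" for x
    using arg_cong[OF T(2), of "\<lambda>Z. snd \<phi> x \<in> Z"] in_chart[OF that] by (simp add: chart_inv_chart[OF \<phi>])
  then have "S \<inter> E = E \<inter> snd \<phi> -` T" by auto
  moreover have "closedin (top_of_set E) (E \<inter> snd \<phi> -` T)"
    by (rule continuous_closedin_preimage[OF continuous_on_subset[OF continuous_on_chart[OF \<phi>]] T(1)])
       (use in_chart in blast)
  ultimately show ?thesis using closedin_compact[OF E(1)] by simp
qed

lemma psh_convex_in_coordinate_ball: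
  assumes K: "compact K" "K \<noteq> {}" "K \<subseteq> chart_inv \<phi> ` ball a R"
    and hull: "hull_in (ball a R) (snd \<phi> ` K) \<subseteq> snd \<phi> ` K"
  shows "psh_convex_in A (chart_inv \<phi> ` ball a R) K"
proof -
  let ?U = "chart_inv \<phi> ` ball a R"
  have cont: "continuous_on K u" if "cont_psh_on A ?U u" for u
    by (rule continuous_on_subset[OF continuous_on_cont_psh_coordinate_ball[OF that] K(3)])
  have "q \<in> psh_hull A ?U K" if "q \<in> K" for q
    unfolding psh_hull_def
  proof (intro CollectI conjI allI impI)
    show "q \<in> ?U" using that K(3) by blast
    show "u q \<le> (SUP x\<in>K. u x)" if "cont_psh_on A ?U u" for u
      using \<open>q \<in> K\<close> compact_continuous_image[OF cont[OF that] K(1)]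
      by (intro cSUP_upper bounded_imp_bdd_above compact_imp_bounded)
  qed
  moreover have "q \<in> K" if "q \<in> psh_hull A ?U K" for q
  proof -
    have q: "q \<in> fst \<phi>" "snd \<phi> q \<in> ball a R"
      using that unfolding psh_hull_def coordinate_ball_eq by auto
    have "snd \<phi> q \<in> hull_in (ball a R) (snd \<phi> ` K)"
      unfolding hull_in_def
    proof (intro CollectI conjI allI impI q(2))
      fix u assume "strong_psh (ball a R) u"
      then have u: "cont_psh_on A ?U (\<lambda>q. u (snd \<phi> q))" by (rule cont_psh_on_coordinate_ball)
      obtain x where x: "x \<in> K" "\<And>y. y \<in> K \<Longrightarrow> u (snd \<phi> y) \<le> u (snd \<phi> x)"
        using continuous_attains_sup[OF K(1,2) cont[OF u]] by blast
      have "u (snd \<phi> q) \<le> (SUP x\<in>K. u (snd \<phi> x))"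
        using \<open>q \<in> psh_hull A ?U K\<close> u unfolding psh_hull_def by blast
      also have "\<dots> \<le> u (snd \<phi> x)" using K(2) x(2) by (rule cSUP_least)
      finally show "\<exists>y\<in>snd \<phi> ` K. u (snd \<phi> q) \<le> u y" using x(1) by blast
    qed
    then obtain x where "x \<in> K" "snd \<phi> q = snd \<phi> x" using hull by blast
    moreover have "x \<in> fst \<phi>" using K(3) \<open>x \<in> K\<close> coordinate_ball_eq by blast
    ultimately show ?thesis using chart_inv_chart[OF \<phi>] q(1) by metis
  qed
  ultimately show ?thesis unfolding psh_convex_in_def using K(1,3) by blast
qed

end

end

section \<open>Taming forms and Riemannian balls\<close>

lemma partition_interval:
  fixes t :: "nat \<Rightarrow> real"
  assumes "t 0 \<le> x" "x < t m"
  shows "\<exists>i<m. t i \<le> x \<and> x < t (Suc i)"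
  using assms(2)
proof (induction m)
  case 0
  then show ?case using assms(1) by simp
next
  case (Suc m)
  then show ?case by (cases "x < t m") (auto intro: less_SucI)
qed

lemma integrable_on_partition:
  fixes f :: "real \<Rightarrow> 'a::banach" and t :: "nat \<Rightarrow> real"
  assumes "\<And>i. i < m \<Longrightarrow> t i \<le> t (Suc i)" and "\<And>i. i < m \<Longrightarrow> f integrable_on {t i..t (Suc i)}"
  shows "t 0 \<le> t m \<and> f integrable_on {t 0..t m}"
  using assms
proof (induction m)
  case 0
  show ?case using integrable_on_refl[of f "t 0"] by simp
next
  case (Suc m)
  then have "t 0 \<le> t m" "f integrable_on {t 0..t m}" "t m \<le> t (Suc m)" "f integrable_on {t m..t (Suc m)}"
    by auto
  then show ?case using Henstock_Kurzweil_Integration.integrable_combine by fastforce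
qed

lemma norm_diff_le_integral:
  fixes f :: "real \<Rightarrow> 'a::banach"
  assumes S: "finite S" and ab: "a \<le> b" and f: "continuous_on {a..b} f"
    and f': "\<And>x. x \<in> {a..b} - S \<Longrightarrow> (f has_vector_derivative f' x) (at x)"
    and bound: "\<And>x. x \<in> {a..b} - S \<Longrightarrow> norm (f' x) \<le> g x" and g: "g integrable_on {a..b}"
  shows "norm (f b - f a) \<le> integral {a..b} g"
proof -
  define f0 where "f0 x = (if x \<in> S then 0 else f' x)" for x
  define g0 where "g0 x = (if x \<in> S then 0 else g x)" for x
  have f0: "(f0 has_integral (f b - f a)) {a..b}"
    by (rule fundamental_theorem_of_calculus_interior_strong[OF S ab _ f]) (use f' in \<open>auto simp: f0_def\<close>)
  have g0: "g0 integrable_on {a..b}"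
    by (rule integrable_spike_finite[OF S _ g]) (simp add: g0_def)
  have "norm (integral {a..b} f0) \<le> integral {a..b} g0"
    by (rule integral_norm_bound_integral) (use f0 g0 bound in \<open>auto simp: f0_def g0_def\<close>)
  also have "integral {a..b} g0 = integral {a..b} g"
    by (rule integral_spike[OF negligible_finite[OF S]]) (simp add: g0_def)
  finally show ?thesis using f0 by (simp add: integral_unique)
qed

lemma first_exit:
  fixes \<gamma> :: "real \<Rightarrow> 'a::topological_space"
  assumes \<gamma>: "continuous_on {0..1} \<gamma>" and U: "open U" "\<gamma> 0 \<in> U" "\<gamma> 1 \<notin> U" and C: "closed C" "U \<subseteq> C"
  obtains s where "s \<in> {0..1}" "\<gamma> s \<notin> U" "\<gamma> ` {0..s} \<subseteq> C"
proof -
  define T where "T = {0..1} \<inter> \<gamma> -` (- U)"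
  have "closed T" unfolding T_def
    by (rule continuous_closed_preimage[OF \<gamma>]) (use U(1) in auto)
  then have "compact T" using compact_Int_closed[OF compact_Icc, of T 0 1] by (simp add: T_def)
  moreover have "1 \<in> T" using U(3) by (simp add: T_def)
  ultimately obtain s where s: "s \<in> T" "\<And>t. t \<in> T \<Longrightarrow> s \<le> t"
    using compact_attains_inf[of T] by auto
  then have "s \<noteq> 0" using U(2) by (auto simp: T_def)
  then have s01: "0 < s" "s \<le> 1" using s(1) by (auto simp: T_def)
  have before: "\<gamma> t \<in> C" if "t \<in> {0..<s}" for t
    using s(2)[of t] that s01 C(2) by (force simp: T_def)
  have "(\<gamma> \<longlongrightarrow> \<gamma> s) (at s within {0..1})"
    using \<gamma> s01 by (auto simp: continuous_on)
  then have "(\<gamma> \<longlongrightarrow> \<gamma> s) (at s within {0..<s})"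
    by (rule tendsto_within_subset) (use s01 in auto)
  moreover have "\<forall>\<^sub>F t in at s within {0..<s}. \<gamma> t \<in> C"
    using before by (auto simp: eventually_at_filter)
  moreover have "at s within {0..<s} \<noteq> bot"
    using s01 by (simp add: trivial_limit_within islimpt_greaterThanLessThan2)
  ultimately have "\<gamma> s \<in> C" using Lim_in_closed_set[OF C(1)] by blast
  then have "\<gamma> ` {0..s} \<subseteq> C" using before by (force simp: less_le)
  then show thesis using that[of s] s(1) by (auto simp: T_def)
qed

locale taming_form = complex_manifold A
  for A :: "('m::{t2_space, second_countable_topology}, 'n::finite) chart set" +
  fixes \<omega> :: "('m, 'n) two_form"
  assumes smooth_form: "smooth_two_form A \<omega>" and tame: "tames_J A \<omega>"
begin

definition form_at :: "('m, 'n) chart \<Rightarrow> 'm \<Rightarrow> complex^'n \<Rightarrow> complex^'n \<Rightarrow> real" where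
  "form_at \<phi> p a b = \<omega> p (coord_vec A \<phi> p a) (coord_vec A \<phi> p b)"

lemma form_coeff_eq: "form_coeff A \<omega> \<phi> a b = (\<lambda>z. form_at \<phi> (chart_inv \<phi> z) a b)"
  by (simp add: form_coeff_def form_at_def)

lemma form_at_bilinear:
  assumes "\<phi> \<in> A" "p \<in> fst \<phi>"
  shows "form_at \<phi> p (a + b) c = form_at \<phi> p a c + form_at \<phi> p b c"
    and "form_at \<phi> p (r *\<^sub>R a) c = r * form_at \<phi> p a c"
    and "form_at \<phi> p a c = - form_at \<phi> p c a"
    and "form_at \<phi> p c (a + b) = form_at \<phi> p c a + form_at \<phi> p c b"
    and "form_at \<phi> p c (r *\<^sub>R a) = r * form_at \<phi> p c a"
proof -
  have alt: "alternating_bilinear_on (tangent_space A p) (\<omega> p)"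
    using smooth_form by (auto simp: smooth_two_form_def)
  note T = coord_vec_tangent[OF assms]
  show add: "form_at \<phi> p (a + b) c = form_at \<phi> p a c + form_at \<phi> p b c" for a b c
    using alt T unfolding alternating_bilinear_on_def form_at_def coord_vec_add[OF assms] by blast
  show scale: "form_at \<phi> p (r *\<^sub>R a) c = r * form_at \<phi> p a c" for r a c
    using alt T unfolding alternating_bilinear_on_def form_at_def coord_vec_scaleR[OF assms] by blast
  show alternating: "form_at \<phi> p a c = - form_at \<phi> p c a" for a c
    using alt T unfolding alternating_bilinear_on_def form_at_def by blast
  show "form_at \<phi> p c (a + b) = form_at \<phi> p c a + form_at \<phi> p c b"
    using add[of a b c] alternating[of c] by simp
  show "form_at \<phi> p c (r *\<^sub>R a) = r * form_at \<phi> p c a"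
    using scale[of r a c] alternating[of c] by simp
qed

lemma bounded_bilinear_form_at:
  assumes "\<phi> \<in> A" "p \<in> fst \<phi>"
  shows "bounded_bilinear (form_at \<phi> p)"
  by (rule bilinear_conv_bounded_bilinear[THEN iffD1])
     (auto simp: bilinear_def form_at_bilinear(1,2,4,5)[OF assms] intro!: linearI)

lemma form_at_tame:
  assumes "\<phi> \<in> A" "p \<in> fst \<phi>" "a \<noteq> 0"
  shows "form_at \<phi> p a (\<i> *s a) > 0"
  using tame coord_vec_tangent[OF assms(1,2)] assms
  unfolding tames_J_def form_at_def coord_vec_J[OF assms(1,2)]
  by (auto simp: coord_vec_eq_zero_iff)

lemma riem_metric_coord:
  assumes "\<phi> \<in> A" "p \<in> fst \<phi>"
  shows "riem_metric \<omega> p (coord_vec A \<phi> p a) (coord_vec A \<phi> p a) = form_at \<phi> p a (\<i> *s a)"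
  unfolding riem_metric_def form_at_def coord_vec_J[OF assms] by simp

lemma form_at_tame_nonneg:
  assumes "\<phi> \<in> A" "p \<in> fst \<phi>"
  shows "0 \<le> form_at \<phi> p a (\<i> *s a)"
  using form_at_tame[OF assms, of a] bounded_bilinear.zero_left[OF bounded_bilinear_form_at[OF assms]]
  by (cases "a = 0") (auto intro: less_imp_le)

lemma continuous_on_form_at:
  assumes \<phi>: "\<phi> \<in> A" and z: "continuous_on S z" "z ` S \<subseteq> snd \<phi> ` fst \<phi>"
    and v: "continuous_on S v" and w: "continuous_on S w"
  shows "continuous_on S (\<lambda>t. form_at \<phi> (chart_inv \<phi> (z t)) (v t) (w t))"
proof (rule continuous_on_bilinear_family[OF _ _ v w])
  show "bounded_bilinear (form_at \<phi> (chart_inv \<phi> (z t)))" if "t \<in> S" for t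
    using that z(2) chart_inv_in[OF \<phi>] by (intro bounded_bilinear_form_at[OF \<phi>]) blast
  show "continuous_on S (\<lambda>t. form_at \<phi> (chart_inv \<phi> (z t)) a b)" for a b
  proof -
    have "Ck_on 0 (form_coeff A \<omega> \<phi> a b) (snd \<phi> ` fst \<phi>)"
      using smooth_form \<phi> unfolding smooth_two_form_def smooth_on_def by blast
    then have "continuous_on (snd \<phi> ` fst \<phi>) (form_coeff A \<omega> \<phi> a b)" by simp
    from continuous_on_compose2[OF this z] show ?thesis by (simp add: form_coeff_eq)
  qed
qed

definition speed_sq :: "(real \<Rightarrow> 'm) \<Rightarrow> real \<Rightarrow> real" where
  "speed_sq \<gamma> t = riem_metric \<omega> (\<gamma> t) (velocity A \<gamma> t) (velocity A \<gamma> t)"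

lemma curve_length_eq_integral_speed_sq: "curve_length A \<omega> \<gamma> = integral {0..1} (\<lambda>t. sqrt (speed_sq \<gamma> t))"
  by (simp add: curve_length_def speed_sq_def)

lemma speed_sq_in_chart:
  assumes \<gamma>: "smooth_curve_on A I \<gamma>" and t: "t \<in> I" and \<phi>: "\<phi> \<in> A" "\<gamma> t \<in> fst \<phi>"
  shows "speed_sq \<gamma> t = form_at \<phi> (\<gamma> t) (vector_derivative (snd \<phi> \<circ> \<gamma>) (at t))
      (\<i> *s vector_derivative (snd \<phi> \<circ> \<gamma>) (at t))"
  unfolding speed_sq_def smooth_curve_velocity(2)[OF assms] by (rule riem_metric_coord[OF \<phi>])

lemma speed_sq_nonneg:
  assumes "smooth_curve_on A I \<gamma>" and "t \<in> I"
  shows "0 \<le> speed_sq \<gamma> t"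
proof -
  obtain \<phi> where "\<phi> \<in> A" "\<gamma> t \<in> fst \<phi>" using chart_covers by blast
  then show ?thesis using speed_sq_in_chart[OF assms] form_at_tame_nonneg by simp
qed

lemma continuous_on_speed_sq:
  assumes \<gamma>: "smooth_curve_on A I \<gamma>"
  shows "continuous_on I (speed_sq \<gamma>)"
proof (rule continuous_at_imp_continuous_on, rule ballI)
  fix t assume t: "t \<in> I"
  obtain \<phi> where \<phi>: "\<phi> \<in> A" "\<gamma> t \<in> fst \<phi>" using chart_covers by blast
  let ?J = "{t \<in> I. \<gamma> t \<in> fst \<phi>}" and ?z' = "\<lambda>t. vector_derivative (snd \<phi> \<circ> \<gamma>) (at t)"
  note chart = smooth_curve_on_chart[OF \<gamma> \<phi>(1)]
  have z': "continuous_on ?J ?z'" by (rule Ck_on_1_vector_derivative(2)[OF chart(2)])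
  have "continuous_on ?J (\<lambda>t. form_at \<phi> (chart_inv \<phi> ((snd \<phi> \<circ> \<gamma>) t)) (?z' t) (\<i> *s ?z' t))"
    by (rule continuous_on_form_at[OF \<phi>(1) _ _ z'
        bounded_linear.continuous_on[OF bounded_linear_i_scale z']])
       (use chart(2)[of 0] in auto)
  then have "continuous_on ?J (speed_sq \<gamma>)"
    by (rule continuous_on_eq) (use speed_sq_in_chart[OF \<gamma> _ \<phi>(1)] chart_inv_chart[OF \<phi>(1)] in auto)
  then show "isCont (speed_sq \<gamma>) t" using chart(1) t \<phi>(2) by (simp add: continuous_on_eq_continuous_at)
qed

lemma velocity_cong:
  assumes "open I" "t \<in> I" "\<And>s. s \<in> I \<Longrightarrow> \<gamma> s = g s"
  shows "velocity A \<gamma> t = velocity A g t"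
proof -
  have "eventually (\<lambda>s. s \<in> I) (nhds t)" using assms(1,2) by (rule eventually_nhds_in_open)
  then have "vector_derivative (snd \<phi> \<circ> \<gamma>) (at t) = vector_derivative (snd \<phi> \<circ> g) (at t)"
    for \<phi> :: "('m, 'n) chart"
    by (intro vector_derivative_cong_eq refl) (auto elim!: eventually_mono simp: assms(3))
  then show ?thesis using assms(2,3) by (auto simp: velocity_def fun_eq_iff)
qed

lemma speed_sq_cong:
  assumes "open I" "t \<in> I" "\<And>s. s \<in> I \<Longrightarrow> \<gamma> s = g s"
  shows "speed_sq \<gamma> t = speed_sq g t"
  using velocity_cong[OF assms] assms(2,3) by (simp add: speed_sq_def)

lemma smooth_curve_on_cong:
  assumes g: "smooth_curve_on A I g" and J: "open J" "J \<subseteq> I" "\<And>s. s \<in> J \<Longrightarrow> \<gamma> s = g s"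
  shows "smooth_curve_on A J \<gamma>"
  unfolding smooth_curve_on_def smooth_on_def
proof (intro conjI ballI allI J(1))
  have "continuous_on J g" using g J continuous_on_subset unfolding smooth_curve_on_def by blast
  then show \<gamma>_cont: "continuous_on J \<gamma>" using J(3) by (metis continuous_on_eq)
  fix \<phi> k assume \<phi>: "\<phi> \<in> A"
  let ?T = "{t \<in> J. \<gamma> t \<in> fst \<phi>}"
  have "?T = J \<inter> \<gamma> -` fst \<phi>" by auto
  then have open_T: "open ?T" using continuous_open_preimage[OF \<gamma>_cont J(1) open_chart_dom[OF \<phi>]] by simp
  have "Ck_on k (snd \<phi> \<circ> g) {t \<in> I. g t \<in> fst \<phi>}"
    using g \<phi> unfolding smooth_curve_on_def smooth_on_def by blast
  then have "Ck_on k (snd \<phi> \<circ> g) ?T" by (rule Ck_on_subset) (use J in auto)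
  then show "Ck_on k (snd \<phi> \<circ> \<gamma>) ?T" by (rule Ck_on_cong[OF open_T, rotated]) (use J in auto)
qed

lemma integrable_sqrt_speed_sq:
  assumes g: "smooth_curve_on A I g" "{a..b} \<subseteq> I" and \<gamma>_eq: "\<And>s. s \<in> {a..b} \<Longrightarrow> \<gamma> s = g s"
  shows "(\<lambda>s. sqrt (speed_sq \<gamma> s)) integrable_on {a..b}"
proof -
  have "continuous_on {a..b} (\<lambda>s. sqrt (speed_sq g s))"
    by (intro continuous_intros continuous_on_subset[OF continuous_on_speed_sq[OF g(1)] g(2)])
  then have "(\<lambda>s. sqrt (speed_sq g s)) integrable_on {a..b}" by (rule integrable_continuous_real)
  then show ?thesis
  proof (rule integrable_spike_finite[of "{a, b}", rotated 2])
    show "sqrt (speed_sq \<gamma> s) = sqrt (speed_sq g s)" if "s \<in> {a..b} - {a, b}" for s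
      using speed_sq_cong[of "{a<..<b}" s \<gamma> g] that \<gamma>_eq by auto
  qed simp
qed

lemma piecewise_smooth_curve_regular:
  assumes "piecewise_smooth_curve A \<gamma>"
  obtains S where "finite S" "\<And>x. x \<in> {0..1} - S \<Longrightarrow> \<exists>J. x \<in> J \<and> smooth_curve_on A J \<gamma>"
    "(\<lambda>t. sqrt (speed_sq \<gamma> t)) integrable_on {0..1}"
proof -
  obtain m t where t: "t (0::nat) = 0" "t m = 1"
    and piece: "\<And>i. i < m \<Longrightarrow> t i < t (Suc i)"
      "\<And>i. i < m \<Longrightarrow> \<exists>I g. {t i..t (Suc i)} \<subseteq> I \<and> smooth_curve_on A I g \<and> (\<forall>s\<in>{t i..t (Suc i)}. \<gamma> s = g s)"
    using assms unfolding piecewise_smooth_curve_def by metis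
  have smooth: "smooth_curve_on A {t i<..<t (Suc i)} \<gamma>"
    and integrable: "(\<lambda>s. sqrt (speed_sq \<gamma> s)) integrable_on {t i..t (Suc i)}" if i: "i < m" for i
  proof -
    obtain I g where g: "{t i..t (Suc i)} \<subseteq> I" "smooth_curve_on A I g" "\<forall>s\<in>{t i..t (Suc i)}. \<gamma> s = g s"
      using piece(2)[OF i] by blast
    show "smooth_curve_on A {t i<..<t (Suc i)} \<gamma>"
      by (rule smooth_curve_on_cong[OF g(2)]) (use g(1,3) in auto)
    show "(\<lambda>s. sqrt (speed_sq \<gamma> s)) integrable_on {t i..t (Suc i)}"
      by (rule integrable_sqrt_speed_sq[OF g(2,1)]) (use g(3) in blast)
  qed
  show thesis
  proof (rule that[of "t ` {..m}"])
    show "(\<lambda>s. sqrt (speed_sq \<gamma> s)) integrable_on {0..1}"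
      using integrable_on_partition[of m t] piece(1) integrable t by (auto intro: less_imp_le)
    fix x assume x: "x \<in> {0..1} - t ` {..m}"
    then have "x \<noteq> t m" by auto
    then obtain i where i: "i < m" "t i \<le> x" "x < t (Suc i)"
      using partition_interval[of t x m] x t by auto
    moreover have "x \<noteq> t i" using x i by auto
    ultimately show "\<exists>J. x \<in> J \<and> smooth_curve_on A J \<gamma>"
      using smooth[OF i(1)] by (intro exI[of _ "{t i<..<t (Suc i)}"]) auto
  qed simp
qed

lemma metric_lower_bound:
  assumes \<phi>: "\<phi> \<in> A" "p \<in> fst \<phi>"
  obtains c r where "0 < c" "0 < r" "cball (snd \<phi> p) r \<subseteq> snd \<phi> ` fst \<phi>"
    "\<And>z w. z \<in> cball (snd \<phi> p) r \<Longrightarrow> (c * norm w)\<^sup>2 \<le> form_at \<phi> (chart_inv \<phi> z) w (\<i> *s w)"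
proof -
  let ?q = "\<lambda>z w. form_at \<phi> (chart_inv \<phi> z) w (\<i> *s w)"
  obtain m r where mr: "0 < m" "0 < r" "cball (snd \<phi> p) r \<subseteq> snd \<phi> ` fst \<phi>"
    "\<And>z w. z \<in> cball (snd \<phi> p) r \<Longrightarrow> m * (norm w)\<^sup>2 \<le> ?q z w"
  proof (rule pos_quadratic_family_lower_bound[of "snd \<phi> ` fst \<phi>" "snd \<phi> p" ?q])
    show "open (snd \<phi> ` fst \<phi>)" "snd \<phi> p \<in> snd \<phi> ` fst \<phi>" using \<phi> open_chart_range by auto
    show "continuous_on (snd \<phi> ` fst \<phi> \<times> sphere 0 1) (\<lambda>(z, w). ?q z w)"
      unfolding case_prod_beta
      by (intro continuous_on_form_at[OF \<phi>(1)] continuous_intros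
          bounded_linear.continuous_on[OF bounded_linear_i_scale]) auto
    show "?q z (r *\<^sub>R w) = r\<^sup>2 * ?q z w" if "z \<in> snd \<phi> ` fst \<phi>" for z w and r :: real
      using form_at_bilinear(2,5)[OF \<phi>(1) chart_inv_in[OF \<phi>(1) that]]
        linear_cmul[OF bounded_linear.linear[OF bounded_linear_i_scale], of r w]
      by (simp add: power2_eq_square)
    show "0 < ?q (snd \<phi> p) w" if "w \<noteq> 0" for w
      using form_at_tame[OF \<phi> that] chart_inv_chart[OF \<phi>] by simp
  qed (rule that)
  then show thesis by (intro that[of "sqrt m" r]) (auto simp: power_mult_distrib)
qed

lemma initial_length_le_curve_length:
  assumes \<gamma>: "piecewise_smooth_curve A \<gamma>" and s: "s \<in> {0..1}"
  shows "integral {0..s} (\<lambda>t. sqrt (speed_sq \<gamma> t)) \<le> curve_length A \<omega> \<gamma>"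
proof -
  let ?speed = "\<lambda>t. sqrt (speed_sq \<gamma> t)"
  obtain S where S: "finite S" "\<And>x. x \<in> {0..1} - S \<Longrightarrow> \<exists>J. x \<in> J \<and> smooth_curve_on A J \<gamma>"
    and integrable: "?speed integrable_on {0..1}"
    using piecewise_smooth_curve_regular[OF \<gamma>] by blast
  have "norm ((\<lambda>_. 0::real) 1 - (\<lambda>_. 0) s) \<le> integral {s..1} ?speed"
  proof (rule norm_diff_le_integral[OF S(1)])
    show "norm (0::real) \<le> ?speed x" if "x \<in> {s..1} - S" for x
      using S(2)[of x] speed_sq_nonneg that s by auto
    show "?speed integrable_on {s..1}" by (rule integrable_on_subinterval[OF integrable]) (use s in auto)
  qed (use s in auto)
  then show ?thesis
    using Henstock_Kurzweil_Integration.integral_combine[of 0 s 1 ?speed] s integrable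
    by (simp add: curve_length_eq_integral_speed_sq)
qed

lemma displacement_le_curve_length:
  assumes \<phi>: "\<phi> \<in> A" and Z: "Z \<subseteq> snd \<phi> ` fst \<phi>" and c: "0 < c"
      "\<And>z w. z \<in> Z \<Longrightarrow> (c * norm w)\<^sup>2 \<le> form_at \<phi> (chart_inv \<phi> z) w (\<i> *s w)"
    and \<gamma>: "piecewise_smooth_curve A \<gamma>" and s: "s \<in> {0..1}" and in_Z: "\<gamma> ` {0..s} \<subseteq> chart_inv \<phi> ` Z"
  shows "c * norm (snd \<phi> (\<gamma> s) - snd \<phi> (\<gamma> 0)) \<le> curve_length A \<omega> \<gamma>"
proof -
  let ?z = "snd \<phi> \<circ> \<gamma>" and ?speed = "\<lambda>t. sqrt (speed_sq \<gamma> t)"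
  obtain S where S: "finite S" "\<And>x. x \<in> {0..1} - S \<Longrightarrow> \<exists>J. x \<in> J \<and> smooth_curve_on A J \<gamma>"
    and integrable: "?speed integrable_on {0..1}"
    using piecewise_smooth_curve_regular[OF \<gamma>] by blast
  have integrable_s: "?speed integrable_on {0..s}"
    by (rule integrable_on_subinterval[OF integrable]) (use s in auto)
  have \<gamma>_Z: "\<gamma> x \<in> fst \<phi>" "?z x \<in> Z" if "x \<in> {0..s}" for x
    using subsetD[OF in_Z imageI[OF that]] unfolding chart_inv_image_eq[OF \<phi> Z] by auto
  have speed: "((\<lambda>t. c *\<^sub>R ?z t) has_vector_derivative c *\<^sub>R vector_derivative ?z (at x)) (at x)"
      "norm (c *\<^sub>R vector_derivative ?z (at x)) \<le> ?speed x" if x: "x \<in> {0..s} - S" for x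
  proof -
    obtain J where J: "smooth_curve_on A J \<gamma>" "x \<in> J" using S(2)[of x] x s by auto
    show "((\<lambda>t. c *\<^sub>R ?z t) has_vector_derivative c *\<^sub>R vector_derivative ?z (at x)) (at x)"
      by (rule bounded_linear.has_vector_derivative[OF bounded_linear_scaleR_right
          smooth_curve_velocity(1)[OF J \<phi>]])
         (use \<gamma>_Z(1) x in blast)
    have "(c * norm (vector_derivative ?z (at x)))\<^sup>2 \<le> speed_sq \<gamma> x"
      using c(2)[OF \<gamma>_Z(2), of x] speed_sq_in_chart[OF J \<phi> \<gamma>_Z(1)] chart_inv_chart[OF \<phi> \<gamma>_Z(1)] x by simp
    then show "norm (c *\<^sub>R vector_derivative ?z (at x)) \<le> ?speed x"
      using c(1) by (simp add: real_le_rsqrt)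
  qed
  have "continuous_on {0..s} \<gamma>"
    using \<gamma> s by (auto simp: piecewise_smooth_curve_def elim: continuous_on_subset)
  then have "continuous_on {0..s} ?z"
    by (rule continuous_on_compose)
       (use \<gamma>_Z(1) in \<open>auto intro: continuous_on_subset[OF continuous_on_chart[OF \<phi>]]\<close>)
  then have "continuous_on {0..s} (\<lambda>t. c *\<^sub>R ?z t)" by (rule continuous_on_scaleR[OF continuous_on_const])
  from norm_diff_le_integral[OF S(1) _ this speed integrable_s] s
  have "norm (c *\<^sub>R ?z s - c *\<^sub>R ?z 0) \<le> integral {0..s} ?speed" by simp
  also have "\<dots> \<le> curve_length A \<omega> \<gamma>" by (rule initial_length_le_curve_length[OF \<gamma> s])
  finally show ?thesis using c(1) by (simp flip: scaleR_diff_right)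
qed

lemma radius_le_length_of_exiting_curve:
  assumes \<phi>: "\<phi> \<in> A" "p \<in> fst \<phi>" and r: "0 < r" "cball (snd \<phi> p) r \<subseteq> snd \<phi> ` fst \<phi>" and c: "0 < c"
      "\<And>z w. z \<in> cball (snd \<phi> p) r \<Longrightarrow> (c * norm w)\<^sup>2 \<le> form_at \<phi> (chart_inv \<phi> z) w (\<i> *s w)"
    and \<gamma>: "piecewise_smooth_curve A \<gamma>" "\<gamma> 0 = p" "\<gamma> 1 \<notin> chart_inv \<phi> ` ball (snd \<phi> p) r"
  shows "c * r \<le> curve_length A \<omega> \<gamma>"
proof -
  let ?U = "chart_inv \<phi> ` ball (snd \<phi> p) r" and ?C = "chart_inv \<phi> ` cball (snd \<phi> p) r"
  have ball: "ball (snd \<phi> p) r \<subseteq> snd \<phi> ` fst \<phi>" using r(2) by auto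
  note U_eq = chart_inv_image_eq[OF \<phi>(1) ball]
  have "compact ?C" by (rule compact_chart_inv_image[OF \<phi>(1) compact_cball r(2)])
  then have closed: "closed ?C" by (rule compact_imp_closed)
  have \<gamma>_cont: "continuous_on {0..1} \<gamma>" using \<gamma>(1) by (simp add: piecewise_smooth_curve_def)
  have start: "\<gamma> 0 \<in> ?U" using \<phi> r(1) \<gamma>(2) by (simp add: U_eq)
  obtain s where s: "s \<in> {0..1}" "\<gamma> s \<notin> ?U" "\<gamma> ` {0..s} \<subseteq> ?C"
    by (rule first_exit[OF \<gamma>_cont open_chart_inv_image[OF \<phi>(1) open_ball ball] start \<gamma>(3) closed
          image_mono[OF ball_subset_cball]])
  have "\<gamma> s \<in> fst \<phi>" using s(1,3) unfolding chart_inv_image_eq[OF \<phi>(1) r(2)] by force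
  then have "r \<le> norm (snd \<phi> (\<gamma> s) - snd \<phi> (\<gamma> 0))"
    using s(2) \<gamma>(2) by (simp add: U_eq dist_norm norm_minus_commute)
  then have "c * r \<le> c * norm (snd \<phi> (\<gamma> s) - snd \<phi> (\<gamma> 0))" using c(1) by simp
  also have "\<dots> \<le> curve_length A \<omega> \<gamma>"
    by (rule displacement_le_curve_length[OF \<phi>(1) r(2) c \<gamma>(1) s(1,3)])
  finally show ?thesis .
qed

lemma riem_ball_subset_coordinate_ball:
  assumes \<phi>: "\<phi> \<in> A" "p \<in> fst \<phi>" and R: "0 < R"
  obtains \<epsilon>0 r where "0 < \<epsilon>0" "0 < r" "r \<le> R" "cball (snd \<phi> p) r \<subseteq> snd \<phi> ` fst \<phi>"
    "\<And>\<epsilon>. \<epsilon> \<le> \<epsilon>0 \<Longrightarrow> riem_ball A \<omega> p \<epsilon> \<subseteq> chart_inv \<phi> ` ball (snd \<phi> p) r"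
proof -
  obtain c r0 where c: "0 < c" "0 < r0" "cball (snd \<phi> p) r0 \<subseteq> snd \<phi> ` fst \<phi>"
    "\<And>z w. z \<in> cball (snd \<phi> p) r0 \<Longrightarrow> (c * norm w)\<^sup>2 \<le> form_at \<phi> (chart_inv \<phi> z) w (\<i> *s w)"
    using metric_lower_bound[OF \<phi>] by blast
  define r where "r = min r0 R"
  have r: "0 < r" "r \<le> R" "cball (snd \<phi> p) r \<subseteq> cball (snd \<phi> p) r0" using c(2) R by (auto simp: r_def)
  have cball: "cball (snd \<phi> p) r \<subseteq> snd \<phi> ` fst \<phi>" using r(3) c(3) by blast
  show thesis
  proof (rule that[OF _ r(1,2) cball])
    fix \<epsilon> assume \<epsilon>: "\<epsilon> \<le> c * r"
    show "riem_ball A \<omega> p \<epsilon> \<subseteq> chart_inv \<phi> ` ball (snd \<phi> p) r"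
    proof
      fix q assume "q \<in> riem_ball A \<omega> p \<epsilon>"
      then obtain \<gamma> where "piecewise_smooth_curve A \<gamma>" "\<gamma> 0 = p" "\<gamma> 1 = q" "curve_length A \<omega> \<gamma> < \<epsilon>"
        unfolding riem_ball_def riem_dist_def by (auto simp: INF_less_iff)
      then show "q \<in> chart_inv \<phi> ` ball (snd \<phi> p) r"
        using radius_le_length_of_exiting_curve[OF \<phi> r(1) cball c(1) c(4)[OF subsetD[OF r(3)]]] \<epsilon>
        by fastforce
    qed
  qed (use c(1) r(1) in simp)
qed

lemma centre_in_riem_ball:
  assumes "\<epsilon> > 0"
  shows "p \<in> riem_ball A \<omega> p \<epsilon>"
proof -
  have smooth: "smooth_curve_on A UNIV (\<lambda>t. p)"
    unfolding smooth_curve_on_def smooth_on_def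
    by (auto simp: o_def intro: Ck_on_const)
  have piecewise_smooth: "piecewise_smooth_curve A (\<lambda>t. p)"
    unfolding piecewise_smooth_curve_def
    using smooth by (intro conjI exI[of _ "1::nat"] exI[of _ "\<lambda>i. real i"]) auto
  obtain \<phi> where \<phi>: "\<phi> \<in> A" "p \<in> fst \<phi>" using chart_covers by blast
  have "velocity A (\<lambda>t. p) t = coord_vec A \<phi> p 0" for t
    using velocity_eq_coord_vec[of \<phi> "\<lambda>t. p" t UNIV 0] \<phi> by (simp add: o_def)
  then have "speed_sq (\<lambda>t. p) t = 0" for t
    unfolding speed_sq_def using riem_metric_coord[OF \<phi>, of 0] form_at_bilinear(2)[OF \<phi>, of 0 0] by simp
  then have "curve_length A \<omega> (\<lambda>t. p) = 0" by (simp add: curve_length_eq_integral_speed_sq)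
  moreover have "riem_dist A \<omega> p p \<le> ereal (curve_length A \<omega> (\<lambda>t. p))"
    unfolding riem_dist_def by (rule INF_lower) (use piecewise_smooth in auto)
  ultimately show ?thesis using assms
    by (auto simp: riem_ball_def intro: le_less_trans)
qed

lemma locally_psh_convexI:
  assumes \<phi>: "\<phi> \<in> A" "p \<in> fst \<phi>" and p: "p \<in> S"
    and R: "0 < R" "ball (snd \<phi> p) R \<subseteq> snd \<phi> ` fst \<phi>"
    and closed: "closedin (top_of_set (ball (snd \<phi> p) R)) {z \<in> ball (snd \<phi> p) R. chart_inv \<phi> z \<in> S}"
    and hull: "\<And>K. compact K \<Longrightarrow> snd \<phi> p \<in> K \<Longrightarrow> K \<subseteq> {z \<in> ball (snd \<phi> p) R. chart_inv \<phi> z \<in> S} \<Longrightarrow>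
      hull_in (ball (snd \<phi> p) R) K \<subseteq> K"
  shows "locally_psh_convex A \<omega> S p"
proof -
  let ?B = "ball (snd \<phi> p) R"
  obtain \<epsilon>0 r where \<epsilon>0: "0 < \<epsilon>0" and r: "r \<le> R / 2" "cball (snd \<phi> p) r \<subseteq> snd \<phi> ` fst \<phi>"
    and riem_ball: "\<And>\<epsilon>. \<epsilon> \<le> \<epsilon>0 \<Longrightarrow> riem_ball A \<omega> p \<epsilon> \<subseteq> chart_inv \<phi> ` ball (snd \<phi> p) r"
    using riem_ball_subset_coordinate_ball[OF \<phi>, of "R / 2"] R(1) by (metis half_gt_zero)
  let ?C = "chart_inv \<phi> ` cball (snd \<phi> p) r"
  have compact_C: "compact ?C" by (rule compact_chart_inv_image[OF \<phi>(1) compact_cball r(2)])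
  have C_B: "?C \<subseteq> chart_inv \<phi> ` ?B" using r(1) R(1) by (intro image_mono) auto
  have "psh_convex_in A (chart_inv \<phi> ` ?B) (S \<inter> closure (riem_ball A \<omega> p \<epsilon>))" if \<epsilon>: "0 < \<epsilon>" "\<epsilon> < \<epsilon>0" for \<epsilon>
  proof -
    let ?E = "closure (riem_ball A \<omega> p \<epsilon>)"
    have E_C: "?E \<subseteq> ?C"
      using riem_ball[of \<epsilon>] \<epsilon> by (intro closure_minimal compact_imp_closed compact_C) auto
    then have compact_E: "compact ?E"
      using compact_Int_closed[OF compact_C closed_closure] by (metis inf.absorb2)
    have E_B: "?E \<subseteq> chart_inv \<phi> ` ?B" using E_C C_B by blast
    then have in_chart: "?E \<subseteq> fst \<phi>" "snd \<phi> ` ?E \<subseteq> ?B" by (auto simp: coordinate_ball_eq[OF \<phi>(1) R(2)])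
    have compact: "compact (S \<inter> ?E)"
      by (rule compact_Int_coordinate_ball[OF \<phi>(1) R(2) closed compact_E E_B])
    have "compact (snd \<phi> ` (S \<inter> ?E))"
      by (intro compact_continuous_image compact continuous_on_subset[OF continuous_on_chart[OF \<phi>(1)]])
         (use in_chart(1) in blast)
    moreover have p_in: "p \<in> S \<inter> ?E" using p centre_in_riem_ball[OF \<epsilon>(1)] closure_subset by blast
    moreover have "snd \<phi> ` (S \<inter> ?E) \<subseteq> {z \<in> ?B. chart_inv \<phi> z \<in> S}"
      using in_chart chart_inv_chart[OF \<phi>(1)] by (auto simp: subset_eq)
    ultimately have "hull_in ?B (snd \<phi> ` (S \<inter> ?E)) \<subseteq> snd \<phi> ` (S \<inter> ?E)" by (intro hull imageI)
    then show ?thesis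
      using p_in E_B by (intro psh_convex_in_coordinate_ball[OF \<phi>(1) R(2) compact]) auto
  qed
  moreover have "p \<in> chart_inv \<phi> ` ?B" using R(1) chart_inv_chart[OF \<phi>] by (metis centre_in_ball image_eqI)
  ultimately show ?thesis
    unfolding locally_psh_convex_def using \<epsilon>0 stein_coordinate_ball[OF \<phi>(1) R(2)] by blast
qed

end

section \<open>Transverse Lagrangian submanifolds\<close>

lemma complementary_reflection:
  fixes T1 T2 :: "'a::real_vector set"
  assumes T: "subspace T1" "subspace T2" and disjoint: "\<And>v. v \<in> T1 \<Longrightarrow> v \<in> T2 \<Longrightarrow> v = 0"
    and span: "\<And>v. \<exists>x\<in>T1. \<exists>y\<in>T2. v = x + y"
  obtains \<sigma> where "linear \<sigma>" "\<And>x y. x \<in> T1 \<Longrightarrow> y \<in> T2 \<Longrightarrow> \<sigma> (x + y) = x - y"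
proof -
  have "\<forall>v. \<exists>s. \<exists>x\<in>T1. \<exists>y\<in>T2. v = x + y \<and> s = x - y" using span by blast
  then obtain \<sigma> where \<sigma>_exists: "\<And>v. \<exists>x\<in>T1. \<exists>y\<in>T2. v = x + y \<and> \<sigma> v = x - y" by metis
  have \<sigma>: "\<sigma> (x + y) = x - y" if xy: "x \<in> T1" "y \<in> T2" for x y
  proof -
    obtain x' y' where xy': "x' \<in> T1" "y' \<in> T2" "x + y = x' + y'" "\<sigma> (x + y) = x' - y'"
      using \<sigma>_exists by blast
    have difference: "x - x' = y' - y" using xy'(3) by (simp add: algebra_simps)
    moreover have "x - x' \<in> T1" "y' - y \<in> T2" using T xy xy' by (auto intro: subspace_diff)
    ultimately have "x - x' = 0" using disjoint by metis
    then show ?thesis using difference xy' by simp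
  qed
  have "linear \<sigma>"
  proof (rule linearI)
    fix v w
    obtain x y x' y' where v: "x \<in> T1" "y \<in> T2" "v = x + y" and w: "x' \<in> T1" "y' \<in> T2" "w = x' + y'"
      using span by metis
    have "\<sigma> (v + w) = \<sigma> ((x + x') + (y + y'))" by (simp add: v w algebra_simps)
    also have "\<dots> = (x + x') - (y + y')" using v w T by (intro \<sigma> subspace_add)
    finally show "\<sigma> (v + w) = \<sigma> v + \<sigma> w" using \<sigma> v w by simp
  next
    fix r v
    obtain x y where v: "x \<in> T1" "y \<in> T2" "v = x + y" using span by blast
    have "\<sigma> (r *\<^sub>R v) = r *\<^sub>R x - r *\<^sub>R y"
      using \<sigma>[of "r *\<^sub>R x" "r *\<^sub>R y"] v T by (simp add: subspace_scale scaleR_add_right)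
    then show "\<sigma> (r *\<^sub>R v) = r *\<^sub>R \<sigma> v" using \<sigma> v by (simp add: scaleR_diff_right)
  qed
  with \<sigma> show thesis by (rule that[rotated])
qed

lemma lagrangian_pair_bilinear_form:
  fixes \<Omega> :: "complex^'n::finite \<Rightarrow> complex^'n \<Rightarrow> real"
  assumes \<Omega>: "bounded_bilinear \<Omega>" and alternating: "\<And>a b. \<Omega> a b = - \<Omega> b a"
    and tame: "\<And>a. a \<noteq> 0 \<Longrightarrow> 0 < \<Omega> a (\<i> *s a)" and T: "subspace T1" "subspace T2"
    and lagrangian: "\<And>a b. a \<in> T1 \<Longrightarrow> b \<in> T1 \<Longrightarrow> \<Omega> a b = 0" "\<And>a b. a \<in> T2 \<Longrightarrow> b \<in> T2 \<Longrightarrow> \<Omega> a b = 0"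
    and span: "\<And>v. \<exists>x\<in>T1. \<exists>y\<in>T2. v = x + y"
  obtains B where "bounded_bilinear B" "\<And>v. v \<in> T1 \<Longrightarrow> v \<noteq> 0 \<Longrightarrow> 0 < Re (complexify_bilinear B v v)"
    "\<And>v. v \<in> T2 \<Longrightarrow> v \<noteq> 0 \<Longrightarrow> Re (complexify_bilinear B v v) < 0"
proof -
  interpret \<Omega>: bounded_bilinear \<Omega> by fact
  have "v = 0" if "v \<in> T1" "v \<in> T2" for v
  proof -
    obtain x y where "x \<in> T1" "y \<in> T2" "\<i> *s v = x + y" using span by blast
    then have "\<Omega> v (\<i> *s v) = 0" using lagrangian that by (simp add: \<Omega>.add_right)
    then show ?thesis using tame[of v] by (cases "v = 0") auto
  qed
  then obtain \<sigma> where "linear \<sigma>" and \<sigma>: "\<And>x y. x \<in> T1 \<Longrightarrow> y \<in> T2 \<Longrightarrow> \<sigma> (x + y) = x - y"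
    using complementary_reflection[OF T _ span] by metis
  have skew: "\<Omega> (\<sigma> v) w = - \<Omega> v (\<sigma> w)" for v w
  proof -
    obtain x y x' y' where "x \<in> T1" "y \<in> T2" "v = x + y" "x' \<in> T1" "y' \<in> T2" "w = x' + y'"
      using span by metis
    then show ?thesis
      using \<sigma> lagrangian by (simp add: \<Omega>.add_left \<Omega>.add_right \<Omega>.diff_left \<Omega>.diff_right)
  qed
  define B where "B v w = \<Omega> (\<sigma> v) (\<i> *s w)" for v w
  have "bounded_bilinear B"
    unfolding B_def
    by (intro \<Omega>.comp bounded_linear_i_scale) (use \<open>linear \<sigma>\<close> in \<open>simp add: linear_conv_bounded_linear\<close>)
  moreover have "Re (complexify_bilinear B v v) = 2 * \<Omega> (\<sigma> v) (\<i> *s v)" for v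
    using skew[of "\<i> *s v" v] alternating[of "\<sigma> v" "\<i> *s v"]
    by (simp add: B_def i_scale_i_scale \<Omega>.minus_right del: vector_smult_assoc)
  moreover have "\<sigma> v = v" if "v \<in> T1" for v using \<sigma>[OF that subspace_0[OF T(2)]] by simp
  moreover have "\<sigma> v = - v" if "v \<in> T2" for v using \<sigma>[OF subspace_0[OF T(1)] that] by simp
  ultimately show thesis
    using that[of B] tame by (simp add: \<Omega>.minus_left)
qed

lemma quadratic_pos_on_zero_set:
  fixes q :: "'a::euclidean_space \<Rightarrow> real" and G :: "'a \<Rightarrow> 'b::real_normed_vector"
  assumes q: "continuous_on UNIV q" "\<And>r v. q (r *\<^sub>R v) = r\<^sup>2 * q v"
    and G: "(G has_derivative G') (at a)" "G a = 0" and pos: "\<And>v. G' v = 0 \<Longrightarrow> v \<noteq> 0 \<Longrightarrow> 0 < q v"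
  obtains r m where "0 < r" "0 < m" "\<And>z. z \<in> ball a r \<Longrightarrow> G z = 0 \<Longrightarrow> m * (norm (z - a))\<^sup>2 \<le> q (z - a)"
proof -
  interpret G': bounded_linear G' by (rule has_derivative_bounded_linear[OF G(1)])
  let ?q = "\<lambda>_ v. max (q v) ((norm (G' v))\<^sup>2)"
  obtain m r0 where m: "0 < m" and r0: "0 < r0" "cball a r0 \<subseteq> UNIV"
    and lower_bound: "\<And>x v. x \<in> cball a r0 \<Longrightarrow> m * (norm v)\<^sup>2 \<le> ?q x v"
  proof (rule pos_quadratic_family_lower_bound[OF open_UNIV UNIV_I, of ?q])
    show "continuous_on (UNIV \<times> sphere 0 1) (\<lambda>(x, v). ?q x v)"
      unfolding case_prod_beta
      by (intro continuous_on_max continuous_intros G'.continuous_on continuous_on_compose2[OF q(1)]) auto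
    show "?q x (r *\<^sub>R v) = r\<^sup>2 * ?q x v" for x v and r :: real
      by (simp add: q(2) G'.scaleR power_mult_distrib max_mult_distrib_left)
    show "0 < ?q a v" if "v \<noteq> 0" for v
      using pos[OF _ that] by (cases "G' v = 0") (auto simp: less_max_iff_disj)
  qed (rule that)
  have "0 < sqrt m / 2" using m by simp
  then obtain r where r: "0 < r"
      "\<And>z. norm (z - a) < r \<Longrightarrow> norm (G z - G a - G' (z - a)) \<le> sqrt m / 2 * norm (z - a)"
    using G(1) unfolding has_derivative_at_alt by meson
  show thesis
  proof (rule that[OF r(1) m])
    fix z assume z: "z \<in> ball a r" "G z = 0"
    show "m * (norm (z - a))\<^sup>2 \<le> q (z - a)"
    proof (cases "z = a")
      case True
      then show ?thesis using q(2)[of 0 0] by simp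
    next
      case False
      have "norm (G' (z - a)) \<le> sqrt m / 2 * norm (z - a)"
        using r(2)[of z] z G(2) by (simp add: dist_norm norm_minus_commute)
      then have "(norm (G' (z - a)))\<^sup>2 \<le> (sqrt m / 2 * norm (z - a))\<^sup>2" by (intro power_mono) auto
      also have "\<dots> = m / 4 * (norm (z - a))\<^sup>2" using m by (simp add: power_mult_distrib power_divide)
      also have "\<dots> < m * (norm (z - a))\<^sup>2" using m False by simp
      finally show ?thesis using lower_bound[of a "z - a"] r0(1) by simp
    qed
  qed
qed

lemma sector_barrier_near_totally_real_zero:
  fixes G :: "complex^'n::finite \<Rightarrow> 'b::euclidean_space"
  assumes N: "open N" "a \<in> N" and G: "Ck_on 2 G N" "G a = 0"
    and totally_real: "\<And>v. frechet_derivative G (at a) v = 0 \<Longrightarrow>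
        frechet_derivative G (at a) (\<i> *s v) = 0 \<Longrightarrow> v = 0"
    and B: "bounded_bilinear B"
    and pos: "\<And>v. frechet_derivative G (at a) v = 0 \<Longrightarrow> v \<noteq> 0 \<Longrightarrow> 0 < Re (complexify_bilinear B v v)"
  obtains r c where "0 < r" "0 < c" "ball a r \<subseteq> N"
    "sector_barrier a r c (\<lambda>z. complexify_bilinear B (z - a) (z - a)) (\<lambda>z. (norm (G z))\<^sup>2)"
proof -
  let ?C = "complexify_bilinear B"
  interpret C: bounded_bilinear ?C by (rule bounded_bilinear_complexify_bilinear[OF B])
  obtain r1 m where m: "0 < r1" "0 < m"
      "\<And>z. z \<in> ball a r1 \<Longrightarrow> G z = 0 \<Longrightarrow> m * (norm (z - a))\<^sup>2 \<le> Re (?C (z - a) (z - a))"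
  proof (rule quadratic_pos_on_zero_set[OF _ _ Ck_on_2D(1)[OF G(1) N(2)] G(2) pos])
    show "continuous_on UNIV (\<lambda>v. Re (?C v v))"
      by (intro bounded_linear.continuous_on[OF bounded_linear_Re] C.continuous_on continuous_on_id)
    show "Re (?C (r *\<^sub>R v) (r *\<^sub>R v)) = r\<^sup>2 * Re (?C v v)" for r v
      unfolding C.scaleR_left C.scaleR_right by (simp add: power2_eq_square del: Re_complexify_bilinear)
  qed (use that in auto)
  obtain K where K: "0 < K" "\<And>v. cmod (?C v v) \<le> norm v * norm v * K" using C.pos_bounded by blast
  obtain r2 \<kappa> where \<kappa>: "0 < r2" "0 < \<kappa>" "ball a r2 \<subseteq> N" "uniformly_psh \<kappa> (ball a r2) (\<lambda>z. (norm (G z))\<^sup>2)"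
    using uniformly_psh_near_totally_real_zero[OF N G totally_real] by blast
  define r where "r = min r1 r2"
  have r: "ball a r \<subseteq> ball a r1" "ball a r \<subseteq> ball a r2" by (auto simp: r_def)
  have "?C (z - a) (z - a) \<in> sector (m / K)" if z: "z \<in> ball a r - {a}" "(norm (G z))\<^sup>2 = 0" for z
  proof -
    have lower: "m * (norm (z - a))\<^sup>2 \<le> Re (?C (z - a) (z - a))" using m(3) z r(1) by auto
    have "m / K * cmod (?C (z - a) (z - a)) \<le> m / K * (norm (z - a) * norm (z - a) * K)"
      using K m(2) by (intro mult_left_mono) auto
    also have "\<dots> = m * (norm (z - a))\<^sup>2" using K(1) by (simp add: power2_eq_square)
    moreover have "0 < m * (norm (z - a))\<^sup>2" using m(2) z(1) by simp
    ultimately show ?thesis using lower unfolding sector_def by (intro CollectI conjI) linarith+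
  qed
  then have "sector_barrier a r (m / K) (\<lambda>z. ?C (z - a) (z - a)) (\<lambda>z. (norm (G z))\<^sup>2)"
    unfolding sector_barrier_def using uniformly_psh_subset[OF \<kappa>(4) r(2)] \<kappa>(2) G(2) by auto
  then show thesis
    using that[of r "m / K"] m K(1) \<kappa> r(2) by (auto simp: r_def)
qed

context taming_form
begin

lemma lagrangian_tangent_coords:
  assumes L: "lagrangian_submanifold A \<omega> L" "p \<in> L" and \<phi>: "\<phi> \<in> A" "p \<in> fst \<phi>"
  shows "subspace (tangent_coords \<phi> L p)"
    and "v \<in> tangent_coords \<phi> L p \<Longrightarrow> w \<in> tangent_coords \<phi> L p \<Longrightarrow> form_at \<phi> p v w = 0"
  using L subspace_tangent_coords[OF _ L(2) \<phi>]
  by (auto simp: lagrangian_submanifold_def mem_tangent_coords_iff[OF \<phi>] form_at_def)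

lemma transverse_tangent_coords:
  assumes "transverse_at A L1 L2 p" and \<phi>: "\<phi> \<in> A" "p \<in> fst \<phi>"
  shows "\<exists>x\<in>tangent_coords \<phi> L1 p. \<exists>y\<in>tangent_coords \<phi> L2 p. v = x + y"
proof -
  obtain u w where "u \<in> submanifold_tangent_space A L1 p" "w \<in> submanifold_tangent_space A L2 p"
      "coord_vec A \<phi> p v = tv_add u w"
    using assms(1) coord_vec_tangent[OF \<phi>, of v] unfolding transverse_at_def by auto
  moreover from this have "v = u \<phi> + w \<phi>" using coord_vec_self[OF \<phi>, of v] by (simp add: tv_add_def)
  ultimately show ?thesis unfolding tangent_coords_def by blast
qed

lemma transverse_lagrangian_bilinear_form:
  assumes L1: "lagrangian_submanifold A \<omega> L1" and L2: "lagrangian_submanifold A \<omega> L2"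
    and transverse: "transverse_at A L1 L2 p" and \<phi>: "\<phi> \<in> A" "p \<in> fst \<phi>"
  obtains B where "bounded_bilinear B"
    "\<And>v. v \<in> tangent_coords \<phi> L1 p \<Longrightarrow> v \<noteq> 0 \<Longrightarrow> 0 < Re (complexify_bilinear B v v)"
    "\<And>v. v \<in> tangent_coords \<phi> L2 p \<Longrightarrow> v \<noteq> 0 \<Longrightarrow> Re (complexify_bilinear B v v) < 0"
proof -
  have p: "p \<in> L1" "p \<in> L2" using transverse by (auto simp: transverse_at_def)
  show thesis
    by (rule lagrangian_pair_bilinear_form[OF bounded_bilinear_form_at[OF \<phi>] form_at_bilinear(3)[OF \<phi>]
        form_at_tame[OF \<phi>]
          lagrangian_tangent_coords(1)[OF L1 p(1) \<phi>] lagrangian_tangent_coords(1)[OF L2 p(2) \<phi>]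
          lagrangian_tangent_coords(2)[OF L1 p(1) \<phi>] lagrangian_tangent_coords(2)[OF L2 p(2) \<phi>]
          transverse_tangent_coords[OF transverse \<phi>]])
       (use that in blast)+
qed

definition has_sector_barrier :: "('m, 'n) chart \<Rightarrow> 'm \<Rightarrow> (complex^'n \<Rightarrow> complex) \<Rightarrow> 'm set \<Rightarrow> bool" where
  "has_sector_barrier \<phi> p P S \<longleftrightarrow>
     (\<exists>r>0. \<exists>c>0. \<exists>\<rho>. ball (snd \<phi> p) r \<subseteq> snd \<phi> ` fst \<phi> \<and> sector_barrier (snd \<phi> p) r c P \<rho> \<and>
       (\<forall>z\<in>ball (snd \<phi> p) r. chart_inv \<phi> z \<in> S \<longleftrightarrow> \<rho> z = 0))"

lemma lagrangian_sector_barrier: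
  assumes L: "lagrangian_submanifold A \<omega> L" "p \<in> L" and \<phi>: "\<phi> \<in> A" "p \<in> fst \<phi>" and B: "bounded_bilinear B"
    and pos: "\<And>v. v \<in> tangent_coords \<phi> L p \<Longrightarrow> v \<noteq> 0 \<Longrightarrow> 0 < Re (complexify_bilinear B v v)"
  shows "has_sector_barrier \<phi> p (\<lambda>z. complexify_bilinear B (z - snd \<phi> p) (z - snd \<phi> p)) L"
proof -
  let ?P = "\<lambda>z. complexify_bilinear B (z - snd \<phi> p) (z - snd \<phi> p)"
  have "embedded_submanifold A CARD('n) L" using L(1) by (simp add: lagrangian_submanifold_def)
  then obtain N and G :: "complex^'n \<Rightarrow> complex^'n"
    where N: "open N" "snd \<phi> p \<in> N" "N \<subseteq> snd \<phi> ` fst \<phi>" and G: "\<And>k. Ck_on k G N"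
      "\<And>z. z \<in> N \<Longrightarrow> chart_inv \<phi> z \<in> L \<longleftrightarrow> G z = 0"
    and kernel: "tangent_coords \<phi> L p = {v. frechet_derivative G (at (snd \<phi> p)) v = 0}"
    by (rule submanifold_defining_map[OF _ L(2) \<phi>]) (rule that)
  have G_p: "G (snd \<phi> p) = 0" using G(2)[OF N(2)] chart_inv_chart[OF \<phi>] L(2) by simp
  obtain r c where r: "0 < r" "0 < c" "ball (snd \<phi> p) r \<subseteq> N"
    and barrier: "sector_barrier (snd \<phi> p) r c ?P (\<lambda>z. (norm (G z))\<^sup>2)"
  proof (rule sector_barrier_near_totally_real_zero[OF N(1,2) G(1) G_p _ B])
    fix v assume "frechet_derivative G (at (snd \<phi> p)) v = 0"
        "frechet_derivative G (at (snd \<phi> p)) (\<i> *s v) = 0"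
    then have "form_at \<phi> p v (\<i> *s v) = 0" using kernel by (intro lagrangian_tangent_coords(2)[OF L \<phi>]) auto
    then show "v = 0" using form_at_tame[OF \<phi>, of v] by (cases "v = 0") auto
  qed (use pos kernel that in auto)
  have "chart_inv \<phi> z \<in> L \<longleftrightarrow> (norm (G z))\<^sup>2 = 0" if "z \<in> ball (snd \<phi> p) r" for z
    using G(2)[of z] r(3) that by auto
  then show ?thesis
    unfolding has_sector_barrier_def using r(1,2) subset_trans[OF r(3) N(3)] barrier by blast
qed

lemma locally_psh_convex_sector_barriers:
  assumes \<phi>: "\<phi> \<in> A" "p \<in> fst \<phi>" and P: "holo_fun_on P UNIV" "P (snd \<phi> p) = 0"
    and S1: "has_sector_barrier \<phi> p P S1" and S2: "has_sector_barrier \<phi> p (\<lambda>z. - P z) S2"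
  shows "locally_psh_convex A \<omega> (S1 \<union> S2) p"
proof -
  obtain r1 c1 \<rho>1 where r1: "0 < r1" "0 < c1" "ball (snd \<phi> p) r1 \<subseteq> snd \<phi> ` fst \<phi>"
    and \<rho>1: "sector_barrier (snd \<phi> p) r1 c1 P \<rho>1"
      "\<And>z. z \<in> ball (snd \<phi> p) r1 \<Longrightarrow> chart_inv \<phi> z \<in> S1 \<longleftrightarrow> \<rho>1 z = 0"
    using S1 unfolding has_sector_barrier_def by blast
  obtain r2 c2 \<rho>2 where r2: "0 < r2" "0 < c2" and \<rho>2: "sector_barrier (snd \<phi> p) r2 c2 (\<lambda>z. - P z) \<rho>2"
      "\<And>z. z \<in> ball (snd \<phi> p) r2 \<Longrightarrow> chart_inv \<phi> z \<in> S2 \<longleftrightarrow> \<rho>2 z = 0"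
    using S2 unfolding has_sector_barrier_def by blast
  define r c where "r = min r1 r2" and "c = min 1 (min c1 c2)"
  let ?B = "ball (snd \<phi> p) r"
  have barriers: "sector_barrier (snd \<phi> p) r c P \<rho>1" "sector_barrier (snd \<phi> p) r c (\<lambda>z. - P z) \<rho>2"
    by (rule sector_barrier_mono[OF \<rho>1(1)] sector_barrier_mono[OF \<rho>2(1)]; simp add: r_def c_def)+
  have zero_set: "{z \<in> ?B. chart_inv \<phi> z \<in> S1 \<union> S2} = {z \<in> ?B. \<rho>1 z * \<rho>2 z = 0}"
    using \<rho>1(2) \<rho>2(2) by (auto simp: r_def)
  have "p \<in> S1 \<union> S2"
    using \<rho>1(2)[of "snd \<phi> p"] r1(1) \<rho>1(1) chart_inv_chart[OF \<phi>] by (simp add: sector_barrier_def)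
  then show ?thesis
  proof (rule locally_psh_convexI[OF \<phi>])
    show "0 < r" "?B \<subseteq> snd \<phi> ` fst \<phi>" using r1 r2(1) by (auto simp: r_def)
    show "closedin (top_of_set ?B) {z \<in> ?B. chart_inv \<phi> z \<in> S1 \<union> S2}"
      unfolding zero_set using barriers
      by (intro continuous_closedin_preimage_constant continuous_intros)
         (auto simp: sector_barrier_def intro: uniformly_psh_continuous)
    show "hull_in ?B K \<subseteq> K"
      if "compact K" "snd \<phi> p \<in> K" "K \<subseteq> {z \<in> ?B. chart_inv \<phi> z \<in> S1 \<union> S2}" for K
      using that(3) unfolding zero_set
      by (intro hull_in_two_sectors[OF that(1,2) _ holo_fun_on_subset[OF P(1)] P(2) _ _ barriers])
         (use r1(2) r2(2) in \<open>auto simp: c_def\<close>)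
  qed
qed

end

theorem proposition3p2:
  fixes A :: "('m::{t2_space, second_countable_topology}, 'n::finite) chart set"
    and \<omega> :: "('m, 'n) two_form"
    and L1 L2 :: "'m set"
    and p :: 'm
  assumes "complex_atlas A"
    and "stein_on A UNIV"
    and "symplectic_form A \<omega>"
    and "tames_J A \<omega>"
    and "lagrangian_submanifold A \<omega> L1"
    and "lagrangian_submanifold A \<omega> L2"
    and "transverse_at A L1 L2 p"
  shows "locally_psh_convex A \<omega> (L1 \<union> L2) p"
proof -
  interpret taming_form A \<omega>
    by unfold_locales (use assms in \<open>auto simp: symplectic_form_def\<close>)
  have p: "p \<in> L1" "p \<in> L2" using assms(7) by (auto simp: transverse_at_def)
  obtain \<phi> where \<phi>: "\<phi> \<in> A" "p \<in> fst \<phi>" using chart_covers by blast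
  obtain B where B: "bounded_bilinear B"
    and pos: "\<And>v. v \<in> tangent_coords \<phi> L1 p \<Longrightarrow> v \<noteq> 0 \<Longrightarrow> 0 < Re (complexify_bilinear B v v)"
    and neg: "\<And>v. v \<in> tangent_coords \<phi> L2 p \<Longrightarrow> v \<noteq> 0 \<Longrightarrow> Re (complexify_bilinear B v v) < 0"
    using transverse_lagrangian_bilinear_form[OF assms(5-7) \<phi>] by blast
  let ?P = "\<lambda>z. complexify_bilinear B (z - snd \<phi> p) (z - snd \<phi> p)"
  have P: "holo_fun_on ?P UNIV" "?P (snd \<phi> p) = 0"
    using holo_fun_on_translate[OF holo_fun_on_complexify_bilinear[OF B, of UNIV], of UNIV "- snd \<phi> p"]
      bounded_bilinear.zero_left[OF bounded_bilinear_complexify_bilinear[OF B]] by simp_all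
  have "has_sector_barrier \<phi> p ?P L1"
    by (rule lagrangian_sector_barrier[OF assms(5) p(1) \<phi> B pos])
  moreover have "has_sector_barrier \<phi> p (\<lambda>z. - ?P z) L2"
    using lagrangian_sector_barrier[OF assms(6) p(2) \<phi> bounded_bilinear_uminus[OF B]] neg
    by (simp add: complexify_bilinear_uminus)
  ultimately show ?thesis by (rule locally_psh_convex_sector_barriers[OF \<phi> P])
qed

end
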